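(* (G-admissibility for points.) Let $X=\{P_1,\dots,P_r\}$ be a set of distinct points of $\mathbb P^n_{\mathbf k}\setminus\{x_n=0\}$, not contained in a hyperplane, of socle degree $s$, and let $L_1,\dots,L_r$ be the associated linear forms. Given $\alpha_1,\dots,\alpha_r\in\mathbf k^*$, consider the $R$-submodule $M$ of $\Gamma$ generated by the elements $$F_t:=\frac{1}{(t+s-1)!}\sum_{i=1}^r\alpha_iL_i^{t+s-1},\qquad t\ge1 .$$ Then $M=I(X)^\perp$ is $G$-admissible (and equivalently $X$ is arithmetically Gorenstein) if and only if the following conditions hold: (1) $\sum_{i=1}^r\alpha_iL_i^{s-1}=0$; (2) $\langle F_1\rangle=\operatorname{Ann}_R(F_s)\circ F_{s+1}$.
   Context: $\mathbf k$ is an algebraically closed field of characteristic zero, $R=\mathbf k[x_0,\dots,x_n]$ (standard graded) and $\Gamma=\mathbf k[y_0,\dots,y_n]$. $R$ acts on $\Gamma$ by differentiation: $f\circ g=f(\partial_{y_0},\dots,\partial_{y_n})(g)$, making $\Gamma$ an $R$-module. For elements $G_j\in\Gamma$, $\langle G_j\rangle$ denotes the $R$-submodule of $\Gamma$ they generate. For an ideal $I\subset R$, $I^\perp=\{G\in\Gamma: I\circ G=0\}$; for $G\in\Gamma$, $\operatorname{Ann}_R(G)=\operatorname{Ann}_R(\langle G\rangle)=\{g\in R: g\circ G=0\}$; for an ideal $\mathfrak a\subset R$, $\mathfrak a\circ G=\{g\circ G: g\in\mathfrak a\}$. $I(X)\subset R$ is the homogeneous defining ideal of $X$. $X$ is arithmetically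 Gorenstein if $R/I(X)$ is a Gorenstein ring. With $\mathrm{HF}_X(t)=\dim_{\mathbf k}(R/I(X))_t$, the socle degree $s$ of $X$ (that is, of $R/I(X)$) is the largest $t$ with $\mathrm{HF}_X(t)-\mathrm{HF}_X(t-1)\ne0$. The linear form associated to $P=[a_0,\dots,a_n]$ is $L=a_0y_0+\cdots+a_ny_n\in\Gamma$; since the points lie off $\{x_n=0\}$, their representatives are chosen with $a_n=1$. An $R$-submodule $M$ of $\Gamma$ is $G$-admissible with respect to a linear form $z\in R$ if it admits a countable system of generators $\{F_l\}_{l\ge1}$ such that: (i) $z\circ F_l=F_{l-1}$ for $l>1$ and $z\circ F_1=0$; (ii) $\operatorname{Ann}_R(\langle F_l\rangle)\circ F_{l+1}=\langle F_1\rangle$ for all $l\ge1$. A family $\{F_l\}_{l\ge1}$ satisfying (i) and (ii) is also called $G$-admissible with respect to $z$. Here "$G$-admissible" means $G$-admissible with respect to $z=x_n$.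
   Formalization: For fixed α, (1),(2) are proved equivalent to the family {F_t} being G-admissible; M is G-admissible iff X is arithmetically Gorenstein iff (1),(2) hold for some nonzero α (as literally stated, for every given α, it fails for 4 general points of P²); n≥1 is assumed. *)

theory Defs
  imports
    "HOL-Library.Poly_Mapping"
    "HOL-Library.Extended_Nat"
    "HOL-Algebra.Algebraic_Closure_Type"
begin

section \<open>Polynomials and the differentiation action\<close>

text \<open>
  A polynomial in the variables indexed by the finite type \<open>'v\<close> is a finitely supported map from
  exponent vectors to coefficients.  The same type serves for both polynomial rings
  $R = k[x_0,\dots,x_n]$ and $\Gamma = k[y_0,\dots,y_n]$, with \<open>card (UNIV :: 'v set) = n + 1\<close>.
\<close>

type_synonym ('v, 'k) mpoly = "('v \<Rightarrow>\<^sub>0 nat) \<Rightarrow>\<^sub>0 'k"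

definition Const :: "'k::zero \<Rightarrow> ('v, 'k) mpoly"
  where "Const c = Poly_Mapping.single 0 c"

definition Var :: "'v \<Rightarrow> ('v, 'k::zero_neq_one) mpoly"
  where "Var v = Poly_Mapping.single (Poly_Mapping.single v 1) 1"

definition mdegree :: "('v::finite \<Rightarrow>\<^sub>0 nat) \<Rightarrow> nat"
  where "mdegree m = (\<Sum>v\<in>UNIV. Poly_Mapping.lookup m v)"

definition forms :: "nat \<Rightarrow> ('v::finite, 'k::zero) mpoly set"
  where "forms d = {f. \<forall>m\<in>Poly_Mapping.keys f. mdegree m = d}"

definition peval :: "('v::finite, 'k::comm_semiring_1) mpoly \<Rightarrow> ('v \<Rightarrow> 'k) \<Rightarrow> 'k"
  where "peval f a = (\<Sum>m\<in>Poly_Mapping.keys f. Poly_Mapping.lookup f m * (\<Prod>v\<in>UNIV. a v ^ Poly_Mapping.lookup m v))"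

text \<open>
  \<open>mono_diff m\<close> is the differential operator $\prod_v \partial_v^{m_v}$.  On a monomial $y^a$ it gives
  $\prod_v a_v (a_v - 1) \cdots (a_v - m_v + 1)\, y^{a - m}$; the subtractions are truncated, but the
  product contains a factor $0$ as soon as $m_v > a_v$ for some $v$.
\<close>

definition diff_coeff :: "('v::finite \<Rightarrow>\<^sub>0 nat) \<Rightarrow> ('v \<Rightarrow>\<^sub>0 nat) \<Rightarrow> nat"
  where "diff_coeff m a = (\<Prod>v\<in>UNIV. \<Prod>j<Poly_Mapping.lookup m v. Poly_Mapping.lookup a v - j)"

definition mono_diff ::
    "('v::finite \<Rightarrow>\<^sub>0 nat) \<Rightarrow> ('v, 'k::comm_semiring_1) mpoly \<Rightarrow> ('v, 'k) mpoly"
  where "mono_diff m g =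
    (\<Sum>a\<in>Poly_Mapping.keys g. Poly_Mapping.single (a - m) (of_nat (diff_coeff m a) * Poly_Mapping.lookup g a))"

definition dact ::
    "('v::finite, 'k::comm_semiring_1) mpoly \<Rightarrow> ('v, 'k) mpoly \<Rightarrow> ('v, 'k) mpoly"
    (infixr \<open>\<circle>\<close> 75)
  where "f \<circle> g = (\<Sum>m\<in>Poly_Mapping.keys f. Const (Poly_Mapping.lookup f m) * mono_diff m g)"

lemma mono_diff_superset:
  assumes "finite S" "Poly_Mapping.keys g \<subseteq> S"
  shows "mono_diff m g =
    (\<Sum>a\<in>S. Poly_Mapping.single (a - m) (of_nat (diff_coeff m a) * Poly_Mapping.lookup g a))"
  unfolding mono_diff_def
  by (rule sum.mono_neutral_left) (use assms in \<open>auto simp: in_keys_iff\<close>)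

lemma dact_superset:
  assumes "finite S" "Poly_Mapping.keys f \<subseteq> S"
  shows "f \<circle> g = (\<Sum>m\<in>S. Const (Poly_Mapping.lookup f m) * mono_diff m g)"
  unfolding dact_def
  by (rule sum.mono_neutral_left) (use assms in \<open>auto simp: in_keys_iff Const_def\<close>)

lemma mono_diff_zero [simp]: "mono_diff m 0 = 0"
  by (simp add: mono_diff_def)

lemma mono_diff_add: "mono_diff m (g + h) = mono_diff m g + mono_diff m h"
proof -
  let ?S = "Poly_Mapping.keys g \<union> Poly_Mapping.keys h"
  have "Poly_Mapping.keys (g + h) \<subseteq> ?S" by (rule Poly_Mapping.keys_add)
  then show ?thesis
    by (simp add: mono_diff_superset[of ?S] lookup_add distrib_left single_add sum.distrib)
qed

lemma mono_diff_sum: "mono_diff m (\<Sum>i\<in>A. g i) = (\<Sum>i\<in>A. mono_diff m (g i))"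
  by (induction A rule: infinite_finite_induct) (auto simp: mono_diff_add)

lemma mono_diff_single:
  "mono_diff m (Poly_Mapping.single a c) = Poly_Mapping.single (a - m) (of_nat (diff_coeff m a) * c)"
  by (simp add: mono_diff_superset[of "{a}"])

lemma mpoly_eq_sum_single: "g = (\<Sum>a\<in>Poly_Mapping.keys g. Poly_Mapping.single a (Poly_Mapping.lookup g a))"
  by (rule poly_mapping_eqI)
     (auto simp: lookup_sum lookup_single when_def in_keys_iff sum.delta)

lemma diff_coeff_add: "diff_coeff (m + m') a = diff_coeff m' a * diff_coeff m (a - m')"
proof -
  have *: "(\<Prod>j<p + q. x - j) = (\<Prod>j<q. x - j) * (\<Prod>j<p. x - q - j)" for p q x :: nat
    by (induction p) (auto simp: algebra_simps)
  show ?thesis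
    by (simp add: diff_coeff_def lookup_add lookup_minus * prod.distrib)
qed

lemma mono_diff_mono_diff: "mono_diff m (mono_diff m' g) = mono_diff (m + m') g"
  by (simp add: mono_diff_def[of m' g] mono_diff_sum mono_diff_single mono_diff_def[of "m + m'"]
      diff_coeff_add diff_diff_add add.commute mult_ac)

lemma mono_diff_Const: "mono_diff m (Const c * g) = Const c * mono_diff m g"
  by (subst (1 2) mpoly_eq_sum_single[of g])
     (simp add: sum_distrib_left mono_diff_sum Const_def mult_single mono_diff_single mult_ac)

lemma diff_coeff_zero [simp]: "diff_coeff 0 a = 1"
  by (simp add: diff_coeff_def)

lemma mono_diff_0 [simp]: "mono_diff 0 g = g"
  by (subst (2) mpoly_eq_sum_single) (simp add: mono_diff_def)

lemma dact_single: "Poly_Mapping.single m c \<circle> g = Const c * mono_diff m g"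
  by (simp add: dact_superset[of "{m}"])

lemma dact_add_left: "(f + h) \<circle> g = f \<circle> g + h \<circle> g"
proof -
  let ?S = "Poly_Mapping.keys f \<union> Poly_Mapping.keys h"
  have "Poly_Mapping.keys (f + h) \<subseteq> ?S" by (rule Poly_Mapping.keys_add)
  then show ?thesis
    by (simp add: dact_superset[of ?S] lookup_add Const_def single_add distrib_right sum.distrib)
qed

lemma dact_zero_left [simp]: "0 \<circle> g = 0"
  by (simp add: dact_def)

lemma dact_sum_left: "(\<Sum>i\<in>A. f i) \<circle> g = (\<Sum>i\<in>A. f i \<circle> g)"
  by (induction A rule: infinite_finite_induct) (auto simp: dact_add_left)

lemma dact_add_right: "f \<circle> (g + h) = f \<circle> g + f \<circle> h"
  by (simp add: dact_def mono_diff_add distrib_left sum.distrib)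

lemma dact_zero_right [simp]: "f \<circle> 0 = 0"
  by (simp add: dact_def)

lemma dact_sum_right: "f \<circle> (\<Sum>i\<in>A. g i) = (\<Sum>i\<in>A. f \<circle> g i)"
  by (induction A rule: infinite_finite_induct) (auto simp: dact_add_right)

lemma dact_one [simp]: "1 \<circle> g = g"
  using dact_single[of 0 1 g] by (simp add: Const_def)

lemma dact_mult: "(f * h) \<circle> g = f \<circle> (h \<circle> g)"
proof -
  have on_mono: "(Poly_Mapping.single m c * Poly_Mapping.single m' c') \<circle> g =
      Poly_Mapping.single m c \<circle> (Poly_Mapping.single m' c' \<circle> g)" for m m' c c'
    by (simp add: mult_single dact_single mono_diff_Const mono_diff_mono_diff)
       (simp add: Const_def mult_single flip: mult.assoc)
  show ?thesis
    by (subst (1 2) mpoly_eq_sum_single[of f], subst (1 2) mpoly_eq_sum_single[of h])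
       (simp add: sum_product dact_sum_left dact_sum_right on_mono, rule sum.swap)
qed

text \<open>$x_v$ acts as $\partial / \partial y_v$; with the module laws below this determines the action.\<close>

lemma dact_Var_single:
  "Var v \<circle> Poly_Mapping.single a c =
     Poly_Mapping.single (a - Poly_Mapping.single v 1) (of_nat (Poly_Mapping.lookup a v) * c)"
proof -
  have "diff_coeff (Poly_Mapping.single v 1) a = (\<Prod>u\<in>UNIV. if u = v then Poly_Mapping.lookup a v else 1)"
    unfolding diff_coeff_def by (intro prod.cong) (auto simp: lookup_single when_def)
  also have "\<dots> = Poly_Mapping.lookup a v"
    by simp
  finally show ?thesis
    by (simp add: Var_def dact_single mono_diff_single Const_def mult_single)
qed

global_interpretation Gam: Modules.module "dact :: ('v::finite, 'k::comm_ring_1) mpoly \<Rightarrow> _"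
  by unfold_locales (simp_all add: dact_add_left dact_add_right dact_mult)

definition ann :: "('v::finite, 'k::comm_ring_1) mpoly set \<Rightarrow> ('v, 'k) mpoly set"
  where "ann N = {g. \<forall>G\<in>N. g \<circle> G = 0}"

definition inv_sys :: "('v::finite, 'k::comm_ring_1) mpoly set \<Rightarrow> ('v, 'k) mpoly set"
  where "inv_sys I = {G. \<forall>g\<in>I. g \<circle> G = 0}"

text \<open>Families are indexed by $l \ge 1$; the value at $0$ is irrelevant.\<close>

definition G_admissible_family ::
    "('v::finite, 'k::comm_ring_1) mpoly \<Rightarrow> (nat \<Rightarrow> ('v, 'k) mpoly) \<Rightarrow> bool"
  where "G_admissible_family z F \<longleftrightarrow>
    (\<forall>l>1. z \<circle> F l = F (l - 1)) \<and> z \<circle> F 1 = 0 \<and>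
    (\<forall>l\<ge>1. (\<lambda>g. g \<circle> F (l + 1)) ` ann (Gam.span {F l}) = Gam.span {F 1})"

definition G_admissible ::
    "('v::finite, 'k::comm_ring_1) mpoly \<Rightarrow> ('v, 'k) mpoly set \<Rightarrow> bool"
  where "G_admissible z M \<longleftrightarrow> (\<exists>F. M = Gam.span (F ` {1..}) \<and> G_admissible_family z F)"


section \<open>Gorenstein rings\<close>

text \<open>The ring of fractions $S^{-1}A$ of a commutative ring \<open>A\<close>.\<close>

definition frac_rel :: "('a, 'b) ring_scheme \<Rightarrow> 'a set \<Rightarrow> (('a \<times> 'a) \<times> ('a \<times> 'a)) set"
  where "frac_rel A S = {((a, s), (b, t)). a \<in> carrier A \<and> s \<in> S \<and> b \<in> carrier A \<and> t \<in> S \<and>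
    (\<exists>u\<in>S. u \<otimes>\<^bsub>A\<^esub> (a \<otimes>\<^bsub>A\<^esub> t \<ominus>\<^bsub>A\<^esub> b \<otimes>\<^bsub>A\<^esub> s) = \<zero>\<^bsub>A\<^esub>)}"

definition frac :: "('a, 'b) ring_scheme \<Rightarrow> 'a set \<Rightarrow> 'a \<Rightarrow> 'a \<Rightarrow> ('a \<times> 'a) set"
  where "frac A S a s = frac_rel A S `` {(a, s)}"

definition fractions :: "('a, 'b) ring_scheme \<Rightarrow> 'a set \<Rightarrow> ('a \<times> 'a) set ring"
  where "fractions A S = \<lparr>
    carrier = (carrier A \<times> S) // frac_rel A S,
    monoid.mult = (\<lambda>x y. \<Union>(a, s)\<in>x. \<Union>(b, t)\<in>y. frac A S (a \<otimes>\<^bsub>A\<^esub> b) (s \<otimes>\<^bsub>A\<^esub> t)),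
    one = frac A S \<one>\<^bsub>A\<^esub> \<one>\<^bsub>A\<^esub>,
    ring.zero = frac A S \<zero>\<^bsub>A\<^esub> \<one>\<^bsub>A\<^esub>,
    add = (\<lambda>x y. \<Union>(a, s)\<in>x. \<Union>(b, t)\<in>y.
      frac A S (a \<otimes>\<^bsub>A\<^esub> t \<oplus>\<^bsub>A\<^esub> b \<otimes>\<^bsub>A\<^esub> s) (s \<otimes>\<^bsub>A\<^esub> t))\<rparr>"

definition krull_dim :: "('a, 'b) ring_scheme \<Rightarrow> enat"
  where "krull_dim B = Sup {enat d | d. \<exists>p. (\<forall>i\<le>d. primeideal (p i) B) \<and> (\<forall>i<d. p i \<subset> p (Suc i))}"

definition regular_sequence :: "('a, 'b) ring_scheme \<Rightarrow> 'a list \<Rightarrow> bool"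
  where "regular_sequence B xs \<longleftrightarrow> set xs \<subseteq> carrier B \<and> genideal B (set xs) \<noteq> carrier B \<and>
    (\<forall>i<length xs. \<forall>a\<in>carrier B.
       xs ! i \<otimes>\<^bsub>B\<^esub> a \<in> genideal B (set (take i xs)) \<longrightarrow> a \<in> genideal B (set (take i xs)))"

definition noetherian_local_ring :: "('a, 'b) ring_scheme \<Rightarrow> 'a set \<Rightarrow> bool"
  where "noetherian_local_ring B \<mm> \<longleftrightarrow>
    cring B \<and> noetherian_ring B \<and> maximalideal \<mm> B \<and> (\<forall>J. maximalideal J B \<longrightarrow> J = \<mm>)"

definition ideal_depth :: "('a, 'b) ring_scheme \<Rightarrow> 'a set \<Rightarrow> enat"
  where "ideal_depth B J = Sup {enat (length xs) | xs. regular_sequence B xs \<and> set xs \<subseteq> J}"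

definition system_of_parameters :: "('a, 'b) ring_scheme \<Rightarrow> 'a set \<Rightarrow> 'a list \<Rightarrow> bool"
  where "system_of_parameters B \<mm> xs \<longleftrightarrow> enat (length xs) = krull_dim B \<and> set xs \<subseteq> \<mm> \<and>
    {a \<in> carrier B. \<exists>k::nat. a [^]\<^bsub>B\<^esub> k \<in> genideal B (set xs)} = \<mm>"

definition irreducible_ideal :: "('a, 'b) ring_scheme \<Rightarrow> 'a set \<Rightarrow> bool"
  where "irreducible_ideal B J \<longleftrightarrow> ideal J B \<and> J \<noteq> carrier B \<and>
    (\<forall>J1 J2. ideal J1 B \<longrightarrow> ideal J2 B \<longrightarrow> J = J1 \<inter> J2 \<longrightarrow> J = J1 \<or> J = J2)"

text \<open>
  Gorenstein local rings are Cohen--Macaulay local rings all of whose parameter ideals are irreducible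
  (Matsumura, Commutative Ring Theory, Section 18); a Noetherian ring is Gorenstein if its
  localizations at maximal ideals are.
\<close>

definition gorenstein_local_ring :: "('a, 'b) ring_scheme \<Rightarrow> 'a set \<Rightarrow> bool"
  where "gorenstein_local_ring B \<mm> \<longleftrightarrow> noetherian_local_ring B \<mm> \<and>
    ideal_depth B \<mm> = krull_dim B \<and>
    (\<forall>xs. system_of_parameters B \<mm> xs \<longrightarrow> irreducible_ideal B (genideal B (set xs)))"

definition gorenstein_ring :: "('a, 'b) ring_scheme \<Rightarrow> bool"
  where "gorenstein_ring A \<longleftrightarrow> cring A \<and> noetherian_ring A \<and>
    (\<forall>\<mm>. maximalideal \<mm> A \<longrightarrow> (let B = fractions A (carrier A - \<mm>) in
       \<exists>\<nn>. gorenstein_local_ring B \<nn>))"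


section \<open>Finite sets of projective points\<close>

text \<open>Projective points are given by representatives of their homogeneous coordinates.\<close>

abbreviation mpoly_ring :: "('v, 'k::comm_ring_1) mpoly ring"
  where "mpoly_ring \<equiv> ring_of_type_algebra"

definition vanishing_ideal :: "('v::finite \<Rightarrow> 'k::comm_ring_1) set \<Rightarrow> ('v, 'k) mpoly set"
  where "vanishing_ideal \<X> =
    genideal mpoly_ring {f. (\<exists>d. f \<in> forms d) \<and> (\<forall>a\<in>\<X>. peval f a = 0)}"

definition arithmetically_gorenstein :: "('v::finite \<Rightarrow> 'k::comm_ring_1) set \<Rightarrow> bool"
  where "arithmetically_gorenstein \<X> \<longleftrightarrow> gorenstein_ring (mpoly_ring Quot vanishing_ideal \<X>)"

global_interpretation mpoly: Vector_Spaces.vector_space "\<lambda>c. (*) (Const c :: ('v, 'k::field) mpoly)"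
  by unfold_locales (simp_all add: Const_def algebra_simps single_add mult_single)

definition hilbert_fun :: "('v::finite \<Rightarrow> 'k::field) set \<Rightarrow> nat \<Rightarrow> nat"
  where "hilbert_fun \<X> t =
    mpoly.dim (forms t :: ('v, 'k) mpoly set) - mpoly.dim (vanishing_ideal \<X> \<inter> forms t)"

definition hilbert_diff :: "('v::finite \<Rightarrow> 'k::field) set \<Rightarrow> nat \<Rightarrow> int"
  where "hilbert_diff \<X> t =
    int (hilbert_fun \<X> t) - (if t = 0 then 0 else int (hilbert_fun \<X> (t - 1)))"

definition socle_degree :: "('v::finite \<Rightarrow> 'k::field) set \<Rightarrow> nat \<Rightarrow> bool"
  where "socle_degree \<X> s \<longleftrightarrow> hilbert_diff \<X> s \<noteq> 0 \<and> (\<forall>t>s. hilbert_diff \<X> t = 0)"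

definition in_hyperplane :: "('v::finite \<Rightarrow> 'k::field) set \<Rightarrow> bool"
  where "in_hyperplane \<X> \<longleftrightarrow> (\<exists>c. c \<noteq> (\<lambda>_. 0) \<and> (\<forall>a\<in>\<X>. (\<Sum>v\<in>UNIV. c v * a v) = 0))"

definition lin_form :: "('v::finite \<Rightarrow> 'k::comm_ring_1) \<Rightarrow> ('v, 'k) mpoly"
  where "lin_form a = (\<Sum>v\<in>UNIV. Const (a v) * Var v)"

end

theory Submission
  imports Defs
begin

text \<open>
  Let \<open>V\<^sub>d\<close> be the space of vectors of values at the points of the forms of degree \<open>d\<close>. As
  \<open>x\<^sub>n = 1\<close> on the points, \<open>V\<^sub>0 \<subseteq> V\<^sub>1 \<subseteq> \<dots>\<close>, and the chain reaches the whole space exactly at \<open>s\<close>.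
  A form \<open>f\<close> of degree \<open>d\<close> sends \<open>W v m = \<Sum>\<^sub>i v\<^sub>i L\<^sub>i\<^sup>m / m!\<close> to \<open>W (v f(P)) (m - d)\<close>, and
  \<open>W v m = 0\<close> iff \<open>v\<close> is orthogonal to \<open>V\<^sub>m\<close>. So both conditions of the theorem are statements on
  orthogonality of the \<open>V\<^sub>d\<close> with respect to the bilinear form with weights \<open>\<alpha>\<^sub>i\<close>.

  All equivalences pass through the statement that the socle of \<open>R/(I(X) + (x\<^sub>n))\<close> is one-dimensional.
  Given an admissible family, \<open>ker x\<^sub>n\<close> on the inverse system is generated by \<open>F\<^sub>1\<close>, whose
  annihilator is therefore \<open>I(X) + (x\<^sub>n)\<close>, and socle elements send \<open>F\<^sub>1\<close> to constants. Conversely the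
  functional on forms of degree \<open>s\<close> with kernel \<open>I(X) + (x\<^sub>n)\<close> is the sum of the values at the points
  with some weights \<open>\<beta>\<^sub>i\<close>, and these have the required properties.

  For the Gorenstein property, restriction to the \<open>r\<close> lines of the affine cone embeds \<open>R/I(X)\<close> in
  \<open>k[t]\<^sup>r\<close>, with everything of order at least \<open>s\<close> in the image. This describes the primes and shows that
  all localizations at maximal ideals have dimension and depth one. In such a ring the socles modulo two
  nonzerodivisors \<open>y\<close>, \<open>z\<close> of the maximal ideal are both isomorphic to the socle modulo \<open>y z\<close>, so
  irreducibility of parameter ideals can be tested on \<open>x\<^sub>n - c\<close>.
\<close>

section \<open>Socles of principal ideals in commutative rings\<close>

text \<open>The module \<open>M\<close> does not depend on the weights: forms of degree
  \<open>s\<close> take arbitrary values at the points, so any nonzero weights generate the whole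
  inverse system. Conditions (1) and (2) for a given \<alpha> therefore characterize admissibility
  of that one family, while admissibility of \<open>M\<close> and the Gorenstein property only
  provide some weights \<beta>. Condition (2) at the single level \<open>s\<close> suffices: the
  operators that matter there have degree \<open>2 * s - m\<close> with \<open>m \<le> s\<close>, so
  every vector of values occurs, and the other levels impose at most the same requirement. The
  weights \<beta> are nonzero because otherwise the indicator vector of a point, taken in the least
  degree where it occurs, would give a socle element of degree below \<open>s\<close>. The
  definition of Gorenstein quantifies over all localizations and all parameter ideals. Algebraic
  closedness makes every maximal ideal a point \<open>c P j\<close> of the affine cone. Away from
  the vertex only one line passes through it and the maximal ideal of the local ring is principal,
  so only the vertex imposes a condition.\<close>

context cring
begin

definition nonzerodivisor :: "'a \<Rightarrow> bool"
  where "nonzerodivisor y \<longleftrightarrow> (\<forall>x\<in>carrier R. y \<otimes> x = \<zero> \<longrightarrow> x = \<zero>)"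

text \<open>The elements multiplied by \<open>\<nn>\<close> into \<open>(y)\<close> form the socle
  modulo \<open>y\<close>. For maximal \<open>\<nn>\<close> the condition says, without forming the
  residue field, that this socle has dimension at most one.\<close>

definition socle_cyclic :: "'a set \<Rightarrow> 'a \<Rightarrow> bool"
  where "socle_cyclic \<nn> y \<longleftrightarrow> (\<forall>a\<in>carrier R. \<forall>b\<in>carrier R.
    (\<forall>n\<in>\<nn>. n \<otimes> a \<in> PIdl y) \<longrightarrow> (\<forall>n\<in>\<nn>. n \<otimes> b \<in> PIdl y) \<longrightarrow> a \<notin> PIdl y \<longrightarrow>
    (\<exists>c\<in>carrier R. b \<ominus> c \<otimes> a \<in> PIdl y))"

lemma ideal_if_closed:
  assumes "I \<subseteq> carrier R" "\<zero> \<in> I" "\<And>x y. x \<in> I \<Longrightarrow> y \<in> I \<Longrightarrow> x \<oplus> y \<in> I"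
    and cl: "\<And>a x. a \<in> carrier R \<Longrightarrow> x \<in> I \<Longrightarrow> a \<otimes> x \<in> I"
  shows "ideal I R"
proof (rule idealI)
  show "ring R" by (rule ring_axioms)
  have "\<ominus> x \<in> I" if "x \<in> I" for x
  proof -
    have "x \<in> carrier R" using that assms by auto
    then have "(\<ominus> \<one>) \<otimes> x = \<ominus> x" by (simp add: l_minus)
    then show ?thesis using cl[of "\<ominus> \<one>" x] that by simp
  qed
  then show "subgroup I (add_monoid R)"
    using assms by (intro add.subgroupI) (auto simp: a_inv_def)
  show "a \<otimes> x \<in> I" "x \<otimes> a \<in> I" if "x \<in> I" "a \<in> carrier R" for x a
    using that cl[of a x] assms(1) m_comm[of x a] by auto
qed

lemma nonzerodivisor_cancel:
  assumes "nonzerodivisor y" "y \<in> carrier R" "a \<in> carrier R" "b \<in> carrier R" "y \<otimes> a = y \<otimes> b"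
  shows "a = b"
proof -
  have "y \<otimes> (a \<ominus> b) = y \<otimes> a \<ominus> y \<otimes> b" using assms(2-4) by algebra
  also have "\<dots> = \<zero>" using assms by simp
  finally have "a \<ominus> b = \<zero>" using assms(1-4) by (simp add: nonzerodivisor_def)
  then show ?thesis using assms by simp
qed

lemma PIdl_mem_iff: "x \<in> PIdl y \<longleftrightarrow> (\<exists>p\<in>carrier R. x = p \<otimes> y)"
  by (auto simp: cgenideal_def)

text \<open>For \<open>a\<close> in the socle modulo \<open>z\<close>, write
  \<open>y \<otimes> a = a' \<otimes> z\<close>. Cancelling \<open>z\<close> shows that
  \<open>a'\<close> is in the socle modulo \<open>y\<close>; cancelling \<open>y\<close> shows that
  \<open>a'\<close> lies in \<open>(y)\<close> only if \<open>a\<close> lies in \<open>(z)\<close>.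
  The map from \<open>a\<close> to \<open>a'\<close> is the composite of the two isomorphisms with
  the socle modulo \<open>y \<otimes> z\<close>.\<close>

lemma socle_cyclic_transfer:
  assumes "y \<in> \<nn>" "z \<in> \<nn>" "\<nn> \<subseteq> carrier R" and y: "nonzerodivisor y" and z: "nonzerodivisor z"
    and soc: "socle_cyclic \<nn> y"
  shows "socle_cyclic \<nn> z"
  unfolding socle_cyclic_def
proof (intro ballI impI)
  fix a b assume a: "a \<in> carrier R" and b: "b \<in> carrier R"
    and na: "\<forall>n\<in>\<nn>. n \<otimes> a \<in> PIdl z" and nb: "\<forall>n\<in>\<nn>. n \<otimes> b \<in> PIdl z" and az: "a \<notin> PIdl z"
  have yc: "y \<in> carrier R" and zc: "z \<in> carrier R" using assms by auto
  obtain a' where a': "a' \<in> carrier R" "y \<otimes> a = a' \<otimes> z" using na \<open>y \<in> \<nn>\<close> by (auto simp: PIdl_mem_iff)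
  obtain b' where b': "b' \<in> carrier R" "y \<otimes> b = b' \<otimes> z" using nb \<open>y \<in> \<nn>\<close> by (auto simp: PIdl_mem_iff)
  have transfer: "\<forall>n\<in>\<nn>. n \<otimes> x' \<in> PIdl y"
    if x: "x \<in> carrier R" "x' \<in> carrier R" "y \<otimes> x = x' \<otimes> z" "\<forall>n\<in>\<nn>. n \<otimes> x \<in> PIdl z" for x x'
  proof
    fix n assume n: "n \<in> \<nn>"
    then have nc: "n \<in> carrier R" using assms by auto
    obtain p where p: "p \<in> carrier R" "n \<otimes> x = p \<otimes> z" using x(4) n by (auto simp: PIdl_mem_iff)
    have "z \<otimes> (n \<otimes> x') = n \<otimes> (x' \<otimes> z)" using nc zc x by algebra
    also have "\<dots> = n \<otimes> (y \<otimes> x)" using x by simp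
    also have "\<dots> = y \<otimes> (n \<otimes> x)" using nc yc x by algebra
    also have "\<dots> = y \<otimes> (p \<otimes> z)" using p by simp
    also have "\<dots> = z \<otimes> (p \<otimes> y)" using yc zc p(1) by algebra
    finally have "n \<otimes> x' = p \<otimes> y"
      by (rule nonzerodivisor_cancel[OF z zc, rotated 2]) (use nc x p yc in auto)
    then show "n \<otimes> x' \<in> PIdl y" using p by (auto simp: PIdl_mem_iff)
  qed
  have "a' \<notin> PIdl y"
  proof
    assume "a' \<in> PIdl y"
    then obtain q where q: "q \<in> carrier R" "a' = q \<otimes> y" by (auto simp: PIdl_mem_iff)
    have "y \<otimes> a = y \<otimes> (q \<otimes> z)" unfolding a'(2) q(2) using q(1) yc zc by algebra
    then have "a = q \<otimes> z"
      by (rule nonzerodivisor_cancel[OF y yc, rotated 2]) (use a q zc in auto)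
    then show False using az q by (auto simp: PIdl_mem_iff)
  qed
  then obtain c where c: "c \<in> carrier R" "b' \<ominus> c \<otimes> a' \<in> PIdl y"
    using soc a' b' transfer[OF a a' na] transfer[OF b b' nb] unfolding socle_cyclic_def by blast
  then obtain p where p: "p \<in> carrier R" "b' \<ominus> c \<otimes> a' = p \<otimes> y" by (auto simp: PIdl_mem_iff)
  have "y \<otimes> (b \<ominus> c \<otimes> a) = y \<otimes> b \<ominus> c \<otimes> (y \<otimes> a)" using yc a b c(1) by algebra
  also have "\<dots> = b' \<otimes> z \<ominus> c \<otimes> (a' \<otimes> z)" using a' b' by simp
  also have "\<dots> = (b' \<ominus> c \<otimes> a') \<otimes> z" using a'(1) b'(1) c(1) zc by algebra
  also have "\<dots> = (p \<otimes> y) \<otimes> z" using p by simp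
  also have "\<dots> = y \<otimes> (p \<otimes> z)" using p(1) yc zc by algebra
  finally have "b \<ominus> c \<otimes> a = p \<otimes> z"
    by (rule nonzerodivisor_cancel[OF y yc, rotated 2]) (use a b c p zc in auto)
  then show "\<exists>c\<in>carrier R. b \<ominus> c \<otimes> a \<in> PIdl z" using c p by (auto simp: PIdl_mem_iff)
qed

text \<open>For socle elements \<open>a\<close>, \<open>b\<close> outside \<open>(y)\<close>,
  irreducibility yields an \<open>e\<close> outside \<open>(y)\<close> in both \<open>(y, a)\<close>
  and \<open>(y, b)\<close>. The coefficient of \<open>b\<close> in \<open>e\<close> cannot lie in
  \<open>\<nn>\<close>, hence is a unit, and the two expressions for \<open>e\<close> can be solved
  for \<open>b\<close>.\<close>

lemma irreducible_imp_socle_cyclic: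
  assumes yc: "y \<in> carrier R" and units: "\<And>x. x \<in> carrier R \<Longrightarrow> x \<notin> \<nn> \<Longrightarrow> x \<in> Units R"
    and irr: "irreducible_ideal R (PIdl y)"
  shows "socle_cyclic \<nn> y"
  unfolding socle_cyclic_def
proof (intro ballI impI)
  fix a b assume a: "a \<in> carrier R" and b: "b \<in> carrier R"
    and na: "\<forall>n\<in>\<nn>. n \<otimes> a \<in> PIdl y" and nb: "\<forall>n\<in>\<nn>. n \<otimes> b \<in> PIdl y" and ay: "a \<notin> PIdl y"
  interpret Y: ideal "PIdl y" R by (rule cgenideal_ideal[OF yc])
  show "\<exists>c\<in>carrier R. b \<ominus> c \<otimes> a \<in> PIdl y"
  proof (cases "b \<in> PIdl y")
    case True
    have "b \<ominus> \<zero> \<otimes> a = b" using a b by algebra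
    then show ?thesis using True by (intro bexI[of _ \<zero>]) auto
  next
    case False
    define J where "J x = set_add R (PIdl y) (PIdl x)" for x
    have J: "ideal (J x) R" if "x \<in> carrier R" for x
      unfolding J_def by (intro add_ideals cgenideal_ideal yc that)
    have J_mem: "e \<in> J x \<longleftrightarrow> (\<exists>p\<in>carrier R. \<exists>q\<in>carrier R. e = p \<otimes> y \<oplus> q \<otimes> x)" for e x
      unfolding J_def set_add_def' cgenideal_def by blast
    have yJ: "PIdl y \<subseteq> J x" if "x \<in> carrier R" for x
    proof
      fix e assume "e \<in> PIdl y"
      then obtain p where "p \<in> carrier R" "e = p \<otimes> y" by (auto simp: PIdl_mem_iff)
      then show "e \<in> J x" unfolding J_mem using that yc by (intro bexI[of _ p] bexI[of _ \<zero>]) auto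
    qed
    have xJ: "x \<in> J x" if "x \<in> carrier R" for x
      unfolding J_mem using that yc by (intro bexI[of _ \<zero>] bexI[of _ \<one>]) auto
    have "PIdl y \<noteq> J a \<inter> J b"
      using irr J[OF a] J[OF b] xJ[OF a] xJ[OF b] ay False unfolding irreducible_ideal_def by metis
    then obtain e where e: "e \<in> J a" "e \<in> J b" "e \<notin> PIdl y" using yJ a b by blast
    obtain p q where pq: "p \<in> carrier R" "q \<in> carrier R" "e = p \<otimes> y \<oplus> q \<otimes> a" using e(1) J_mem by auto
    obtain p' q' where pq': "p' \<in> carrier R" "q' \<in> carrier R" "e = p' \<otimes> y \<oplus> q' \<otimes> b" using e(2) J_mem by auto
    have "q' \<notin> \<nn>"
    proof
      assume "q' \<in> \<nn>"
      then have "q' \<otimes> b \<in> PIdl y" using nb by auto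
      moreover have "p' \<otimes> y \<in> PIdl y" using pq' by (auto simp: PIdl_mem_iff)
      ultimately show False using e(3) pq' Y.a_closed by simp
    qed
    then have u: "q' \<in> Units R" using units pq' by auto
    define w where "w = inv q'"
    have w: "w \<in> carrier R" "w \<otimes> q' = \<one>" using u by (auto simp: w_def)
    have "b \<ominus> (w \<otimes> q) \<otimes> a = (w \<otimes> q') \<otimes> b \<ominus> (w \<otimes> q) \<otimes> a" using b w by simp
    also have "\<dots> = w \<otimes> ((p' \<otimes> y \<oplus> q' \<otimes> b) \<ominus> p' \<otimes> y \<ominus> q \<otimes> a)"
      using w(1) pq(1,2) pq'(1,2) a b yc by algebra
    also have "\<dots> = w \<otimes> ((p \<otimes> y \<oplus> q \<otimes> a) \<ominus> p' \<otimes> y \<ominus> q \<otimes> a)" using pq(3) pq'(3) by simp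
    also have "\<dots> = (w \<otimes> (p \<ominus> p')) \<otimes> y"
      using w(1) pq(1,2) pq'(1,2) a b yc by algebra
    finally have "b \<ominus> (w \<otimes> q) \<otimes> a \<in> PIdl y"
      using w pq pq' by (auto simp: PIdl_mem_iff)
    then show ?thesis using w pq by blast
  qed
qed

text \<open>Generators are treated one at a time: for a new \<open>g\<close>, the element
  \<open>a\<close> is replaced by the last \<open>g [^] j \<otimes> a\<close> that is still outside
  \<open>Q\<close>. The earlier generators keep multiplying it into \<open>Q\<close>.\<close>

lemma ideal_contains_socle_element:
  assumes fin: "finite G" "G \<subseteq> carrier R"
    and nil: "\<And>g. g \<in> G \<Longrightarrow> \<exists>k::nat. g [^] k \<in> Q"
    and Q: "ideal Q R" and J: "ideal J R" and nsub: "\<not> J \<subseteq> Q"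
  shows "\<exists>a\<in>J. a \<notin> Q \<and> (\<forall>g\<in>G. g \<otimes> a \<in> Q)"
  using fin nil
proof (induction G rule: finite_induct)
  case empty
  then show ?case using nsub by auto
next
  case (insert g G)
  interpret Q: ideal Q R by fact
  interpret J: ideal J R by fact
  obtain a where a: "a \<in> J" "a \<notin> Q" "\<forall>g\<in>G. g \<otimes> a \<in> Q" using insert by auto
  have ac: "a \<in> carrier R" and gc: "g \<in> carrier R" using a J.Icarr insert by auto
  obtain k :: nat where "g [^] k \<in> Q" using insert by blast
  then have ex: "\<exists>k::nat. g [^] k \<otimes> a \<in> Q" using ac Q.I_r_closed by blast
  define l where "l = (LEAST k::nat. g [^] k \<otimes> a \<in> Q)"
  have l: "g [^] l \<otimes> a \<in> Q" unfolding l_def using ex by (rule LeastI_ex)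
  have "l \<noteq> 0" using l a(2) ac by (cases l) auto
  then obtain j where j: "l = Suc j" by (cases l) auto
  have nj: "g [^] j \<otimes> a \<notin> Q" using not_less_Least[of j "\<lambda>k. g [^] k \<otimes> a \<in> Q"] j l_def by auto
  have "g \<otimes> (g [^] j \<otimes> a) = g [^] l \<otimes> a"
    unfolding j nat_pow_Suc using gc ac nat_pow_closed[OF gc, of j] by algebra
  then have 1: "g \<otimes> (g [^] j \<otimes> a) \<in> Q" using l by simp
  have 2: "h \<otimes> (g [^] j \<otimes> a) \<in> Q" if "h \<in> G" for h
  proof -
    have "h \<in> carrier R" using that insert by auto
    then have "h \<otimes> (g [^] j \<otimes> a) = g [^] j \<otimes> (h \<otimes> a)" using gc ac nat_pow_closed[OF gc, of j] by algebra
    then show ?thesis using a(3) that gc by (simp add: Q.I_l_closed)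
  qed
  show ?case
    using nj 1 2 a gc by (intro bexI[of _ "g [^] j \<otimes> a"]) (auto simp: J.I_l_closed)
qed

text \<open>If both ideals were strictly larger than \<open>(y)\<close>, each would contain a socle
  element outside \<open>(y)\<close>. These are proportional modulo \<open>(y)\<close>, so the
  second one lies in both ideals and hence in \<open>(y)\<close>.\<close>

lemma socle_cyclic_imp_irreducible:
  assumes yc: "y \<in> carrier R" and G: "finite G" "G \<subseteq> carrier R" "\<nn> = Idl G"
    and nil: "\<And>g. g \<in> G \<Longrightarrow> \<exists>k::nat. g [^] k \<in> PIdl y"
    and proper: "PIdl y \<noteq> carrier R" and soc: "socle_cyclic \<nn> y"
  shows "irreducible_ideal R (PIdl y)"
  unfolding irreducible_ideal_def
proof (intro conjI allI impI)
  show I: "ideal (PIdl y) R" by (rule cgenideal_ideal[OF yc])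
  interpret Y: ideal "PIdl y" R by fact
  show "PIdl y \<noteq> carrier R" by fact
  have ex: "\<exists>a\<in>J. a \<notin> PIdl y \<and> (\<forall>n\<in>\<nn>. n \<otimes> a \<in> PIdl y)" if J: "ideal J R" "\<not> J \<subseteq> PIdl y" for J
  proof -
    obtain a where a: "a \<in> J" "a \<notin> PIdl y" "\<forall>g\<in>G. g \<otimes> a \<in> PIdl y"
      using ideal_contains_socle_element[OF G(1,2) nil I J] by auto
    have ac: "a \<in> carrier R" using a ideal.Icarr[OF J(1)] by auto
    have "ideal {n \<in> carrier R. n \<otimes> a \<in> PIdl y} R"
    proof (rule ideal_if_closed)
      fix m n assume "m \<in> carrier R" "n \<in> {n \<in> carrier R. n \<otimes> a \<in> PIdl y}"
      then show "m \<otimes> n \<in> {n \<in> carrier R. n \<otimes> a \<in> PIdl y}"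
        using ac by (simp add: m_assoc Y.I_l_closed)
    qed (use ac in \<open>auto simp: l_distr\<close>)
    then have "\<nn> \<subseteq> {n \<in> carrier R. n \<otimes> a \<in> PIdl y}"
      unfolding G(3) using a G by (intro genideal_minimal) auto
    then show ?thesis using a by blast
  qed
  fix J1 J2 assume J: "ideal J1 R" "ideal J2 R" "PIdl y = J1 \<inter> J2"
  show "PIdl y = J1 \<or> PIdl y = J2"
  proof (rule ccontr)
    assume "\<not> (PIdl y = J1 \<or> PIdl y = J2)"
    then have "\<not> J1 \<subseteq> PIdl y" "\<not> J2 \<subseteq> PIdl y" using J by auto
    then obtain a b where a: "a \<in> J1" "a \<notin> PIdl y" "\<forall>n\<in>\<nn>. n \<otimes> a \<in> PIdl y"
      and b: "b \<in> J2" "b \<notin> PIdl y" "\<forall>n\<in>\<nn>. n \<otimes> b \<in> PIdl y" using ex J by meson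
    interpret J1: ideal J1 R by fact
    have ac: "a \<in> carrier R" and bc: "b \<in> carrier R" using a b J1.Icarr ideal.Icarr[OF J(2)] by auto
    obtain c where c: "c \<in> carrier R" "b \<ominus> c \<otimes> a \<in> PIdl y"
      using soc a b ac bc unfolding socle_cyclic_def by blast
    have "(b \<ominus> c \<otimes> a) \<oplus> c \<otimes> a \<in> J1"
      using c J a by (intro J1.a_closed J1.I_l_closed) auto
    moreover have "(b \<ominus> c \<otimes> a) \<oplus> c \<otimes> a = b" using ac bc c(1) by algebra
    ultimately show False using b J by auto
  qed
qed

end

section \<open>Localization\<close>

locale mult_subset = cring R for R (structure) +
  fixes S :: "'a set"
  assumes S_carrier: "S \<subseteq> carrier R" and one_S: "\<one> \<in> S"
    and mult_S: "\<And>s t. s \<in> S \<Longrightarrow> t \<in> S \<Longrightarrow> s \<otimes> t \<in> S"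
begin

lemma S_in_carrier [simp]: "s \<in> S \<Longrightarrow> s \<in> carrier R"
  using S_carrier by auto

text \<open>Without the subtraction, equality of fractions can be proved by chains of
  equations.\<close>

lemma frac_rel_iff:
  "((a, s), (b, t)) \<in> frac_rel R S \<longleftrightarrow> a \<in> carrier R \<and> s \<in> S \<and> b \<in> carrier R \<and> t \<in> S \<and>
    (\<exists>u\<in>S. u \<otimes> (a \<otimes> t) = u \<otimes> (b \<otimes> s))"
proof -
  have "u \<otimes> (a \<otimes> t \<ominus> b \<otimes> s) = \<zero> \<longleftrightarrow> u \<otimes> (a \<otimes> t) = u \<otimes> (b \<otimes> s)"
    if "a \<in> carrier R" "s \<in> S" "b \<in> carrier R" "t \<in> S" "u \<in> S" for u
  proof -
    have "s \<in> carrier R" "t \<in> carrier R" "u \<in> carrier R" using that by auto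
    then have "u \<otimes> (a \<otimes> t \<ominus> b \<otimes> s) = u \<otimes> (a \<otimes> t) \<ominus> u \<otimes> (b \<otimes> s)" using that(1,3) by algebra
    then show ?thesis using that by simp
  qed
  then show ?thesis unfolding frac_rel_def by auto
qed

lemma equiv_frac_rel: "equiv (carrier R \<times> S) (frac_rel R S)"
proof (rule equivI)
  show "frac_rel R S \<subseteq> (carrier R \<times> S) \<times> (carrier R \<times> S)"
    by (auto simp: frac_rel_def)
  show "refl_on (carrier R \<times> S) (frac_rel R S)"
    by (rule refl_onI) (use one_S in \<open>auto simp: frac_rel_iff\<close>)
  show "sym (frac_rel R S)"
  proof (rule symI)
    fix x y assume "(x, y) \<in> frac_rel R S"
    then show "(y, x) \<in> frac_rel R S"
      by (cases x; cases y) (auto simp: frac_rel_iff intro: sym)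
  qed
  show "trans (frac_rel R S)"
  proof (rule transI)
    fix x y z assume xy: "(x, y) \<in> frac_rel R S" and yz: "(y, z) \<in> frac_rel R S"
    obtain a s b t c r where e: "x = (a, s)" "y = (b, t)" "z = (c, r)" by (metis prod.exhaust)
    from xy yz obtain u v where m: "a \<in> carrier R" "s \<in> S" "b \<in> carrier R" "t \<in> S" "c \<in> carrier R" "r \<in> S"
      and uv: "u \<in> S" "v \<in> S" "u \<otimes> (a \<otimes> t) = u \<otimes> (b \<otimes> s)" "v \<otimes> (b \<otimes> r) = v \<otimes> (c \<otimes> t)"
      unfolding e frac_rel_iff by auto
    have c: "s \<in> carrier R" "t \<in> carrier R" "r \<in> carrier R" "u \<in> carrier R" "v \<in> carrier R" using m uv by auto
    have "(u \<otimes> v \<otimes> t) \<otimes> (a \<otimes> r) = (u \<otimes> (a \<otimes> t)) \<otimes> (v \<otimes> r)" using c m(1,3,5) by algebra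
    also have "\<dots> = (u \<otimes> (b \<otimes> s)) \<otimes> (v \<otimes> r)" using uv by simp
    also have "\<dots> = (v \<otimes> (b \<otimes> r)) \<otimes> (u \<otimes> s)" using c m(1,3,5) by algebra
    also have "\<dots> = (v \<otimes> (c \<otimes> t)) \<otimes> (u \<otimes> s)" using uv by simp
    also have "\<dots> = (u \<otimes> v \<otimes> t) \<otimes> (c \<otimes> s)" using c m(1,3,5) by algebra
    finally show "(x, z) \<in> frac_rel R S" unfolding e frac_rel_iff using m uv mult_S by blast
  qed
qed

lemma frac_eq_iff:
  assumes "a \<in> carrier R" "s \<in> S" "b \<in> carrier R" "t \<in> S"
  shows "frac R S a s = frac R S b t \<longleftrightarrow> (\<exists>u\<in>S. u \<otimes> (a \<otimes> t) = u \<otimes> (b \<otimes> s))"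
  unfolding frac_def
  using eq_equiv_class_iff[OF equiv_frac_rel, of "(a, s)" "(b, t)"] assms
  by (simp add: frac_rel_iff)

lemma frac_eqI:
  assumes "a \<in> carrier R" "s \<in> S" "b \<in> carrier R" "t \<in> S" "a \<otimes> t = b \<otimes> s"
  shows "frac R S a s = frac R S b t"
  using frac_eq_iff[OF assms(1-4)] one_S assms(5) by auto

lemma mem_frac_iff:
  assumes "a \<in> carrier R" "s \<in> S"
  shows "(b, t) \<in> frac R S a s \<longleftrightarrow> b \<in> carrier R \<and> t \<in> S \<and> frac R S b t = frac R S a s"
proof -
  have "(b, t) \<in> frac R S a s \<longleftrightarrow> ((a, s), (b, t)) \<in> frac_rel R S" by (simp add: frac_def)
  then show ?thesis using assms frac_eq_iff[of a s b t] frac_rel_iff[of a s b t] by auto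
qed

lemma carrier_fractions: "carrier (fractions R S) = {frac R S a s | a s. a \<in> carrier R \<and> s \<in> S}"
  by (auto simp: fractions_def quotient_def frac_def)

lemma frac_closed [simp]: "a \<in> carrier R \<Longrightarrow> s \<in> S \<Longrightarrow> frac R S a s \<in> carrier (fractions R S)"
  by (auto simp: carrier_fractions)

text \<open>Evaluates the unions in the operations of \<open>fractions\<close> once independence of
  the representatives is known.\<close>

lemma Union_const: "x \<in> A \<Longrightarrow> (\<And>y. y \<in> A \<Longrightarrow> f y = c) \<Longrightarrow> (\<Union>y\<in>A. f y) = c"
  by auto

lemma frac_mult:
  assumes "a \<in> carrier R" "s \<in> S" "b \<in> carrier R" "t \<in> S"
  shows "frac R S a s \<otimes>\<^bsub>fractions R S\<^esub> frac R S b t = frac R S (a \<otimes> b) (s \<otimes> t)"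
proof -
  have eq: "frac R S (a' \<otimes> b') (s' \<otimes> t') = frac R S (a \<otimes> b) (s \<otimes> t)"
    if "(a', s') \<in> frac R S a s" "(b', t') \<in> frac R S b t" for a' s' b' t'
  proof -
    have m: "a' \<in> carrier R" "s' \<in> S" "frac R S a' s' = frac R S a s"
      "b' \<in> carrier R" "t' \<in> S" "frac R S b' t' = frac R S b t"
      using that assms by (auto simp: mem_frac_iff)
    obtain u v where uv: "u \<in> S" "u \<otimes> (a' \<otimes> s) = u \<otimes> (a \<otimes> s')" "v \<in> S" "v \<otimes> (b' \<otimes> t) = v \<otimes> (b \<otimes> t')"
      using m assms by (auto simp: frac_eq_iff)
    have c: "s \<in> carrier R" "t \<in> carrier R" "s' \<in> carrier R" "t' \<in> carrier R" "u \<in> carrier R" "v \<in> carrier R"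
      using m uv assms by auto
    have "(u \<otimes> v) \<otimes> ((a' \<otimes> b') \<otimes> (s \<otimes> t)) = (u \<otimes> (a' \<otimes> s)) \<otimes> (v \<otimes> (b' \<otimes> t))"
      using c m(1,4) assms(1,3) by algebra
    also have "\<dots> = (u \<otimes> (a \<otimes> s')) \<otimes> (v \<otimes> (b \<otimes> t'))" using uv by simp
    also have "\<dots> = (u \<otimes> v) \<otimes> ((a \<otimes> b) \<otimes> (s' \<otimes> t'))" using c m(1,4) assms(1,3) by algebra
    finally show ?thesis using m uv assms mult_S by (subst frac_eq_iff) auto
  qed
  have in1: "(a, s) \<in> frac R S a s" and in2: "(b, t) \<in> frac R S b t" using assms by (auto simp: mem_frac_iff)
  have "frac R S a s \<otimes>\<^bsub>fractions R S\<^esub> frac R S b t =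
     (\<Union>(a', s')\<in>frac R S a s. \<Union>(b', t')\<in>frac R S b t. frac R S (a' \<otimes> b') (s' \<otimes> t'))"
    by (simp add: fractions_def)
  also have "\<dots> = frac R S (a \<otimes> b) (s \<otimes> t)"
  proof (rule Union_const[OF in1], clarify, rule Union_const[OF in2], clarify)
    fix a' s' b' t'
    assume "(a', s') \<in> frac R S a s" "(b', t') \<in> frac R S b t"
    then show "frac R S (a' \<otimes> b') (s' \<otimes> t') = frac R S (a \<otimes> b) (s \<otimes> t)" by (rule eq)
  qed
  finally show ?thesis .
qed

lemma frac_add:
  assumes "a \<in> carrier R" "s \<in> S" "b \<in> carrier R" "t \<in> S"
  shows "frac R S a s \<oplus>\<^bsub>fractions R S\<^esub> frac R S b t = frac R S (a \<otimes> t \<oplus> b \<otimes> s) (s \<otimes> t)"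
proof -
  have eq: "frac R S (a' \<otimes> t' \<oplus> b' \<otimes> s') (s' \<otimes> t') = frac R S (a \<otimes> t \<oplus> b \<otimes> s) (s \<otimes> t)"
    if "(a', s') \<in> frac R S a s" "(b', t') \<in> frac R S b t" for a' s' b' t'
  proof -
    have m: "a' \<in> carrier R" "s' \<in> S" "frac R S a' s' = frac R S a s"
      "b' \<in> carrier R" "t' \<in> S" "frac R S b' t' = frac R S b t"
      using that assms by (auto simp: mem_frac_iff)
    obtain u v where uv: "u \<in> S" "u \<otimes> (a' \<otimes> s) = u \<otimes> (a \<otimes> s')" "v \<in> S" "v \<otimes> (b' \<otimes> t) = v \<otimes> (b \<otimes> t')"
      using m assms by (auto simp: frac_eq_iff)
    have c: "s \<in> carrier R" "t \<in> carrier R" "s' \<in> carrier R" "t' \<in> carrier R" "u \<in> carrier R" "v \<in> carrier R"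
      using m uv assms by auto
    have "(u \<otimes> v) \<otimes> ((a' \<otimes> t' \<oplus> b' \<otimes> s') \<otimes> (s \<otimes> t)) =
        (u \<otimes> (a' \<otimes> s)) \<otimes> (v \<otimes> t' \<otimes> t) \<oplus> (v \<otimes> (b' \<otimes> t)) \<otimes> (u \<otimes> s' \<otimes> s)"
      using c m(1,4) assms(1,3) by algebra
    also have "\<dots> = (u \<otimes> (a \<otimes> s')) \<otimes> (v \<otimes> t' \<otimes> t) \<oplus> (v \<otimes> (b \<otimes> t')) \<otimes> (u \<otimes> s' \<otimes> s)"
      using uv by simp
    also have "\<dots> = (u \<otimes> v) \<otimes> ((a \<otimes> t \<oplus> b \<otimes> s) \<otimes> (s' \<otimes> t'))" using c m(1,4) assms(1,3) by algebra
    finally show ?thesis using m uv assms mult_S by (subst frac_eq_iff) auto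
  qed
  have in1: "(a, s) \<in> frac R S a s" and in2: "(b, t) \<in> frac R S b t" using assms by (auto simp: mem_frac_iff)
  have "frac R S a s \<oplus>\<^bsub>fractions R S\<^esub> frac R S b t =
     (\<Union>(a', s')\<in>frac R S a s. \<Union>(b', t')\<in>frac R S b t. frac R S (a' \<otimes> t' \<oplus> b' \<otimes> s') (s' \<otimes> t'))"
    by (simp add: fractions_def)
  also have "\<dots> = frac R S (a \<otimes> t \<oplus> b \<otimes> s) (s \<otimes> t)"
  proof (rule Union_const[OF in1], clarify, rule Union_const[OF in2], clarify)
    fix a' s' b' t'
    assume "(a', s') \<in> frac R S a s" "(b', t') \<in> frac R S b t"
    then show "frac R S (a' \<otimes> t' \<oplus> b' \<otimes> s') (s' \<otimes> t') = frac R S (a \<otimes> t \<oplus> b \<otimes> s) (s \<otimes> t)" by (rule eq)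
  qed
  finally show ?thesis .
qed

lemma frac_zero: "\<zero>\<^bsub>fractions R S\<^esub> = frac R S \<zero> \<one>"
  and frac_one: "\<one>\<^bsub>fractions R S\<^esub> = frac R S \<one> \<one>"
  by (simp_all add: fractions_def)

lemma fraction_cases:
  assumes "x \<in> carrier (fractions R S)"
  obtains a s where "a \<in> carrier R" "s \<in> S" "x = frac R S a s"
  using assms by (auto simp: carrier_fractions)

lemma cring_fractions: "cring (fractions R S)"
proof (rule cringI)
  note [simp] = frac_mult frac_add frac_zero frac_one one_S mult_S
  note [elim!] = fraction_cases
  show "abelian_group (fractions R S)"
  proof (rule abelian_groupI)
    fix x assume "x \<in> carrier (fractions R S)"
    then obtain a s where x: "a \<in> carrier R" "s \<in> S" "x = frac R S a s" by auto
    then have "frac R S (\<ominus> a \<otimes> s \<oplus> a \<otimes> s) (s \<otimes> s) = frac R S \<zero> \<one>"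
      by (intro frac_eqI) (auto simp: l_minus l_neg)
    then show "\<exists>y\<in>carrier (fractions R S). y \<oplus>\<^bsub>fractions R S\<^esub> x = \<zero>\<^bsub>fractions R S\<^esub>"
      using x by (intro bexI[of _ "frac R S (\<ominus> a) s"]) auto
  next
    fix x y z assume "x \<in> carrier (fractions R S)" "y \<in> carrier (fractions R S)" "z \<in> carrier (fractions R S)"
    then obtain a s b t c r where e: "a \<in> carrier R" "s \<in> S" "x = frac R S a s"
      "b \<in> carrier R" "t \<in> S" "y = frac R S b t" "c \<in> carrier R" "r \<in> S" "z = frac R S c r" by auto
    then have "s \<in> carrier R" "t \<in> carrier R" "r \<in> carrier R" by auto
    then have "(a \<otimes> t \<oplus> b \<otimes> s) \<otimes> r \<oplus> c \<otimes> (s \<otimes> t) = a \<otimes> (t \<otimes> r) \<oplus> (b \<otimes> r \<oplus> c \<otimes> t) \<otimes> s"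
      "s \<otimes> t \<otimes> r = s \<otimes> (t \<otimes> r)"
      using e(1,4,7) by algebra+
    then show "x \<oplus>\<^bsub>fractions R S\<^esub> y \<oplus>\<^bsub>fractions R S\<^esub> z = x \<oplus>\<^bsub>fractions R S\<^esub> (y \<oplus>\<^bsub>fractions R S\<^esub> z)"
      using e by simp
  next
    fix x y assume "x \<in> carrier (fractions R S)" "y \<in> carrier (fractions R S)"
    then obtain a s b t where e: "a \<in> carrier R" "s \<in> S" "x = frac R S a s"
      "b \<in> carrier R" "t \<in> S" "y = frac R S b t" by auto
    then show "x \<oplus>\<^bsub>fractions R S\<^esub> y = y \<oplus>\<^bsub>fractions R S\<^esub> x" "x \<oplus>\<^bsub>fractions R S\<^esub> y \<in> carrier (fractions R S)"
      by (simp_all add: a_comm m_comm)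
  qed auto
  show "comm_monoid (fractions R S)"
  proof (rule comm_monoidI)
    fix x y z assume "x \<in> carrier (fractions R S)" "y \<in> carrier (fractions R S)" "z \<in> carrier (fractions R S)"
    then show "x \<otimes>\<^bsub>fractions R S\<^esub> y \<otimes>\<^bsub>fractions R S\<^esub> z = x \<otimes>\<^bsub>fractions R S\<^esub> (y \<otimes>\<^bsub>fractions R S\<^esub> z)"
      by (auto simp: m_assoc)
  qed (auto simp: m_comm)
  fix x y z assume "x \<in> carrier (fractions R S)" "y \<in> carrier (fractions R S)" "z \<in> carrier (fractions R S)"
  then obtain a s b t c r where e: "a \<in> carrier R" "s \<in> S" "x = frac R S a s"
    "b \<in> carrier R" "t \<in> S" "y = frac R S b t" "c \<in> carrier R" "r \<in> S" "z = frac R S c r" by auto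
  then have "s \<in> carrier R" "t \<in> carrier R" "r \<in> carrier R" by auto
  then have "(a \<otimes> t \<oplus> b \<otimes> s) \<otimes> c \<otimes> (s \<otimes> r \<otimes> (t \<otimes> r)) = (a \<otimes> c \<otimes> (t \<otimes> r) \<oplus> b \<otimes> c \<otimes> (s \<otimes> r)) \<otimes> (s \<otimes> t \<otimes> r)"
    using e(1,4,7) by algebra
  then have "frac R S ((a \<otimes> t \<oplus> b \<otimes> s) \<otimes> c) (s \<otimes> t \<otimes> r) =
      frac R S (a \<otimes> c \<otimes> (t \<otimes> r) \<oplus> b \<otimes> c \<otimes> (s \<otimes> r)) (s \<otimes> r \<otimes> (t \<otimes> r))"
    using e by (intro frac_eqI) simp_all
  then show "(x \<oplus>\<^bsub>fractions R S\<^esub> y) \<otimes>\<^bsub>fractions R S\<^esub> z =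
      x \<otimes>\<^bsub>fractions R S\<^esub> z \<oplus>\<^bsub>fractions R S\<^esub> y \<otimes>\<^bsub>fractions R S\<^esub> z"
    using e by simp
qed

lemma frac_eq_zero_iff:
  assumes "a \<in> carrier R"
  shows "frac R S a \<one> = \<zero>\<^bsub>fractions R S\<^esub> \<longleftrightarrow> (\<exists>u\<in>S. u \<otimes> a = \<zero>)"
  unfolding frac_zero using assms one_S by (subst frac_eq_iff) auto

end

text \<open>
  \<open>B\<close> is the localization of \<open>UNIV/I\<close> at the image of \<open>S\<close>, with canonical map \<open>\<theta>\<close>.
\<close>

locale localization_pres = cring B for B (structure) +
  fixes \<theta> :: "'r::comm_ring_1 \<Rightarrow> 'a" and S I :: "'r set"
  assumes th_closed [simp]: "\<theta> f \<in> carrier B"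
    and th_add: "\<theta> (f + g) = \<theta> f \<oplus> \<theta> g"
    and th_mult: "\<theta> (f * g) = \<theta> f \<otimes> \<theta> g"
    and th_one: "\<theta> 1 = \<one>"
    and th_unit: "g \<in> S \<Longrightarrow> \<theta> g \<in> Units B"
    and th_surj: "x \<in> carrier B \<Longrightarrow> \<exists>f g. g \<in> S \<and> x \<otimes> \<theta> g = \<theta> f"
    and th_zero_iff: "\<theta> f = \<zero> \<longleftrightarrow> (\<exists>u\<in>S. u * f \<in> I)"
    and th_I: "f \<in> I \<Longrightarrow> \<theta> f = \<zero>"

text \<open>Forming the quotient and localizing it are merged into one presentation by the original
  ring, with the preimage of the complement of \<open>\<MM>\<close> as denominators. Later
  computations can then be made with polynomials.\<close>

lemma (in cring) localization_pres_fractions: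
  assumes pres: "localization_pres R \<theta> {1} I" and "primeideal \<MM> R"
  shows "localization_pres (fractions R (carrier R - \<MM>)) (\<lambda>f. frac R (carrier R - \<MM>) (\<theta> f) \<one>) {g. \<theta> g \<notin> \<MM>} I"
proof -
  interpret P: localization_pres R \<theta> "{1}" I by fact
  interpret M: primeideal \<MM> R by fact
  interpret S: mult_subset R "carrier R - \<MM>"
    by unfold_locales (use M.I_prime M.I_notcarr M.one_imp_carrier in auto)
  interpret B: cring "fractions R (carrier R - \<MM>)" by (rule S.cring_fractions)
  have surj: "\<exists>f. \<theta> f = x" if "x \<in> carrier R" for x
    using P.th_surj[OF that] that by (auto simp: P.th_one)
  show ?thesis
  proof unfold_locales
    fix f g
    show "frac R (carrier R - \<MM>) (\<theta> f) \<one> \<in> carrier (fractions R (carrier R - \<MM>))"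
      using S.one_S by simp
    show "frac R (carrier R - \<MM>) (\<theta> (f + g)) \<one> =
      frac R (carrier R - \<MM>) (\<theta> f) \<one> \<oplus>\<^bsub>fractions R (carrier R - \<MM>)\<^esub> frac R (carrier R - \<MM>) (\<theta> g) \<one>"
      using S.one_S by (simp add: S.frac_add P.th_add)
    show "frac R (carrier R - \<MM>) (\<theta> (f * g)) \<one> =
      frac R (carrier R - \<MM>) (\<theta> f) \<one> \<otimes>\<^bsub>fractions R (carrier R - \<MM>)\<^esub> frac R (carrier R - \<MM>) (\<theta> g) \<one>"
      using S.one_S by (simp add: S.frac_mult P.th_mult)
    show "frac R (carrier R - \<MM>) (\<theta> 1) \<one> = \<one>\<^bsub>fractions R (carrier R - \<MM>)\<^esub>"
      by (simp add: S.frac_one P.th_one)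
    show "frac R (carrier R - \<MM>) (\<theta> f) \<one> = \<zero>\<^bsub>fractions R (carrier R - \<MM>)\<^esub> \<longleftrightarrow> (\<exists>u\<in>{g. \<theta> g \<notin> \<MM>}. u * f \<in> I)"
    proof -
      have "(\<exists>u\<in>carrier R - \<MM>. u \<otimes> \<theta> f = \<zero>) \<longleftrightarrow> (\<exists>u\<in>{g. \<theta> g \<notin> \<MM>}. \<theta> (u * f) = \<zero>)"
        using surj by (auto simp: P.th_mult)
      then show ?thesis by (simp add: S.frac_eq_zero_iff P.th_zero_iff)
    qed
  next
    fix f assume "f \<in> I"
    then show "frac R (carrier R - \<MM>) (\<theta> f) \<one> = \<zero>\<^bsub>fractions R (carrier R - \<MM>)\<^esub>"
      by (simp add: P.th_I S.frac_zero)
  next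
    fix g assume g: "g \<in> {g. \<theta> g \<notin> \<MM>}"
    then have "frac R (carrier R - \<MM>) (\<theta> g) \<one> \<otimes>\<^bsub>fractions R (carrier R - \<MM>)\<^esub> frac R (carrier R - \<MM>) \<one> (\<theta> g)
       = \<one>\<^bsub>fractions R (carrier R - \<MM>)\<^esub>"
      using S.one_S S.frac_eqI[of "\<theta> g" "\<theta> g" \<one> \<one>] by (simp add: S.frac_mult S.frac_one)
    then show "frac R (carrier R - \<MM>) (\<theta> g) \<one> \<in> Units (fractions R (carrier R - \<MM>))"
      using S.one_S g B.m_comm unfolding Units_def
      by (auto intro!: bexI[of _ "frac R (carrier R - \<MM>) \<one> (\<theta> g)"])
  next
    fix x assume "x \<in> carrier (fractions R (carrier R - \<MM>))"
    then obtain a s where x: "a \<in> carrier R" "s \<in> carrier R - \<MM>" "x = frac R (carrier R - \<MM>) a s"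
      by (rule S.fraction_cases)
    obtain f g where fg: "\<theta> f = a" "\<theta> g = s" using surj x by blast
    have "x \<otimes>\<^bsub>fractions R (carrier R - \<MM>)\<^esub> frac R (carrier R - \<MM>) (\<theta> g) \<one> = frac R (carrier R - \<MM>) (\<theta> f) \<one>"
      unfolding x(3) fg using x S.one_S S.frac_eqI[of "a \<otimes> s" s a \<one>] by (simp add: S.frac_mult)
    then show "\<exists>f g. g \<in> {g. \<theta> g \<notin> \<MM>} \<and>
       x \<otimes>\<^bsub>fractions R (carrier R - \<MM>)\<^esub> frac R (carrier R - \<MM>) (\<theta> g) \<one> = frac R (carrier R - \<MM>) (\<theta> f) \<one>"
      using x fg by blast
  qed
qed

text \<open>A quotient is the presentation whose only denominator is 1.\<close>

lemma localization_pres_quotient: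
  fixes I :: "'r::comm_ring_1 set"
  assumes "ideal I (ring_of_type_algebra :: 'r ring)"
  shows "localization_pres (ring_of_type_algebra Quot I) (\<lambda>f. I +>\<^bsub>ring_of_type_algebra\<^esub> f) {1} I"
proof -
  let ?R = "ring_of_type_algebra :: 'r ring"
  have z: "\<zero>\<^bsub>?R Quot I\<^esub> = I" by (simp add: FactRing_def)
  interpret R: cring ?R by (rule cring_from_type_algebra)
  interpret I: ideal I ?R by fact
  interpret Q: cring "?R Quot I" by (rule I.quotient_is_cring[OF R.cring_axioms])
  interpret h: ring_hom_ring ?R "?R Quot I" "(+>\<^bsub>?R\<^esub>) I" by (rule I.rcos_ring_hom_ring)
  have simps: "carrier ?R = UNIV" "x \<otimes>\<^bsub>?R\<^esub> y = x * y" "x \<oplus>\<^bsub>?R\<^esub> y = x + y" "\<one>\<^bsub>?R\<^esub> = 1" for x y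
    by (simp_all add: ring_of_type_algebra_def)
  show ?thesis
  proof unfold_locales
    fix f g :: 'r
    show "I +>\<^bsub>?R\<^esub> f \<in> carrier (?R Quot I)" using h.hom_closed[of f] by (simp add: simps)
    show "I +>\<^bsub>?R\<^esub> (f + g) = (I +>\<^bsub>?R\<^esub> f) \<oplus>\<^bsub>?R Quot I\<^esub> (I +>\<^bsub>?R\<^esub> g)"
      using h.hom_add[of f g] by (simp add: simps)
    show "I +>\<^bsub>?R\<^esub> (f * g) = (I +>\<^bsub>?R\<^esub> f) \<otimes>\<^bsub>?R Quot I\<^esub> (I +>\<^bsub>?R\<^esub> g)"
      using h.hom_mult[of f g] by (simp add: simps)
    show one: "I +>\<^bsub>?R\<^esub> 1 = \<one>\<^bsub>?R Quot I\<^esub>" using h.hom_one by (simp add: simps)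
    have "I +>\<^bsub>?R\<^esub> f = I \<longleftrightarrow> f \<in> I"
      using I.a_rcos_const[of f] I.rcos_const_imp_mem[of f] unfolding simps(1) by blast
    then show "I +>\<^bsub>?R\<^esub> f = \<zero>\<^bsub>?R Quot I\<^esub> \<longleftrightarrow> (\<exists>u\<in>{1}. u * f \<in> I)"
      unfolding z by simp
    show "I +>\<^bsub>?R\<^esub> f = \<zero>\<^bsub>?R Quot I\<^esub>" if "f \<in> I"
      unfolding z using that \<open>I +>\<^bsub>?R\<^esub> f = I \<longleftrightarrow> f \<in> I\<close> by simp
    show "I +>\<^bsub>?R\<^esub> g \<in> Units (?R Quot I)" if "g \<in> {1}" using that one Q.Units_one_closed by (metis singletonD)
  next
    fix x assume "x \<in> carrier (?R Quot I)"
    moreover obtain f where "x = I +>\<^bsub>?R\<^esub> f" using calculation unfolding FactRing_def A_RCOSETS_def' by auto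
    moreover have "I +>\<^bsub>?R\<^esub> 1 = \<one>\<^bsub>?R Quot I\<^esub>" using h.hom_one unfolding simps .
    ultimately have "x \<otimes>\<^bsub>?R Quot I\<^esub> (I +>\<^bsub>?R\<^esub> 1) = I +>\<^bsub>?R\<^esub> f" by (metis Q.r_one)
    then show "\<exists>f g. g \<in> {1} \<and> x \<otimes>\<^bsub>?R Quot I\<^esub> (I +>\<^bsub>?R\<^esub> g) = I +>\<^bsub>?R\<^esub> f"
      by blast
  qed
qed

section \<open>Depth and the Gorenstein condition in local rings of dimension one\<close>

context cring
begin

text \<open>Suppose a regular sequence starts with \<open>y\<close>, \<open>z\<close>. Some power of
  \<open>z\<close> lies in \<open>(y)\<close>, and regularity of \<open>z\<close> modulo
  \<open>y\<close> removes a factor from it, so the least exponent is 0. The sequence then generates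
  the unit ideal, which is excluded.\<close>

lemma ideal_depth_eq_1:
  assumes \<nn>: "\<nn> \<subseteq> carrier R" "\<nn> \<noteq> carrier R" "ideal \<nn> R" and pi: "\<pi> \<in> \<nn>" "nonzerodivisor \<pi>"
    and rad: "\<And>y z. y \<in> \<nn> \<Longrightarrow> nonzerodivisor y \<Longrightarrow> z \<in> \<nn> \<Longrightarrow> \<exists>k::nat. z [^] k \<in> PIdl y"
  shows "ideal_depth R \<nn> = 1"
proof -
  interpret n: ideal \<nn> R by fact
  have Idl0: "Idl {} = {\<zero>}"
    using genideal_minimal[OF zeroideal, of "{}"] genideal_ideal[of "{}"]
    by (auto simp: additive_subgroup.zero_closed ideal_def)
  have le: "length xs \<le> 1" if "regular_sequence R xs" "set xs \<subseteq> \<nn>" for xs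
  proof (rule ccontr)
    assume "\<not> length xs \<le> 1"
    then obtain y z zs where xs: "xs = y # z # zs" by (cases xs; cases "tl xs") auto
    have y: "y \<in> \<nn>" "y \<in> carrier R" and z: "z \<in> \<nn>" "z \<in> carrier R" using that xs \<nn> by auto
    have reg: "\<And>i a. i < length xs \<Longrightarrow> a \<in> carrier R \<Longrightarrow> xs ! i \<otimes> a \<in> Idl (set (take i xs)) \<Longrightarrow> a \<in> Idl (set (take i xs))"
      and nontriv: "Idl (set xs) \<noteq> carrier R"
      using that(1) unfolding regular_sequence_def by auto
    have "nonzerodivisor y"
      unfolding nonzerodivisor_def using reg[of 0] xs Idl0 by auto
    then obtain k :: nat where k: "z [^] k \<in> PIdl y" using rad y z by blast
    define l where "l = (LEAST k::nat. z [^] k \<in> PIdl y)"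
    have l: "z [^] l \<in> PIdl y" unfolding l_def using k by (rule LeastI)
    have regz: "a \<in> PIdl y" if "a \<in> carrier R" "z \<otimes> a \<in> PIdl y" for a
      using reg[of 1 a] that xs cgenideal_eq_genideal[OF y(2)] by auto
    show False
    proof (cases l)
      case 0
      then have "\<one> \<in> PIdl y" using l by simp
      also have "PIdl y \<subseteq> Idl (set xs)"
      proof -
        have "set xs \<subseteq> carrier R" using that \<nn> by auto
        then show ?thesis
          unfolding cgenideal_eq_genideal[OF y(2)] using genideal_self[of "set xs"] xs
          by (intro genideal_minimal genideal_ideal) auto
      qed
      finally have "\<one> \<in> Idl (set xs)" .
      moreover have "ideal (Idl (set xs)) R" using that \<nn> by (intro genideal_ideal) auto
      ultimately show False using nontriv ideal.one_imp_carrier by blast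
    next
      case (Suc j)
      have "z \<otimes> z [^] j \<in> PIdl y" using l unfolding Suc nat_pow_Suc2[OF z(2)] .
      then have "z [^] j \<in> PIdl y" using regz[of "z [^] j"] z by blast
      then have "l \<le> j" unfolding l_def by (rule Least_le)
      then show False using Suc by simp
    qed
  qed
  have "regular_sequence R [\<pi>]"
  proof -
    have pc: "\<pi> \<in> carrier R" using pi \<nn> by auto
    have "Idl {\<pi>} \<subseteq> \<nn>" using pi by (intro genideal_minimal n.is_ideal) auto
    then have "Idl {\<pi>} \<noteq> carrier R" using \<nn> by auto
    moreover have "\<forall>a\<in>carrier R. \<pi> \<otimes> a \<in> Idl {} \<longrightarrow> a \<in> Idl {}"
      using pi(2) unfolding Idl0 nonzerodivisor_def by blast
    ultimately show ?thesis using pc unfolding regular_sequence_def by simp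
  qed
  then have "enat 1 \<in> {enat (length xs) | xs. regular_sequence R xs \<and> set xs \<subseteq> \<nn>}"
    using pi by (intro CollectI exI[of _ "[\<pi>]"]) auto
  then have "enat 1 \<le> ideal_depth R \<nn>" unfolding ideal_depth_def by (rule Sup_upper)
  moreover have "ideal_depth R \<nn> \<le> enat 1"
    unfolding ideal_depth_def using le by (intro Sup_least) auto
  ultimately show ?thesis by (simp add: one_enat_def)
qed

text \<open>By \<open>rad\<close>, every nonzerodivisor in \<open>\<nn>\<close> is a parameter, in
  particular \<pi>. Conversely a power of \<pi> is a multiple of any parameter \<open>y\<close>, so
  \<open>y\<close> is a nonzerodivisor as well, and irreducibility passes from \<pi> to
  \<open>y\<close> by comparing socles.\<close>

lemma gorenstein_local_ring_iff_dim_1: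
  assumes loc: "noetherian_local_ring R \<nn>" and dim: "krull_dim R = 1"
    and units: "\<And>x. x \<in> carrier R \<Longrightarrow> x \<notin> \<nn> \<Longrightarrow> x \<in> Units R"
    and pi: "\<pi> \<in> \<nn>" "nonzerodivisor \<pi>"
    and rad: "\<And>y z. y \<in> \<nn> \<Longrightarrow> nonzerodivisor y \<Longrightarrow> z \<in> \<nn> \<Longrightarrow> \<exists>k::nat. z [^] k \<in> PIdl y"
  shows "gorenstein_local_ring R \<nn> \<longleftrightarrow> irreducible_ideal R (PIdl \<pi>)"
proof -
  interpret n: maximalideal \<nn> R using loc by (simp add: noetherian_local_ring_def)
  interpret noetherian_ring R using loc by (simp add: noetherian_local_ring_def)
  have sub: "\<nn> \<subseteq> carrier R" using n.Icarr by auto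
  have prime: "primeideal \<nn> R" by (rule maximalideal_prime[OF n.is_maximalideal])
  then interpret np: primeideal \<nn> R .
  have one: "\<one> \<notin> \<nn>" using n.one_imp_carrier n.I_notcarr by auto
  have pc: "\<pi> \<in> carrier R" using pi sub by auto
  have PIdl_sub: "PIdl y \<subseteq> \<nn>" if "y \<in> \<nn>" for y
    using that n.is_ideal cgenideal_minimal by auto
  have pow: "a \<in> \<nn>" if "a \<in> carrier R" "a [^] k \<in> \<nn>" for a and k :: nat
    using that(2)
  proof (induction k)
    case (Suc k)
    then have "a [^] k \<in> \<nn> \<or> a \<in> \<nn>" using that(1) np.I_prime by simp
    then show ?case using Suc by auto
  qed (use one in auto)
  have depth: "ideal_depth R \<nn> = 1"
    using sub n.I_notcarr n.is_ideal pi rad by (intro ideal_depth_eq_1) auto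
  obtain G where G: "finite G" "G \<subseteq> carrier R" "\<nn> = Idl G" using finetely_gen[OF n.is_ideal] by auto
  have Gsub: "G \<subseteq> \<nn>" using genideal_self[OF G(2)] G(3) by auto
  show ?thesis
  proof
    assume g: "gorenstein_local_ring R \<nn>"
    have "system_of_parameters R \<nn> [\<pi>]"
      unfolding system_of_parameters_def
    proof (intro conjI)
      show "enat (length [\<pi>]) = krull_dim R" using dim by (simp add: one_enat_def)
      show "set [\<pi>] \<subseteq> \<nn>" using pi by simp
      have "a \<in> \<nn>" if "a \<in> carrier R" "a [^] k \<in> PIdl \<pi>" for a and k :: nat
        using that pow PIdl_sub[OF pi(1)] by blast
      then show "{a \<in> carrier R. \<exists>k::nat. a [^] k \<in> Idl (set [\<pi>])} = \<nn>"
        using rad[OF pi] sub by (auto simp: cgenideal_eq_genideal[OF pc])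
    qed
    then show "irreducible_ideal R (PIdl \<pi>)"
      using g unfolding gorenstein_local_ring_def by (auto simp: cgenideal_eq_genideal[OF pc])
  next
    assume irr: "irreducible_ideal R (PIdl \<pi>)"
    have "irreducible_ideal R (Idl (set xs))" if xs: "system_of_parameters R \<nn> xs" for xs
    proof -
      have "length xs = 1" "set xs \<subseteq> \<nn>" and
        rt: "{a \<in> carrier R. \<exists>k::nat. a [^] k \<in> Idl (set xs)} = \<nn>"
        using xs unfolding system_of_parameters_def dim by (auto simp: one_enat_def)
      then obtain y where y: "xs = [y]" "y \<in> \<nn>" by (cases xs) auto
      have yc: "y \<in> carrier R" using y sub by auto
      have PI: "PIdl y = Idl (set xs)" using y cgenideal_eq_genideal[OF yc] by simp
      obtain k :: nat where "\<pi> [^] k \<in> PIdl y" using pi(1) rt unfolding PI by blast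
      then obtain p where p: "p \<in> carrier R" "\<pi> [^] k = p \<otimes> y" by (auto simp: PIdl_mem_iff)
      have "nonzerodivisor y"
        unfolding nonzerodivisor_def
      proof (intro ballI impI)
        fix x assume x: "x \<in> carrier R" "y \<otimes> x = \<zero>"
        have "\<pi> [^] k \<otimes> x = p \<otimes> (y \<otimes> x)" unfolding p(2) using p(1) yc x(1) by algebra
        then have "\<pi> [^] k \<otimes> x = \<zero>" using x p by simp
        then show "x = \<zero>"
        proof (induction k)
          case (Suc k)
          have "\<pi> \<otimes> (\<pi> [^] k \<otimes> x) = \<pi> [^] Suc k \<otimes> x"
            unfolding nat_pow_Suc using pc x(1) nat_pow_closed[OF pc, of k] by algebra
          then have "\<pi> [^] k \<otimes> x = \<zero>" using Suc.prems pi(2) x pc unfolding nonzerodivisor_def by simp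
          then show ?case by (rule Suc.IH)
        qed (use x in simp)
      qed
      then have "socle_cyclic \<nn> y"
        using socle_cyclic_transfer[OF pi(1) y(2) sub pi(2)] irreducible_imp_socle_cyclic[OF pc units irr] by blast
      moreover have "PIdl y \<noteq> carrier R" using PIdl_sub[OF y(2)] n.I_notcarr sub by auto
      ultimately show ?thesis
        unfolding PI[symmetric] using rad[OF y(2) \<open>nonzerodivisor y\<close>] Gsub
        by (intro socle_cyclic_imp_irreducible[OF yc G]) auto
    qed
    then show "gorenstein_local_ring R \<nn>"
      unfolding gorenstein_local_ring_def using loc depth dim by simp
  qed
qed

end

section \<open>Ideals of type-class rings and their extension to a presented ring\<close>

definition ring_ideal :: "'r::comm_ring_1 set \<Rightarrow> bool"
  where "ring_ideal Q \<longleftrightarrow> 0 \<in> Q \<and> (\<forall>x\<in>Q. \<forall>y\<in>Q. x + y \<in> Q) \<and> (\<forall>a. \<forall>x\<in>Q. a * x \<in> Q)"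

definition prime_ring_ideal :: "'r::comm_ring_1 set \<Rightarrow> bool"
  where "prime_ring_ideal Q \<longleftrightarrow> ring_ideal Q \<and> 1 \<notin> Q \<and> (\<forall>x y. x * y \<in> Q \<longrightarrow> x \<in> Q \<or> y \<in> Q)"

lemma ring_ideal_minus: "ring_ideal Q \<Longrightarrow> x \<in> Q \<Longrightarrow> - x \<in> Q"
  unfolding ring_ideal_def by (metis mult_minus1)

lemma ring_ideal_diff: "ring_ideal Q \<Longrightarrow> x \<in> Q \<Longrightarrow> y \<in> Q \<Longrightarrow> x - y \<in> Q"
  using ring_ideal_minus[of Q y] unfolding ring_ideal_def by (metis add_uminus_conv_diff)

lemma ring_ideal_iff: "ideal Q (ring_of_type_algebra :: 'r::comm_ring_1 ring) \<longleftrightarrow> ring_ideal Q"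
proof
  interpret R: cring "ring_of_type_algebra :: 'r ring" by (rule cring_from_type_algebra)
  assume "ideal Q (ring_of_type_algebra :: 'r ring)"
  then interpret ideal Q "ring_of_type_algebra :: 'r ring" .
  show "ring_ideal Q"
    using zero_closed a_closed I_l_closed unfolding ring_ideal_def by (simp add: ring_of_type_algebra_def)
next
  interpret R: cring "ring_of_type_algebra :: 'r ring" by (rule cring_from_type_algebra)
  assume "ring_ideal Q"
  then show "ideal Q (ring_of_type_algebra :: 'r ring)"
    by (intro R.ideal_if_closed) (auto simp: ring_ideal_def ring_of_type_algebra_def)
qed

context localization_pres
begin

lemma th_0: "\<theta> 0 = \<zero>"
proof -
  have "\<theta> 0 \<oplus> \<theta> 0 = \<theta> 0 \<oplus> \<zero>" using th_add[of 0 0] by simp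
  then show ?thesis by (metis add.l_cancel th_closed zero_closed)
qed

lemma th_uminus: "\<theta> (- f) = \<ominus> \<theta> f"
  using th_add[of "- f" f] by (simp add: th_0 minus_equality)

lemma th_diff: "\<theta> (f - g) = \<theta> f \<ominus> \<theta> g"
  using th_add[of f "- g"] by (simp add: th_uminus minus_eq)

lemma th_power: "\<theta> (f ^ n) = \<theta> f [^] n"
  by (induction n) (simp_all add: th_one th_mult m_comm)

lemma th_eq_iff: "\<theta> f = \<theta> g \<longleftrightarrow> (\<exists>u\<in>S. u * (f - g) \<in> I)"
  using th_zero_iff[of "f - g"] by (simp add: th_diff)

lemma th_cong: "f - g \<in> I \<Longrightarrow> \<theta> f = \<theta> g"
  using th_I[of "f - g"] by (simp add: th_diff)

lemma unit_mult_mem_ideal_iff: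
  assumes "ideal J B" "u \<in> Units B" "x \<in> carrier B"
  shows "x \<otimes> u \<in> J \<longleftrightarrow> x \<in> J"
proof
  interpret ideal J B by fact
  show "x \<in> J" if "x \<otimes> u \<in> J"
  proof -
    have "(x \<otimes> u) \<otimes> inv u \<in> J" using I_r_closed[OF that] assms by simp
    moreover have "(x \<otimes> u) \<otimes> inv u = x" using assms by (simp add: m_assoc Units_closed)
    ultimately show ?thesis by simp
  qed
  show "x \<in> J \<Longrightarrow> x \<otimes> u \<in> J" using assms I_r_closed by auto
qed

lemma ring_ideal_contraction:
  assumes "ideal J B"
  shows "ring_ideal {f. \<theta> f \<in> J}"
proof -
  interpret ideal J B by fact
  show ?thesis unfolding ring_ideal_def by (simp add: th_0 th_add th_mult I_l_closed)
qed

text \<open>Denominators are units, so an ideal of \<open>B\<close> is generated by the image of its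
  contraction; generators of the contraction modulo \<open>I\<close> are therefore enough.\<close>

lemma noetherian_if_finitely_generated_modulo:
  assumes fg: "\<And>Q. ring_ideal Q \<Longrightarrow> I \<subseteq> Q \<Longrightarrow> \<exists>G c. finite G \<and> G \<subseteq> Q \<and> (\<forall>f\<in>Q. f - (\<Sum>g\<in>G. c f g * g) \<in> I)"
  shows "noetherian_ring B"
proof (rule noetherian_ringI)
  fix J assume J: "ideal J B"
  interpret J: ideal J B by fact
  have "I \<subseteq> {f. \<theta> f \<in> J}" by (auto simp: th_I)
  from fg[OF ring_ideal_contraction[OF J] this] obtain G c where
    G: "finite G" "G \<subseteq> {f. \<theta> f \<in> J}" "\<And>f. \<theta> f \<in> J \<Longrightarrow> f - (\<Sum>g\<in>G. c f g * g) \<in> I" by auto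
  have sub: "\<theta> ` G \<subseteq> carrier B" by auto
  interpret K: ideal "Idl (\<theta> ` G)" B by (rule genideal_ideal[OF sub])
  have sum_mem: "\<theta> (\<Sum>g\<in>H. c f g * g) \<in> Idl (\<theta> ` G)" if "H \<subseteq> G" for f H
    using finite_subset[OF that G(1)] that
  proof (induction H rule: finite_induct)
    case (insert h H)
    then have "\<theta> h \<in> Idl (\<theta> ` G)" using genideal_self[OF sub] by auto
    then show ?case using insert by (simp add: th_add th_mult K.I_l_closed)
  qed (simp add: th_0)
  have "J \<subseteq> Idl (\<theta> ` G)"
  proof
    fix x assume x: "x \<in> J"
    then have xc: "x \<in> carrier B" using J.Icarr by auto
    then obtain f g where fg: "g \<in> S" "x \<otimes> \<theta> g = \<theta> f" using th_surj by blast
    then have "\<theta> f \<in> J" using x J.I_r_closed by (metis th_closed)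
    then have "\<theta> f = \<theta> (\<Sum>g\<in>G. c f g * g)" using G(3) by (intro th_cong)
    then have "x \<otimes> \<theta> g \<in> Idl (\<theta> ` G)" using sum_mem fg by simp
    then show "x \<in> Idl (\<theta> ` G)"
      using unit_mult_mem_ideal_iff[OF K.is_ideal th_unit xc] fg by blast
  qed
  moreover have "Idl (\<theta> ` G) \<subseteq> J" using G(2) by (intro genideal_minimal J) auto
  ultimately show "\<exists>A\<subseteq>carrier B. finite A \<and> J = Idl A" using sub G(1) by blast
qed

end

section \<open>Localization at a prime: units, primes, dimension and socles in terms of the original
  ring\<close>

locale local_pres = localization_pres B \<theta> "- m" I for B (structure) and \<theta> :: "'r::comm_ring_1 \<Rightarrow> 'a" and m I +
  assumes m_prime: "prime_ring_ideal m" and I_m: "I \<subseteq> m"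
begin

text \<open>Taken as the set of nonunits, so that it contains every proper ideal; only closure under
  the operations has to be shown.\<close>

definition nn :: "'a set" where "nn = {x \<in> carrier B. x \<notin> Units B}"

lemma m_facts: "0 \<in> m" "\<And>x y. x \<in> m \<Longrightarrow> y \<in> m \<Longrightarrow> x + y \<in> m" "\<And>a x. x \<in> m \<Longrightarrow> a * x \<in> m" "\<And>a x. x \<in> m \<Longrightarrow> x * a \<in> m"
  "1 \<notin> m" "\<And>x y. x * y \<in> m \<Longrightarrow> x \<in> m \<or> y \<in> m"
  using m_prime unfolding prime_ring_ideal_def ring_ideal_def by (auto simp: mult.commute)

lemma repr:
  assumes "x \<in> carrier B"
  obtains f g where "g \<notin> m" "\<theta> g \<in> Units B" "x \<otimes> \<theta> g = \<theta> f"
  using th_surj[OF assms] th_unit by auto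

text \<open>If \<theta> maps \<open>f \<in> m\<close> to a unit, clearing the denominator
  \<open>b\<close> of the inverse gives \<open>f * a - b \<in> m\<close>, since
  \<open>I \<subseteq> m\<close> and \<open>m\<close> is prime. Then \<open>b \<in> m\<close>,
  although \<open>b\<close> is a denominator.\<close>

lemma th_Units_iff: "\<theta> f \<in> Units B \<longleftrightarrow> f \<notin> m"
proof
  assume u: "\<theta> f \<in> Units B"
  show "f \<notin> m"
  proof
    assume f: "f \<in> m"
    obtain a b where ab: "b \<notin> m" "inv (\<theta> f) \<otimes> \<theta> b = \<theta> a"
      using th_surj[OF Units_inv_closed[OF u]] by auto
    have "\<theta> (f * a) = \<theta> f \<otimes> (inv (\<theta> f) \<otimes> \<theta> b)" using ab by (simp add: th_mult)
    also have "\<dots> = \<theta> b" using u by (simp add: m_assoc[symmetric])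
    finally obtain v where v: "v \<notin> m" "v * (f * a - b) \<in> I" unfolding th_eq_iff by auto
    then have "f * a - b \<in> m" using m_facts(6) I_m by blast
    then have "f * a - (f * a - b) \<in> m"
      using m_facts(4)[OF f] ring_ideal_diff[of m] m_prime unfolding prime_ring_ideal_def by blast
    then show False using ab by simp
  qed
qed (auto intro: th_unit)

lemma th_nn_iff: "\<theta> f \<in> nn \<longleftrightarrow> f \<in> m"
  by (simp add: nn_def th_Units_iff)

lemma mult_unit_inv: "x \<in> carrier B \<Longrightarrow> u \<in> Units B \<Longrightarrow> x \<otimes> u \<otimes> inv u = x"
  by (simp add: m_assoc Units_closed)

lemma Units_mult_iff:
  assumes "x \<in> carrier B" "u \<in> Units B"
  shows "x \<otimes> u \<in> Units B \<longleftrightarrow> x \<in> Units B"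
proof
  assume "x \<otimes> u \<in> Units B"
  then have "x \<otimes> u \<otimes> inv u \<in> Units B" using assms(2) by (rule Units_m_closed[OF _ Units_inv_Units])
  moreover have "x \<otimes> u \<otimes> inv u = x" using assms by (simp add: m_assoc Units_closed)
  ultimately show "x \<in> Units B" by simp
qed (use assms in auto)

lemma nn_iff:
  assumes "x \<in> carrier B" "g \<notin> m" "x \<otimes> \<theta> g = \<theta> f"
  shows "x \<in> nn \<longleftrightarrow> f \<in> m"
  using Units_mult_iff[of x "\<theta> g"] assms th_Units_iff unfolding nn_def by auto

lemma ideal_nn: "ideal nn B"
proof (rule ideal_if_closed)
  show "nn \<subseteq> carrier B" by (auto simp: nn_def)
  show "\<zero> \<in> nn" using th_nn_iff[of 0] m_facts(1) by (simp add: th_0)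
  fix x y assume y: "y \<in> nn"
  then have yc: "y \<in> carrier B" by (simp add: nn_def)
  obtain f' g' where y': "g' \<notin> m" "\<theta> g' \<in> Units B" "y \<otimes> \<theta> g' = \<theta> f'" using repr[OF yc] .
  have f': "f' \<in> m" using nn_iff[OF yc y'(1,3)] y by simp
  show "x \<oplus> y \<in> nn" if x: "x \<in> nn"
  proof -
    have xc: "x \<in> carrier B" using x by (simp add: nn_def)
    obtain f g where x': "g \<notin> m" "\<theta> g \<in> Units B" "x \<otimes> \<theta> g = \<theta> f" using repr[OF xc] .
    have f: "f \<in> m" using nn_iff[OF xc x'(1,3)] x by simp
    have "(x \<oplus> y) \<otimes> \<theta> (g * g') = (x \<otimes> \<theta> g) \<otimes> \<theta> g' \<oplus> (y \<otimes> \<theta> g') \<otimes> \<theta> g"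
      unfolding th_mult using xc yc th_closed[of g] th_closed[of g'] by algebra
    then have "(x \<oplus> y) \<otimes> \<theta> (g * g') = \<theta> (f * g' + f' * g)" by (simp add: x' y' th_mult th_add)
    moreover have "g * g' \<notin> m" using m_facts(6) x'(1) y'(1) by blast
    ultimately show ?thesis
      using nn_iff[of "x \<oplus> y" "g * g'"] xc yc f f' m_facts(2,4) by simp
  qed
  show "x \<otimes> y \<in> nn" if xc: "x \<in> carrier B"
  proof -
    obtain f g where x': "g \<notin> m" "\<theta> g \<in> Units B" "x \<otimes> \<theta> g = \<theta> f" using repr[OF xc] .
    have "(x \<otimes> y) \<otimes> \<theta> (g * g') = (x \<otimes> \<theta> g) \<otimes> (y \<otimes> \<theta> g')"
      unfolding th_mult using xc yc th_closed[of g] th_closed[of g'] by algebra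
    then have "(x \<otimes> y) \<otimes> \<theta> (g * g') = \<theta> (f * f')" by (simp add: x' y' th_mult)
    moreover have "g * g' \<notin> m" using m_facts(6) x'(1) y'(1) by blast
    ultimately show ?thesis
      using nn_iff[of "x \<otimes> y" "g * g'"] xc yc f' m_facts(3) by simp
  qed
qed

lemma proper_ideal_sub_nn: "ideal J B \<Longrightarrow> J \<noteq> carrier B \<Longrightarrow> J \<subseteq> nn"
proof
  fix x assume J: "ideal J B" "J \<noteq> carrier B" and x: "x \<in> J"
  interpret ideal J B by fact
  have "x \<notin> Units B"
  proof
    assume "x \<in> Units B"
    then have "inv x \<otimes> x \<in> J" using x by (intro I_l_closed) auto
    then show False using J one_imp_carrier \<open>x \<in> Units B\<close> by simp
  qed
  then show "x \<in> nn" using x Icarr by (simp add: nn_def)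
qed

lemma nn_neq: "nn \<noteq> carrier B"
  by (auto simp: nn_def)

lemma maximal_nn: "maximalideal nn B"
proof (rule maximalidealI[OF ideal_nn])
  show "carrier B \<noteq> nn" using nn_neq by simp
  show "J = nn \<or> J = carrier B" if "ideal J B" "nn \<subseteq> J" "J \<subseteq> carrier B" for J
    using proper_ideal_sub_nn that by auto
qed

lemma maximal_unique: "maximalideal J B \<Longrightarrow> J = nn"
proof -
  assume "maximalideal J B"
  then interpret maximalideal J B .
  have "J \<subseteq> nn" using proper_ideal_sub_nn[OF is_ideal] I_notcarr by metis
  moreover have "nn \<subseteq> carrier B" by (auto simp: nn_def)
  ultimately have "nn = J \<or> nn = carrier B" by (rule I_maximal[OF ideal_nn])
  then show "J = nn" using nn_neq by auto
qed

lemma noetherian_local: "noetherian_ring B \<Longrightarrow> noetherian_local_ring B nn"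
  unfolding noetherian_local_ring_def using maximal_nn maximal_unique cring_axioms by blast

lemma prime_contraction:
  assumes "primeideal p B"
  shows "prime_ring_ideal {f. \<theta> f \<in> p}" "I \<subseteq> {f. \<theta> f \<in> p}" "{f. \<theta> f \<in> p} \<subseteq> m"
proof -
  interpret primeideal p B by fact
  have "p \<subseteq> nn" using proper_ideal_sub_nn is_ideal I_notcarr by auto
  then show "{f. \<theta> f \<in> p} \<subseteq> m" using th_nn_iff by blast
  then show "prime_ring_ideal {f. \<theta> f \<in> p}"
    unfolding prime_ring_ideal_def using ring_ideal_contraction[OF is_ideal] I_prime m_facts(5)
    by (auto simp: th_mult)
  show "I \<subseteq> {f. \<theta> f \<in> p}" by (auto simp: th_I)
qed

text \<open>An element of \<open>q\<close> outside \<open>p\<close> keeps this property after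
  multiplication by its denominator, a unit, which moves it into the image of \<theta>.\<close>

lemma contraction_strict:
  assumes "ideal p B" "ideal q B" "p \<subset> q"
  shows "{f. \<theta> f \<in> p} \<subset> {f. \<theta> f \<in> q}"
proof -
  obtain x where x: "x \<in> q" "x \<notin> p" using assms by auto
  have xc: "x \<in> carrier B" using x ideal.Icarr[OF assms(2)] by auto
  obtain f g where "g \<notin> m" "\<theta> g \<in> Units B" "x \<otimes> \<theta> g = \<theta> f" using repr[OF xc] .
  then have "\<theta> f \<in> q" "\<theta> f \<notin> p"
    using unit_mult_mem_ideal_iff[OF assms(1) _ xc] unit_mult_mem_ideal_iff[OF assms(2) _ xc] x by metis+
  then show ?thesis using assms by blast
qed

lemma prime_extension:
  assumes p: "prime_ring_ideal p" "I \<subseteq> p" "p \<subseteq> m"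
  defines "e \<equiv> {x \<in> carrier B. \<exists>f g. g \<notin> m \<and> f \<in> p \<and> x \<otimes> \<theta> g = \<theta> f}"
  shows "primeideal e B" "\<And>f. \<theta> f \<in> e \<longleftrightarrow> f \<in> p"
proof -
  have pf: "0 \<in> p" "\<And>x y. x \<in> p \<Longrightarrow> y \<in> p \<Longrightarrow> x + y \<in> p" "\<And>a x. x \<in> p \<Longrightarrow> a * x \<in> p" "\<And>a x. x \<in> p \<Longrightarrow> x * a \<in> p"
     "\<And>x y. x * y \<in> p \<Longrightarrow> x \<in> p \<or> y \<in> p"
    using p(1) unfolding prime_ring_ideal_def ring_ideal_def by (auto simp: mult.commute)
  \<comment> \<open>Membership does not depend on the fraction chosen: as
    \<open>p \<subseteq> m\<close>, denominators lie outside the prime \<open>p\<close> and can be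
    cancelled.\<close>
  have e_iff: "x \<in> e \<longleftrightarrow> f \<in> p" if x: "x \<in> carrier B" "g \<notin> m" "x \<otimes> \<theta> g = \<theta> f" for x f g
  proof
    assume "x \<in> e"
    then obtain f' g' where fg: "g' \<notin> m" "f' \<in> p" "x \<otimes> \<theta> g' = \<theta> f'" by (auto simp: e_def)
    have "\<theta> (f * g') = (x \<otimes> \<theta> g) \<otimes> \<theta> g'" using x by (simp add: th_mult)
    also have "\<dots> = (x \<otimes> \<theta> g') \<otimes> \<theta> g" using x(1) th_closed[of g] th_closed[of g'] by algebra
    also have "\<dots> = \<theta> (f' * g)" using fg by (simp add: th_mult)
    finally obtain u where u: "u \<notin> m" "u * (f * g' - f' * g) \<in> I" unfolding th_eq_iff by auto
    then have "f * g' - f' * g \<in> p" using pf(5) p by blast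
    then have "(f * g' - f' * g) + f' * g \<in> p" using pf(2) pf(4)[OF fg(2)] by blast
    then have "f * g' \<in> p" by simp
    then show "f \<in> p" using pf(5) fg(1) p(3) by blast
  qed (use x in \<open>auto simp: e_def\<close>)
  show th_iff: "\<theta> f \<in> e \<longleftrightarrow> f \<in> p" for f
    by (rule e_iff[of _ 1]) (auto simp: m_facts th_one)
  have id: "ideal e B"
  proof (rule ideal_if_closed)
    show "e \<subseteq> carrier B" by (auto simp: e_def)
    show "\<zero> \<in> e" using th_iff[of 0] pf(1) by (simp add: th_0)
    fix x y assume y: "y \<in> e"
    then have yc: "y \<in> carrier B" by (simp add: e_def)
    obtain f' g' where y': "g' \<notin> m" "f' \<in> p" "y \<otimes> \<theta> g' = \<theta> f'" using y by (auto simp: e_def)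
    show "x \<oplus> y \<in> e" if x: "x \<in> e"
    proof -
      have xc: "x \<in> carrier B" using x by (simp add: e_def)
      obtain f g where x': "g \<notin> m" "f \<in> p" "x \<otimes> \<theta> g = \<theta> f" using x by (auto simp: e_def)
      have "(x \<oplus> y) \<otimes> \<theta> (g * g') = (x \<otimes> \<theta> g) \<otimes> \<theta> g' \<oplus> (y \<otimes> \<theta> g') \<otimes> \<theta> g"
        unfolding th_mult using xc yc th_closed[of g] th_closed[of g'] by algebra
      then have "(x \<oplus> y) \<otimes> \<theta> (g * g') = \<theta> (f * g' + f' * g)" by (simp add: x' y' th_mult th_add)
      moreover have "g * g' \<notin> m" using m_facts(6) x'(1) y'(1) by blast
      ultimately show ?thesis
        using e_iff[of "x \<oplus> y" "g * g'"] xc yc x' y' pf(2,4) by simp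
    qed
    show "x \<otimes> y \<in> e" if xc: "x \<in> carrier B"
    proof -
      obtain f g where x': "g \<notin> m" "\<theta> g \<in> Units B" "x \<otimes> \<theta> g = \<theta> f" using repr[OF xc] .
      have "(x \<otimes> y) \<otimes> \<theta> (g * g') = (x \<otimes> \<theta> g) \<otimes> (y \<otimes> \<theta> g')"
        unfolding th_mult using xc yc th_closed[of g] th_closed[of g'] by algebra
      then have "(x \<otimes> y) \<otimes> \<theta> (g * g') = \<theta> (f * f')" by (simp add: x' y' th_mult)
      moreover have "g * g' \<notin> m" using m_facts(6) x'(1) y'(1) by blast
      ultimately show ?thesis
        using e_iff[of "x \<otimes> y" "g * g'"] xc yc y' pf(3) by simp
    qed
  qed
  show "primeideal e B"
  proof (rule primeidealI[OF id cring_axioms])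
    show "carrier B \<noteq> e" using th_iff[of 1] m_facts(5) p(3) by (auto simp: th_one)
    fix x y assume xc: "x \<in> carrier B" and yc: "y \<in> carrier B" and xy: "x \<otimes> y \<in> e"
    obtain f g where x': "g \<notin> m" "\<theta> g \<in> Units B" "x \<otimes> \<theta> g = \<theta> f" using repr[OF xc] .
    obtain f' g' where y': "g' \<notin> m" "\<theta> g' \<in> Units B" "y \<otimes> \<theta> g' = \<theta> f'" using repr[OF yc] .
    have "(x \<otimes> y) \<otimes> \<theta> (g * g') = (x \<otimes> \<theta> g) \<otimes> (y \<otimes> \<theta> g')"
      unfolding th_mult using xc yc th_closed[of g] th_closed[of g'] by algebra
    then have "(x \<otimes> y) \<otimes> \<theta> (g * g') = \<theta> (f * f')" by (simp add: x' y' th_mult)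
    moreover have "g * g' \<notin> m" using m_facts(6) x'(1) y'(1) by blast
    ultimately have "f * f' \<in> p" using e_iff[of "x \<otimes> y" "g * g'"] xc yc xy by simp
    then show "x \<in> e \<or> y \<in> e" using pf(5) e_iff[OF xc x'(1,3)] e_iff[OF yc y'(1,3)] by blast
  qed
qed

text \<open>In a chain of three primes the middle one contracts to \<open>m\<close> by
  \<open>no\<close>, which leaves no room above it. A chain of two is given by the extension of
  \<open>p\<close> and the maximal ideal.\<close>

lemma krull_dim_eq_1:
  assumes ex: "prime_ring_ideal p" "I \<subseteq> p" "p \<subset> m"
    and no: "\<And>p q. prime_ring_ideal p \<Longrightarrow> prime_ring_ideal q \<Longrightarrow> I \<subseteq> p \<Longrightarrow> p \<subset> q \<Longrightarrow> q \<subseteq> m \<Longrightarrow> q = m"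
  shows "krull_dim B = 1"
proof -
  have "d \<le> 1" if P: "\<forall>i\<le>d. primeideal (P i) B" "\<forall>i<d. P i \<subset> P (Suc i)" for d P
  proof (rule ccontr)
    assume "\<not> d \<le> 1"
    then have d: "0 \<le> d" "Suc 0 \<le> d" "Suc (Suc 0) \<le> d" "0 < d" "Suc 0 < d" by auto
    define c where "c i = {f. \<theta> f \<in> P i}" for i
    have "c 0 \<subset> c (Suc 0)" "c (Suc 0) \<subset> c (Suc (Suc 0))"
      unfolding c_def using P d by (intro contraction_strict primeideal.axioms(1); simp)+
    moreover have "c (Suc 0) = m"
    proof (rule no[of "c 0" "c (Suc 0)"])
      have p: "primeideal (P 0) B" "primeideal (P (Suc 0)) B" using P d by auto
      show "prime_ring_ideal (c 0)" "prime_ring_ideal (c (Suc 0))" "I \<subseteq> c 0" "c (Suc 0) \<subseteq> m"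
        unfolding c_def using prime_contraction[OF p(1)] prime_contraction[OF p(2)] by simp_all
    qed fact
    moreover have "c (Suc (Suc 0)) \<subseteq> m"
      unfolding c_def using P d by (intro prime_contraction(3)) simp
    ultimately show False by blast
  qed
  then have "krull_dim B \<le> enat 1"
    unfolding krull_dim_def by (intro Sup_least) auto
  moreover have "enat 1 \<le> krull_dim B"
  proof -
    obtain e where e: "primeideal e B" "\<And>f. \<theta> f \<in> e \<longleftrightarrow> f \<in> p"
      using prime_extension[OF ex(1,2)] ex(3) by blast
    have nnp: "primeideal nn B" by (rule maximalideal_prime[OF maximal_nn])
    have "e \<subseteq> nn" using proper_ideal_sub_nn e(1) primeideal.I_notcarr[OF e(1)] by (auto dest: primeideal.axioms(1))
    moreover have "e \<noteq> nn" using e(2) th_nn_iff ex(3) by blast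
    ultimately have "e \<subset> nn" by auto
    then have "enat 1 \<in> {enat d | d. \<exists>p. (\<forall>i\<le>d. primeideal (p i) B) \<and> (\<forall>i<d. p i \<subset> p (Suc i))}"
      using e(1) nnp by (intro CollectI exI[of _ 1] conjI exI[of _ "\<lambda>i. if i = 0 then e else nn"]) auto
    then show ?thesis unfolding krull_dim_def by (rule Sup_upper)
  qed
  ultimately show ?thesis by (simp add: one_enat_def)
qed

lemma nonzerodivisor_th_iff: "nonzerodivisor (\<theta> f) \<longleftrightarrow> (\<forall>h. \<theta> (f * h) = \<zero> \<longrightarrow> \<theta> h = \<zero>)"
proof
  show "\<forall>h. \<theta> (f * h) = \<zero> \<longrightarrow> \<theta> h = \<zero>" if "nonzerodivisor (\<theta> f)"
    using that unfolding nonzerodivisor_def by (simp add: th_mult)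
  assume h: "\<forall>h. \<theta> (f * h) = \<zero> \<longrightarrow> \<theta> h = \<zero>"
  show "nonzerodivisor (\<theta> f)"
    unfolding nonzerodivisor_def
  proof (intro ballI impI)
    fix x assume x: "x \<in> carrier B" "\<theta> f \<otimes> x = \<zero>"
    obtain a g where ag: "g \<notin> m" "\<theta> g \<in> Units B" "x \<otimes> \<theta> g = \<theta> a" using repr[OF x(1)] .
    have "\<theta> (f * a) = (\<theta> f \<otimes> x) \<otimes> \<theta> g" unfolding th_mult ag(3)[symmetric] using m_assoc[of "\<theta> f" x "\<theta> g"] x(1) th_closed by simp
    then have "\<theta> a = \<zero>" using h x by simp
    then have "(x \<otimes> \<theta> g) \<otimes> inv (\<theta> g) = \<zero>" using ag by simp
    moreover have "(x \<otimes> \<theta> g) \<otimes> inv (\<theta> g) = x" by (rule mult_unit_inv[OF x(1) ag(2)])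
    ultimately show "x = \<zero>" by simp
  qed
qed

lemma th_PIdl_iff: "\<theta> f \<in> PIdl (\<theta> p) \<longleftrightarrow> (\<exists>u h. u \<notin> m \<and> u * f - h * p \<in> I)"
proof
  assume "\<theta> f \<in> PIdl (\<theta> p)"
  then obtain x where x: "x \<in> carrier B" "\<theta> f = x \<otimes> \<theta> p" by (auto simp: PIdl_mem_iff)
  obtain a g where ag: "g \<notin> m" "\<theta> g \<in> Units B" "x \<otimes> \<theta> g = \<theta> a" using repr[OF x(1)] .
  have "\<theta> (g * f) = (x \<otimes> \<theta> g) \<otimes> \<theta> p" unfolding th_mult x(2) using x(1) th_closed[of g] th_closed[of p] by algebra
  then have "\<theta> (g * f) = \<theta> (a * p)" by (simp add: ag th_mult)
  then obtain u where "u \<notin> m" "u * (g * f - a * p) \<in> I" unfolding th_eq_iff by auto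
  then show "\<exists>u h. u \<notin> m \<and> u * f - h * p \<in> I"
    using m_facts(6) ag(1) by (intro exI[of _ "u * g"] exI[of _ "u * a"]) (auto simp: algebra_simps)
next
  assume "\<exists>u h. u \<notin> m \<and> u * f - h * p \<in> I"
  then obtain u h where u: "u \<notin> m" "u * f - h * p \<in> I" by auto
  have uu: "\<theta> u \<in> Units B" using u th_Units_iff by simp
  have "\<theta> u \<otimes> \<theta> f = \<theta> h \<otimes> \<theta> p" using th_cong[OF u(2)] by (simp add: th_mult)
  then have "\<theta> f \<otimes> \<theta> u \<in> PIdl (\<theta> p)" by (auto simp: PIdl_mem_iff m_comm)
  then show "\<theta> f \<in> PIdl (\<theta> p)"
    using unit_mult_mem_ideal_iff[OF cgenideal_ideal[of "\<theta> p"] uu] by simp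
qed

lemma mem_PIdl_repr:
  assumes "x \<in> carrier B" "\<theta> g \<in> Units B" "x \<otimes> \<theta> g = \<theta> f" "y \<in> carrier B"
  shows "x \<in> PIdl y \<longleftrightarrow> \<theta> f \<in> PIdl y"
  using unit_mult_mem_ideal_iff[OF cgenideal_ideal[OF assms(4)] assms(2,1)] assms(3) by simp

text \<open>The coefficient relating two socle elements of \<open>B\<close> is a fraction;
  \<open>c\<close> and \<open>q\<close> are its numerator and denominator.\<close>

lemma socle_cyclic_iff:
  "socle_cyclic nn (\<theta> p) \<longleftrightarrow> (\<forall>a b. (\<forall>n\<in>m. \<theta> (n * a) \<in> PIdl (\<theta> p)) \<longrightarrow> (\<forall>n\<in>m. \<theta> (n * b) \<in> PIdl (\<theta> p)) \<longrightarrow>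
    \<theta> a \<notin> PIdl (\<theta> p) \<longrightarrow> (\<exists>c q. q \<notin> m \<and> \<theta> (q * b - c * a) \<in> PIdl (\<theta> p)))"
  (is "?L \<longleftrightarrow> ?R")
proof -
  interpret P: ideal "PIdl (\<theta> p)" B by (rule cgenideal_ideal) simp
  have nn_mult: "(\<forall>n\<in>nn. n \<otimes> x \<in> PIdl (\<theta> p)) \<longleftrightarrow> (\<forall>n\<in>m. \<theta> (n * a) \<in> PIdl (\<theta> p))"
    if x: "x \<in> carrier B" "g \<notin> m" "\<theta> g \<in> Units B" "x \<otimes> \<theta> g = \<theta> a" for x g a
  proof
    assume L: "\<forall>n\<in>nn. n \<otimes> x \<in> PIdl (\<theta> p)"
    show "\<forall>n\<in>m. \<theta> (n * a) \<in> PIdl (\<theta> p)"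
    proof
      fix n assume "n \<in> m"
      then have "\<theta> n \<otimes> x \<in> PIdl (\<theta> p)" using L th_nn_iff by blast
      then have "(\<theta> n \<otimes> x) \<otimes> \<theta> g \<in> PIdl (\<theta> p)" by (rule P.I_r_closed) simp
      then show "\<theta> (n * a) \<in> PIdl (\<theta> p)" using x by (simp add: th_mult m_assoc)
    qed
  next
    assume R: "\<forall>n\<in>m. \<theta> (n * a) \<in> PIdl (\<theta> p)"
    show "\<forall>n\<in>nn. n \<otimes> x \<in> PIdl (\<theta> p)"
    proof
      fix y assume y: "y \<in> nn"
      then have yc: "y \<in> carrier B" by (simp add: nn_def)
      obtain n g' where n: "g' \<notin> m" "\<theta> g' \<in> Units B" "y \<otimes> \<theta> g' = \<theta> n" using repr[OF yc] .
      then have "n \<in> m" using nn_iff[OF yc n(1,3)] y by simp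
      then have "\<theta> (n * a) \<in> PIdl (\<theta> p)" using R by blast
      moreover have "(y \<otimes> x) \<otimes> (\<theta> g \<otimes> \<theta> g') = (y \<otimes> \<theta> g') \<otimes> (x \<otimes> \<theta> g)"
        using x(1) yc th_closed[of g] th_closed[of g'] by algebra
      ultimately have "(y \<otimes> x) \<otimes> (\<theta> g \<otimes> \<theta> g') \<in> PIdl (\<theta> p)" using n x by (simp add: th_mult)
      then show "y \<otimes> x \<in> PIdl (\<theta> p)"
        using unit_mult_mem_ideal_iff[OF P.is_ideal, of "\<theta> g \<otimes> \<theta> g'" "y \<otimes> x"] x n yc by simp
    qed
  qed
  show ?thesis
  proof
    assume L: ?L
    show ?R
    proof (intro allI impI)
      fix a b assume ab: "\<forall>n\<in>m. \<theta> (n * a) \<in> PIdl (\<theta> p)" "\<forall>n\<in>m. \<theta> (n * b) \<in> PIdl (\<theta> p)" "\<theta> a \<notin> PIdl (\<theta> p)"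
      have "1 \<notin> m" "\<theta> 1 \<in> Units B" using m_facts(5) th_Units_iff by blast+
      then have "\<forall>n\<in>nn. n \<otimes> \<theta> a \<in> PIdl (\<theta> p)" "\<forall>n\<in>nn. n \<otimes> \<theta> b \<in> PIdl (\<theta> p)"
        using ab nn_mult[of "\<theta> a" 1 a] nn_mult[of "\<theta> b" 1 b] by (simp_all add: th_one)
      then obtain x where x: "x \<in> carrier B" "\<theta> b \<ominus> x \<otimes> \<theta> a \<in> PIdl (\<theta> p)"
        using L ab th_closed unfolding socle_cyclic_def by meson
      obtain c q where cq: "q \<notin> m" "\<theta> q \<in> Units B" "x \<otimes> \<theta> q = \<theta> c" using repr[OF x(1)] .
      have "\<theta> q \<otimes> (\<theta> b \<ominus> x \<otimes> \<theta> a) \<in> PIdl (\<theta> p)" using x by (intro P.I_l_closed) auto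
      moreover have "\<theta> q \<otimes> (\<theta> b \<ominus> x \<otimes> \<theta> a) = \<theta> q \<otimes> \<theta> b \<ominus> (x \<otimes> \<theta> q) \<otimes> \<theta> a"
        using x(1) th_closed[of q] th_closed[of a] th_closed[of b] by algebra
      ultimately have "\<theta> (q * b - c * a) \<in> PIdl (\<theta> p)" by (simp add: th_diff th_mult cq)
      then show "\<exists>c q. q \<notin> m \<and> \<theta> (q * b - c * a) \<in> PIdl (\<theta> p)" using cq by blast
    qed
  next
    assume R: ?R
    show ?L
      unfolding socle_cyclic_def
    proof (intro ballI impI)
      fix x y assume xc: "x \<in> carrier B" and yc: "y \<in> carrier B" and
        xy: "\<forall>n\<in>nn. n \<otimes> x \<in> PIdl (\<theta> p)" "\<forall>n\<in>nn. n \<otimes> y \<in> PIdl (\<theta> p)" "x \<notin> PIdl (\<theta> p)"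
      obtain a g where x': "g \<notin> m" "\<theta> g \<in> Units B" "x \<otimes> \<theta> g = \<theta> a" using repr[OF xc] .
      obtain b g' where y': "g' \<notin> m" "\<theta> g' \<in> Units B" "y \<otimes> \<theta> g' = \<theta> b" using repr[OF yc] .
      have "\<theta> a \<notin> PIdl (\<theta> p)" using mem_PIdl_repr[OF xc x'(2,3), of "\<theta> p"] xy by simp
      then obtain c q where cq: "q \<notin> m" "\<theta> (q * b - c * a) \<in> PIdl (\<theta> p)"
        using R xy nn_mult[OF xc x'] nn_mult[OF yc y'] by metis
      define w where "w = inv (\<theta> q \<otimes> \<theta> g')"
      have u: "\<theta> q \<otimes> \<theta> g' \<in> Units B" using cq y' th_Units_iff by simp
      then have w: "w \<in> carrier B" "w \<otimes> (\<theta> q \<otimes> \<theta> g') = \<one>" by (auto simp: w_def)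
      have "w \<otimes> \<theta> (q * b - c * a) \<in> PIdl (\<theta> p)" using w cq by (intro P.I_l_closed)
      moreover have "w \<otimes> \<theta> (q * b - c * a) = w \<otimes> (\<theta> q \<otimes> (y \<otimes> \<theta> g') \<ominus> \<theta> c \<otimes> (x \<otimes> \<theta> g))"
        by (simp add: th_diff th_mult x' y')
      moreover have "\<dots> = (w \<otimes> (\<theta> q \<otimes> \<theta> g')) \<otimes> y \<ominus> (w \<otimes> \<theta> c \<otimes> \<theta> g) \<otimes> x"
        using w(1) xc yc th_closed[of q] th_closed[of g] th_closed[of g'] th_closed[of c] by algebra
      ultimately have "y \<ominus> (w \<otimes> \<theta> c \<otimes> \<theta> g) \<otimes> x \<in> PIdl (\<theta> p)" using w yc by simp
      moreover have "w \<otimes> \<theta> c \<otimes> \<theta> g \<in> carrier B" using w by simp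
      ultimately show "\<exists>c\<in>carrier B. y \<ominus> c \<otimes> x \<in> PIdl (\<theta> p)" by (rule bexI)
    qed
  qed
qed

text \<open>Every element of \<open>nn\<close> is a unit multiple of an image under \<theta>, so the
  radical condition has to be verified for such images only.\<close>

lemma gorenstein_local_iff_socle_cyclic:
  assumes noeth: "noetherian_ring B" and dim: "krull_dim B = 1"
    and pi: "\<pi> \<in> m" "nonzerodivisor (\<theta> \<pi>)"
    and rad: "\<And>f z. f \<in> m \<Longrightarrow> nonzerodivisor (\<theta> f) \<Longrightarrow> z \<in> m \<Longrightarrow> \<exists>k::nat. \<theta> (z ^ k) \<in> PIdl (\<theta> f)"
  shows "(\<exists>\<nn>. gorenstein_local_ring B \<nn>) \<longleftrightarrow> socle_cyclic nn (\<theta> \<pi>)"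
proof -
  have rad': "\<exists>k::nat. z [^] k \<in> PIdl y" if y: "y \<in> nn" "nonzerodivisor y" and z: "z \<in> nn" for y z
  proof -
    have yc: "y \<in> carrier B" and zc: "z \<in> carrier B" using y z by (auto simp: nn_def)
    obtain f g where y': "g \<notin> m" "\<theta> g \<in> Units B" "y \<otimes> \<theta> g = \<theta> f" using repr[OF yc] .
    obtain f' g' where z': "g' \<notin> m" "\<theta> g' \<in> Units B" "z \<otimes> \<theta> g' = \<theta> f'" using repr[OF zc] .
    have "f \<in> m" "f' \<in> m" using nn_iff[OF yc y'(1,3)] nn_iff[OF zc z'(1,3)] y z by auto
    moreover have "nonzerodivisor (\<theta> f)"
      unfolding nonzerodivisor_def
    proof (intro ballI impI)
      fix x assume x: "x \<in> carrier B" "\<theta> f \<otimes> x = \<zero>"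
      have "y \<otimes> (\<theta> g \<otimes> x) = \<zero>" using x yc y' by (simp add: m_assoc[symmetric])
      then have "\<theta> g \<otimes> x = \<zero>" using y(2) x unfolding nonzerodivisor_def by auto
      then have "inv (\<theta> g) \<otimes> (\<theta> g \<otimes> x) = \<zero>" using y' by simp
      moreover have "inv (\<theta> g) \<otimes> (\<theta> g \<otimes> x) = x" using y' x by (simp add: m_assoc[symmetric])
      ultimately show "x = \<zero>" by simp
    qed
    ultimately obtain k :: nat where k: "\<theta> (f' ^ k) \<in> PIdl (\<theta> f)" using rad by blast
    then obtain q where q: "q \<in> carrier B" "\<theta> (f' ^ k) = q \<otimes> \<theta> f" by (auto simp: PIdl_mem_iff)
    then have "\<theta> (f' ^ k) = (q \<otimes> \<theta> g) \<otimes> y" unfolding y'(3)[symmetric]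
      using yc th_closed[of g] m_assoc m_comm by metis
    then have 1: "\<theta> (f' ^ k) \<in> PIdl y" using q by (auto simp: PIdl_mem_iff)
    have "z [^] k \<otimes> \<theta> (g' ^ k) = \<theta> (f' ^ k)"
      unfolding th_power z'(3)[symmetric] using zc by (simp add: nat_pow_distrib)
    moreover have "\<theta> (g' ^ k) \<in> Units B" using z' by (simp add: th_power Units_pow_closed)
    ultimately show ?thesis using 1 mem_PIdl_repr[of "z [^] k" "g' ^ k" "f' ^ k" y] zc yc by auto
  qed
  have "(\<exists>\<nn>. gorenstein_local_ring B \<nn>) \<longleftrightarrow> gorenstein_local_ring B nn"
    using maximal_unique unfolding gorenstein_local_ring_def noetherian_local_ring_def by blast
  also have "\<dots> \<longleftrightarrow> irreducible_ideal B (PIdl (\<theta> \<pi>))"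
    using pi rad' by (intro gorenstein_local_ring_iff_dim_1 noetherian_local noeth dim) (auto simp: nn_def th_nn_iff th_Units_iff)
  also have "\<dots> \<longleftrightarrow> socle_cyclic nn (\<theta> \<pi>)"
  proof
    assume "irreducible_ideal B (PIdl (\<theta> \<pi>))"
    then show "socle_cyclic nn (\<theta> \<pi>)" by (intro irreducible_imp_socle_cyclic) (auto simp: nn_def)
  next
    assume soc: "socle_cyclic nn (\<theta> \<pi>)"
    interpret N: noetherian_ring B by fact
    obtain G where G: "G \<subseteq> carrier B" "finite G" "nn = Idl G" using N.finetely_gen[OF ideal_nn] by auto
    have Gsub: "G \<subseteq> nn" using genideal_self[OF G(1)] G(3) by auto
    have pin: "\<theta> \<pi> \<in> nn" using pi th_nn_iff by simp
    have "PIdl (\<theta> \<pi>) \<subseteq> nn" using pin ideal_nn cgenideal_minimal by auto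
    then have "PIdl (\<theta> \<pi>) \<noteq> carrier B" using nn_neq by (auto simp: nn_def)
    then show "irreducible_ideal B (PIdl (\<theta> \<pi>))"
      using rad'[OF pin pi(2)] Gsub soc by (intro socle_cyclic_imp_irreducible[OF _ G(2,1,3)]) auto
  qed
  finally show ?thesis .
qed

end

section \<open>Polynomials restricted to lines\<close>

lemma sum_keys_superset:
  assumes "finite S" "Poly_Mapping.keys f \<subseteq> S" "\<And>m. G m 0 = 0"
  shows "(\<Sum>m\<in>Poly_Mapping.keys f. G m (Poly_Mapping.lookup f m)) = (\<Sum>m\<in>S. G m (Poly_Mapping.lookup f m))"
  by (rule sum.mono_neutral_left) (use assms in \<open>auto simp: in_keys_iff\<close>)

lemma sum_keys_add:
  fixes G :: "'a \<Rightarrow> 'b::comm_monoid_add \<Rightarrow> 'c::comm_monoid_add"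
  assumes z: "\<And>m. G m 0 = 0" and "\<And>m x y. G m (x + y) = G m x + G m y"
  shows "(\<Sum>m\<in>Poly_Mapping.keys (f + g). G m (Poly_Mapping.lookup (f + g) m)) =
    (\<Sum>m\<in>Poly_Mapping.keys f. G m (Poly_Mapping.lookup f m)) + (\<Sum>m\<in>Poly_Mapping.keys g. G m (Poly_Mapping.lookup g m))"
proof -
  let ?S = "Poly_Mapping.keys f \<union> Poly_Mapping.keys g"
  have "Poly_Mapping.keys (f + g) \<subseteq> ?S" by (rule Poly_Mapping.keys_add)
  then show ?thesis
    by (subst (1 2 3) sum_keys_superset[where S = ?S]) (auto simp: z lookup_add assms(2) sum.distrib)
qed

definition mono_val :: "('v::finite \<Rightarrow> 'k::comm_semiring_1) \<Rightarrow> ('v \<Rightarrow>\<^sub>0 nat) \<Rightarrow> 'k"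
  where "mono_val a m = (\<Prod>v\<in>UNIV. a v ^ Poly_Mapping.lookup m v)"

definition hcomp :: "nat \<Rightarrow> ('v::finite, 'k::comm_monoid_add) mpoly \<Rightarrow> ('v, 'k) mpoly"
  where "hcomp d f = (\<Sum>m\<in>Poly_Mapping.keys f. Poly_Mapping.single m (Poly_Mapping.lookup f m when mdegree m = d))"

text \<open>Restriction to the line through the origin and \<open>a\<close>: the variable
  \<open>v\<close> becomes \<open>t * a v\<close>. The coefficient at \<open>t ^ d\<close> is the
  value at \<open>a\<close> of the part of degree \<open>d\<close>, so homogeneous parts are handled
  all at once.\<close>

definition on_line :: "('v::finite \<Rightarrow> 'k::comm_ring_1) \<Rightarrow> ('v, 'k) mpoly \<Rightarrow> 'k poly"
  where "on_line a f = (\<Sum>m\<in>Poly_Mapping.keys f. Polynomial.monom (Poly_Mapping.lookup f m * mono_val a m) (mdegree m))"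

lemma mono_val_add: "mono_val a (m + m') = mono_val a m * mono_val a m'"
  by (simp add: mono_val_def lookup_add power_add prod.distrib)

lemma mono_val_0 [simp]: "mono_val a 0 = 1"
  by (simp add: mono_val_def)

lemma mono_val_single [simp]: "mono_val a (Poly_Mapping.single v 1) = a v"
proof -
  have "mono_val a (Poly_Mapping.single v 1) = (\<Prod>u\<in>UNIV. if u = v then a v else 1)"
    unfolding mono_val_def by (intro prod.cong) (auto simp: lookup_single when_def)
  then show ?thesis by simp
qed

lemma mdegree_add: "mdegree (m + m') = mdegree m + mdegree m'"
  by (simp add: mdegree_def lookup_add sum.distrib)

lemma mdegree_0 [simp]: "mdegree 0 = 0"
  by (simp add: mdegree_def)

lemma mdegree_eq_0_iff: "mdegree m = 0 \<longleftrightarrow> m = 0"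
  by (auto simp: mdegree_def intro: poly_mapping_eqI)

lemma mdegree_single [simp]: "mdegree (Poly_Mapping.single v n) = n"
proof -
  have "mdegree (Poly_Mapping.single v n) = (\<Sum>u\<in>UNIV. if u = v then n else 0)"
    unfolding mdegree_def by (intro sum.cong) (auto simp: lookup_single when_def)
  then show ?thesis by simp
qed

lemma exponent_Suc_split:
  assumes "mdegree m = Suc n"
  obtains v m' where "m = Poly_Mapping.single v 1 + m'" "mdegree m' = n"
proof -
  have "m \<noteq> 0" using assms by auto
  then obtain v where v: "Poly_Mapping.lookup m v \<noteq> 0"
    using poly_mapping_eqI[of m 0] by auto
  have m: "m = Poly_Mapping.single v 1 + (m - Poly_Mapping.single v 1)"
    by (rule poly_mapping_eqI) (use v in \<open>auto simp: lookup_add lookup_minus lookup_single when_def\<close>)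
  have "mdegree m = 1 + mdegree (m - Poly_Mapping.single v 1)"
    by (subst m) (simp only: mdegree_add mdegree_single)
  then show thesis using that m assms by simp
qed

lemma lookup_Const_mult [simp]: "Poly_Mapping.lookup (Const c * f) m = c * Poly_Mapping.lookup f m"
  for c :: "'k::comm_semiring_1"
  by (subst mpoly_eq_sum_single[of f])
    (auto simp: Const_def sum_distrib_left mult_single lookup_sum lookup_single when_def sum.delta in_keys_iff)

lemma Const_mult: "Const (a * b) = Const a * Const b"
  and Const_add: "Const (a + b) = Const a + Const b"
  and Const_0 [simp]: "Const 0 = 0"
  and Const_1 [simp]: "Const 1 = 1"
  for a b :: "'k::comm_semiring_1"
  by (simp_all add: Const_def mult_single single_add)

lemma Const_sum: "Const (\<Sum>i\<in>A. f i) = (\<Sum>i\<in>A. Const (f i :: 'k::comm_semiring_1))"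
  by (induction A rule: infinite_finite_induct) (auto simp: Const_add)

lemma lookup_Const: "Poly_Mapping.lookup (Const c) m = (c when m = 0)"
  by (auto simp: Const_def lookup_single when_def)

lemma lookup_hcomp: "Poly_Mapping.lookup (hcomp d f) m = (Poly_Mapping.lookup f m when mdegree m = d)"
  by (auto simp: hcomp_def lookup_sum lookup_single when_def sum.delta in_keys_iff)

lemma hcomp_0 [simp]: "hcomp d 0 = 0"
  by (simp add: hcomp_def)

lemma hcomp_in_forms: "hcomp d f \<in> forms d"
  by (auto simp: forms_def in_keys_iff lookup_hcomp)

lemma hcomp_sum: "hcomp d (\<Sum>i\<in>A. f i) = (\<Sum>i\<in>A. hcomp d (f i))"
  by (rule poly_mapping_eqI) (auto simp: lookup_hcomp lookup_sum when_def)

lemma hcomp_diff: "hcomp d (f - g) = hcomp d f - hcomp d g"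
  for f :: "('v::finite, 'k::comm_ring_1) mpoly"
  by (rule poly_mapping_eqI) (simp add: lookup_hcomp lookup_minus when_def)

lemma hcomp_Const_mult: "hcomp d (Const c * f) = Const c * hcomp d f"
  for f :: "('v::finite, 'k::comm_ring_1) mpoly"
  by (rule poly_mapping_eqI) (simp add: lookup_hcomp when_def)

lemma forms_lookup: "f \<in> forms d \<Longrightarrow> mdegree m \<noteq> d \<Longrightarrow> Poly_Mapping.lookup f m = 0"
  by (auto simp: forms_def in_keys_iff)

lemma formsI: "(\<And>m. mdegree m \<noteq> d \<Longrightarrow> Poly_Mapping.lookup f m = 0) \<Longrightarrow> f \<in> forms d"
  by (auto simp: forms_def in_keys_iff)

lemma hcomp_forms: "f \<in> forms d \<Longrightarrow> hcomp e f = (if e = d then f else 0)"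
  by (auto intro!: poly_mapping_eqI simp: lookup_hcomp when_def forms_lookup)

lemma mpoly_eq_sum_hcomp: obtains N where "f = (\<Sum>d\<le>N. hcomp d f)" "\<And>d. d > N \<Longrightarrow> hcomp d f = 0"
proof
  let ?N = "Max (insert 0 (mdegree ` Poly_Mapping.keys f))"
  have le: "mdegree m \<le> ?N" if "Poly_Mapping.lookup f m \<noteq> 0" for m
    using that by (intro Max_ge) (auto simp: in_keys_iff)
  show "f = (\<Sum>d\<le>?N. hcomp d f)"
  proof (rule poly_mapping_eqI)
    fix m
    have "Poly_Mapping.lookup (\<Sum>d\<le>?N. hcomp d f) m = (\<Sum>d\<le>?N. if mdegree m = d then Poly_Mapping.lookup f m else 0)"
      by (simp add: lookup_sum lookup_hcomp when_def)
    also have "\<dots> = Poly_Mapping.lookup f m"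
      using le[of m] by (subst sum.delta') auto
    finally show "Poly_Mapping.lookup f m = Poly_Mapping.lookup (\<Sum>d\<le>?N. hcomp d f) m" by simp
  qed
  show "hcomp d f = 0" if "d > ?N" for d
  proof (rule poly_mapping_eqI)
    fix m
    show "Poly_Mapping.lookup (hcomp d f) m = Poly_Mapping.lookup 0 m"
      using le[of m] that by (cases "Poly_Mapping.lookup f m = 0") (auto simp del: Max_less_iff simp: lookup_hcomp when_def)
  qed
qed

lemma forms_0 [simp]: "0 \<in> forms d"
  by (simp add: forms_def)

lemma forms_add: "f \<in> forms d \<Longrightarrow> g \<in> forms d \<Longrightarrow> f + g \<in> forms d"
  by (rule formsI) (simp add: lookup_add forms_lookup)

lemma forms_diff: "f \<in> forms d \<Longrightarrow> g \<in> forms d \<Longrightarrow> f - g \<in> forms d"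
  for f :: "('v::finite, 'k::comm_ring_1) mpoly"
  by (rule formsI) (simp add: lookup_minus forms_lookup)

lemma forms_sum: "(\<And>i. i \<in> A \<Longrightarrow> f i \<in> forms d) \<Longrightarrow> (\<Sum>i\<in>A. f i) \<in> forms d"
  by (induction A rule: infinite_finite_induct) (auto intro: forms_add)

lemma forms_mult: "f \<in> forms d \<Longrightarrow> g \<in> forms e \<Longrightarrow> f * g \<in> forms (d + e)"
  using keys_mult[of f g] by (fastforce simp: forms_def mdegree_add)

lemma forms_Const: "Const c \<in> forms 0"
  by (auto simp: forms_def Const_def)

lemma forms_Const_mult: "f \<in> forms d \<Longrightarrow> Const c * f \<in> forms d"
  using forms_mult[OF forms_Const] by fastforce

lemma forms_Var: "Var v \<in> forms 1"
  by (auto simp: forms_def Var_def)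

lemma forms_power: "f \<in> forms d \<Longrightarrow> f ^ n \<in> forms (n * d)"
  for f :: "('a::finite, 'b::comm_semiring_1) mpoly"
  using forms_Const[of "1::'b"] by (induction n) (auto intro: forms_mult)

lemma forms_0_eq_Const: "f \<in> forms 0 \<Longrightarrow> f = Const (Poly_Mapping.lookup f 0)"
  by (rule poly_mapping_eqI) (auto simp: lookup_Const when_def forms_lookup mdegree_eq_0_iff)

lemma on_line_add: "on_line a (f + g) = on_line a f + on_line a g"
  unfolding on_line_def by (rule sum_keys_add) (auto simp: distrib_right add_monom)

lemma on_line_0 [simp]: "on_line a 0 = 0"
  by (simp add: on_line_def)

lemma on_line_sum: "on_line a (\<Sum>i\<in>A. f i) = (\<Sum>i\<in>A. on_line a (f i))"
  by (induction A rule: infinite_finite_induct) (auto simp: on_line_add)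

lemma on_line_single: "on_line a (Poly_Mapping.single m c) = Polynomial.monom (c * mono_val a m) (mdegree m)"
  by (simp add: on_line_def)

lemma on_line_mult: "on_line a (f * g) = on_line a f * on_line a g"
proof -
  have on_mono: "on_line a (Poly_Mapping.single m c * Poly_Mapping.single m' c') =
      on_line a (Poly_Mapping.single m c) * on_line a (Poly_Mapping.single m' c')" for m m' c c'
    by (simp add: mult_single on_line_single mult_monom mono_val_add mdegree_add mult_ac)
  show ?thesis
    by (subst (1 2) mpoly_eq_sum_single[of f], subst (1 2) mpoly_eq_sum_single[of g])
      (simp add: sum_product on_line_sum on_mono)
qed

lemma on_line_Const [simp]: "on_line a (Const c) = [:c:]"
  by (simp add: Const_def on_line_single monom_0)

lemma on_line_1 [simp]: "on_line a 1 = 1"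
  using on_line_Const[of a 1] by (simp add: one_pCons)

lemma on_line_Var: "on_line a (Var v) = Polynomial.monom (a v) 1"
  unfolding Var_def by (subst on_line_single) (simp only: mono_val_single mdegree_single mult_1)

lemma on_line_uminus: "on_line a (- f) = - on_line a f"
  using on_line_add[of a f "- f"] by (simp add: add_eq_0_iff)

lemma on_line_diff: "on_line a (f - g) = on_line a f - on_line a g"
  using on_line_add[of a f "- g"] by (simp add: on_line_uminus)

lemma on_line_power: "on_line a (f ^ n) = on_line a f ^ n"
  by (induction n) (auto simp: on_line_mult)

lemma on_line_prod: "on_line a (\<Prod>i\<in>A. f i) = (\<Prod>i\<in>A. on_line a (f i))"
  by (induction A rule: infinite_finite_induct) (auto simp: on_line_mult)

lemma peval_conv_on_line: "peval f a = poly (on_line a f) 1"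
  by (simp add: peval_def on_line_def poly_sum poly_monom mono_val_def)

lemma on_line_forms: "f \<in> forms d \<Longrightarrow> on_line a f = Polynomial.monom (peval f a) d"
  unfolding on_line_def peval_def mono_val_def
  by (simp add: forms_def monom_sum)

lemma coeff_on_line: "Polynomial.coeff (on_line a f) d = peval (hcomp d f) a"
proof -
  obtain N where N: "f = (\<Sum>d\<le>N. hcomp d f)" "\<And>d. d > N \<Longrightarrow> hcomp d f = 0"
    using mpoly_eq_sum_hcomp[of f] by blast
  have "Polynomial.coeff (on_line a f) d = (\<Sum>e\<le>N. Polynomial.coeff (on_line a (hcomp e f)) d)"
    by (subst N(1)) (simp add: on_line_sum coeff_sum)
  also have "\<dots> = (\<Sum>e\<le>N. if e = d then peval (hcomp d f) a else 0)"
    by (intro sum.cong) (auto simp: on_line_forms[OF hcomp_in_forms])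
  also have "\<dots> = peval (hcomp d f) a"
    using N(2)[of d] by (auto simp: peval_def)
  finally show ?thesis .
qed

lemma peval_add: "peval (f + g) a = peval f a + peval g a"
  and peval_diff: "peval (f - g) a = peval f a - peval g a"
  and peval_mult: "peval (f * g) a = peval f a * peval g a"
  and peval_Const [simp]: "peval (Const c) a = c"
  and peval_power: "peval (f ^ n) a = peval f a ^ n"
  and peval_sum: "peval (\<Sum>i\<in>A. h i) a = (\<Sum>i\<in>A. peval (h i) a)"
  and peval_prod: "peval (\<Prod>i\<in>A. h i) a = (\<Prod>i\<in>A. peval (h i) a)"
  and peval_Var [simp]: "peval (Var v) a = a v"
  and peval_0 [simp]: "peval 0 a = 0"
  for f g :: "('v::finite, 'k::comm_ring_1) mpoly"
  by (simp_all add: peval_conv_on_line on_line_add on_line_diff on_line_mult on_line_power on_line_sum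
      on_line_prod on_line_Var poly_monom poly_sum poly_prod)

section \<open>Apolarity with powers of linear forms\<close>

lemma dact_Const_left: "Const c \<circle> g = Const c * g"
  using dact_single[of 0 c g] by (simp add: Const_def)

lemma dact_Const_right: "f \<circle> (Const c * g) = Const c * (f \<circle> g)"
  for f g :: "('v::finite, 'k::comm_ring_1) mpoly"
  by (metis dact_Const_left dact_mult mult.commute)

lemma dact_diff_left: "(f - h) \<circle> g = f \<circle> g - h \<circle> g"
  for f g h :: "('v::finite, 'k::comm_ring_1) mpoly"
  by (metis add_diff_cancel_right' dact_add_left diff_add_cancel)

lemma dact_Var_mult: "Var v \<circle> (g * h) = (Var v \<circle> g) * h + g * (Var v \<circle> h)"
proof -
  let ?e = "Poly_Mapping.single v (1::nat)"
  have on_mono: "Var v \<circle> (Poly_Mapping.single a c * Poly_Mapping.single b c') =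
      (Var v \<circle> Poly_Mapping.single a c) * Poly_Mapping.single b c'
      + Poly_Mapping.single a c * (Var v \<circle> Poly_Mapping.single b c')" for a b and c c' :: 'b
  proof -
    have 1: "a - ?e + b = a + b - ?e" if "Poly_Mapping.lookup a v \<noteq> 0" for a b
      by (rule poly_mapping_eqI) (use that in \<open>auto simp: lookup_add lookup_minus lookup_single when_def\<close>)
    \<comment> \<open>Truncated subtraction breaks the identity of exponents only if
      \<open>v\<close> does not occur in the differentiated factor, and then the coefficients on
      both sides are 0.\<close>
    have A: "Poly_Mapping.single (a - ?e + b) (of_nat (Poly_Mapping.lookup a v) * c * c')
        = Poly_Mapping.single (a + b - ?e) (of_nat (Poly_Mapping.lookup a v) * c * c')"
      using 1[of a b] by (cases "Poly_Mapping.lookup a v = 0") auto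
    have B: "Poly_Mapping.single (a + (b - ?e)) (of_nat (Poly_Mapping.lookup b v) * c * c')
        = Poly_Mapping.single (a + b - ?e) (of_nat (Poly_Mapping.lookup b v) * c * c')"
      using 1[of b a] by (cases "Poly_Mapping.lookup b v = 0") (auto simp: add.commute)
    show ?thesis
      unfolding mult_single dact_Var_single
      using A B by (simp add: lookup_add algebra_simps flip: single_add)
  qed
  show ?thesis
    by (subst (1 2 3) mpoly_eq_sum_single[of g], subst (1 2 3) mpoly_eq_sum_single[of h])
      (simp add: sum_product dact_sum_right on_mono sum.distrib)
qed

lemma dact_Var_Var: "Var u \<circle> Var v = Const (if u = v then 1 else 0)"
  unfolding Var_def[of v] dact_Var_single
  by (simp add: Const_def lookup_single)

lemma dact_Var_lin_form: "Var v \<circle> lin_form a = Const (a v)"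
proof -
  have "Var v \<circle> lin_form a = (\<Sum>u\<in>UNIV. if v = u then Const (a u) else 0)"
    unfolding lin_form_def dact_sum_right dact_Const_right dact_Var_Var
    by (intro sum.cong) auto
  then show ?thesis by simp
qed

lemma dact_Var_lin_form_power:
  "Var v \<circle> lin_form a ^ Suc n = Const (of_nat (Suc n) * a v) * lin_form a ^ n"
proof (induction n)
  case 0
  then show ?case by (simp add: dact_Var_lin_form)
next
  case (Suc n)
  have "Var v \<circle> lin_form a ^ Suc (Suc n) = Const (a v) * lin_form a ^ Suc n
      + lin_form a * (Const (of_nat (Suc n) * a v) * lin_form a ^ n)"
    by (subst power_Suc) (simp only: dact_Var_mult dact_Var_lin_form Suc)
  also have "\<dots> = Const (a v + of_nat (Suc n) * a v) * lin_form a ^ Suc n"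
    unfolding Const_add by (simp add: algebra_simps del: of_nat_Suc)
  finally show ?case by (simp add: algebra_simps)
qed

lemma dact_Const: "Var v \<circle> Const c = 0"
  unfolding Const_def dact_Var_single by simp

text \<open>The divided power of the linear form. With this normalization a derivative lowers the
  exponent without an integer factor, so a variable with coordinate 1 acts as a pure shift.\<close>

definition divpow :: "('v::finite \<Rightarrow> 'k::field_char_0) \<Rightarrow> nat \<Rightarrow> ('v, 'k) mpoly"
  where "divpow a n = Const (1 / fact n) * lin_form a ^ n"

lemma dact_Var_divpow_Suc: "Var v \<circle> divpow a (Suc n) = Const (a v) * divpow a n"
proof -
  have "1 / fact (Suc n) * (of_nat (Suc n) * a v) = a v * (1 / fact n)"
    by (simp del: of_nat_Suc)
  then show ?thesis
    unfolding divpow_def dact_Const_right dact_Var_lin_form_power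
    by (simp only: mult.assoc[symmetric] Const_mult[symmetric])
qed

lemma dact_Var_divpow_0: "Var v \<circle> divpow a 0 = 0"
  using dact_Const[of v 1] by (simp add: divpow_def)

lemma lin_form_forms: "lin_form a \<in> forms 1"
  unfolding lin_form_def by (intro forms_sum forms_Const_mult forms_Var)

lemma divpow_forms: "divpow a n \<in> forms n"
  unfolding divpow_def using forms_power[OF lin_form_forms, of a n] by (intro forms_Const_mult) simp

lemma mono_diff_divpow:
  "mono_diff m (divpow a n) =
    (if mdegree m \<le> n then Const (mono_val a m) * divpow a (n - mdegree m) else 0)"
proof (induction "mdegree m" arbitrary: m)
  case 0
  then have "m = 0" by (simp add: mdegree_eq_0_iff)
  then show ?case by simp
next
  case (Suc d)
  obtain v m' where m: "m = Poly_Mapping.single v 1 + m'" "mdegree m' = d"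
    using exponent_Suc_split[of m d] Suc.hyps(2) by auto
  have V: "mono_diff (Poly_Mapping.single v 1) g = Var v \<circle> g" for g :: "('a, 'b) mpoly"
    by (simp add: Var_def dact_single Const_def)
  have md: "mdegree m = Suc d" using Suc.hyps by simp
  have mv: "mono_val a m = a v * mono_val a m'"
    unfolding m mono_val_add mono_val_single ..
  have "mono_diff m (divpow a n) = Var v \<circle> mono_diff m' (divpow a n)"
    unfolding m mono_diff_mono_diff[symmetric] V ..
  also have "\<dots> = Var v \<circle> (if d \<le> n then Const (mono_val a m') * divpow a (n - d) else 0)"
    using Suc.hyps(1)[of m'] m(2) by simp
  also have "\<dots> = (if Suc d \<le> n then Const (mono_val a m) * divpow a (n - Suc d) else 0)"
  proof (cases "d < n")
    case True
    then obtain k where "n = Suc (d + k)" using less_iff_Suc_add by auto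
    moreover have "Var v \<circle> divpow a (Suc (d + k) - d) = Const (a v) * divpow a k"
      using dact_Var_divpow_Suc[of v a k] by (simp add: Suc_diff_le)
    ultimately show ?thesis
      by (simp add: dact_Const_right mv Const_mult mult_ac)
  next
    case False
    then show ?thesis by (auto simp: dact_Const_right dact_Var_divpow_0)
  qed
  finally show ?case by (simp only: md)
qed

text \<open>A monomial of degree \<open>d\<close> lowers the power by \<open>d\<close> and
  contributes its value at \<open>a\<close>. Hence only the restriction of \<open>f\<close> to the
  line of \<open>a\<close> enters, and the action becomes a statement on values at the
  points.\<close>

lemma dact_divpow:
  "f \<circle> divpow a n = (\<Sum>d\<le>n. Const (Polynomial.coeff (on_line a f) d) * divpow a (n - d))"
proof -
  have on_mono: "Poly_Mapping.single m c \<circle> divpow a n =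
      (\<Sum>d\<le>n. Const (Polynomial.coeff (on_line a (Poly_Mapping.single m c)) d) * divpow a (n - d))" for m c
  proof -
    have "(\<Sum>d\<le>n. Const (Polynomial.coeff (on_line a (Poly_Mapping.single m c)) d) * divpow a (n - d))
      = (\<Sum>d\<le>n. if mdegree m = d then Const (c * mono_val a m) * divpow a (n - mdegree m) else 0)"
      by (intro sum.cong) (auto simp: on_line_single)
    also have "\<dots> = Poly_Mapping.single m c \<circle> divpow a n"
      by (subst sum.delta') (auto simp: dact_single mono_diff_divpow)
    finally show ?thesis by simp
  qed
  have "f \<circle> divpow a n = (\<Sum>m\<in>Poly_Mapping.keys f. Poly_Mapping.single m (Poly_Mapping.lookup f m) \<circle> divpow a n)"
    by (subst mpoly_eq_sum_single[of f]) (rule dact_sum_left)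
  also have "\<dots> = (\<Sum>d\<le>n. Const (Polynomial.coeff (on_line a (\<Sum>m\<in>Poly_Mapping.keys f. Poly_Mapping.single m (Poly_Mapping.lookup f m))) d) * divpow a (n - d))"
    unfolding on_mono by (subst sum.swap) (simp add: on_line_sum coeff_sum Const_sum sum_distrib_right)
  finally show ?thesis unfolding mpoly_eq_sum_single[of f, symmetric] .
qed

lemma diff_coeff_eq_0: "\<not> Poly_Mapping.lookup m v \<le> Poly_Mapping.lookup a v \<Longrightarrow> diff_coeff m a = 0"
  unfolding diff_coeff_def
  by (rule prod_zero, simp, rule bexI[of _ v], rule prod_zero, simp,
      rule bexI[of _ "Poly_Mapping.lookup a v"]) auto

lemma diff_coeff_self_pos: "diff_coeff m m > 0"
  by (simp add: diff_coeff_def)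

text \<open>A monomial other than \<open>m\<close> has either some exponent smaller than that of
  \<open>m\<close>, and is killed, or some larger one, and leaves a nonconstant term.\<close>

lemma lookup_mono_diff_0: "Poly_Mapping.lookup (mono_diff m G) 0 = of_nat (diff_coeff m m) * Poly_Mapping.lookup G m"
proof -
  have "Poly_Mapping.lookup (mono_diff m G) 0 = (\<Sum>a\<in>Poly_Mapping.keys G.
      (of_nat (diff_coeff m a) * Poly_Mapping.lookup G a when a - m = 0))"
    by (simp add: mono_diff_def lookup_sum lookup_single)
  also have "\<dots> = (\<Sum>a\<in>Poly_Mapping.keys G. if a = m then of_nat (diff_coeff m m) * Poly_Mapping.lookup G m else 0)"
  proof (rule sum.cong[OF refl])
    fix a
    show "(of_nat (diff_coeff m a) * Poly_Mapping.lookup G a when a - m = 0)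
      = (if a = m then of_nat (diff_coeff m m) * Poly_Mapping.lookup G m else 0)"
    proof (cases "a = m")
      case False
      then obtain v where v: "Poly_Mapping.lookup a v \<noteq> Poly_Mapping.lookup m v"
        using poly_mapping_eqI[of a m] by auto
      show ?thesis
      proof (cases "Poly_Mapping.lookup a v < Poly_Mapping.lookup m v")
        case True
        then show ?thesis using False by (simp add: diff_coeff_eq_0[of m v a])
      next
        case 2: False
        then have "Poly_Mapping.lookup (a - m) v \<noteq> 0" using v by (simp add: lookup_minus)
        then have "a - m \<noteq> 0" by auto
        then show ?thesis using False by simp
      qed
    qed simp
  qed
  also have "\<dots> = of_nat (diff_coeff m m) * Poly_Mapping.lookup G m"
    by (simp add: in_keys_iff)
  finally show ?thesis .
qed

lemma lookup_dact_single_0: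
  "Poly_Mapping.lookup (Poly_Mapping.single m c \<circle> G) 0 = c * of_nat (diff_coeff m m) * Poly_Mapping.lookup G m"
  by (simp add: dact_single lookup_mono_diff_0 mult.assoc)

text \<open>The constant term of \<open>f \<circle> G\<close> pairs monomials diagonally. The
  weights \<open>diff_coeff m m\<close> are products of factorials, nonzero in characteristic
  0.\<close>

lemma eq_if_pairing_eq_on_forms:
  fixes G H :: "('v::finite, 'k::field_char_0) mpoly"
  assumes "\<And>f. f \<in> forms n \<Longrightarrow> Poly_Mapping.lookup (f \<circle> G) 0 = Poly_Mapping.lookup (f \<circle> H) 0"
  shows "hcomp n G = hcomp n H"
proof (rule poly_mapping_eqI)
  fix m
  show "Poly_Mapping.lookup (hcomp n G) m = Poly_Mapping.lookup (hcomp n H) m"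
  proof (cases "mdegree m = n")
    case True
    then have "Poly_Mapping.single m 1 \<in> forms n" by (auto simp: forms_def)
    from assms[OF this] diff_coeff_self_pos[of m] show ?thesis
      by (simp add: lookup_dact_single_0 lookup_hcomp)
  qed (simp add: lookup_hcomp)
qed

lemma lookup_divpow_0: "Poly_Mapping.lookup (divpow a n) 0 = (if n = 0 then 1 else 0)"
  using forms_lookup[OF divpow_forms, of 0 n a] by (auto simp: divpow_def lookup_Const)

lemma pairing_divpow: "Poly_Mapping.lookup (f \<circle> divpow a n) 0 = Polynomial.coeff (on_line a f) n"
proof -
  have "Poly_Mapping.lookup (f \<circle> divpow a n) 0 = (\<Sum>d\<le>n. if d = n then Polynomial.coeff (on_line a f) n else 0)"
    unfolding dact_divpow lookup_sum by (intro sum.cong) (auto simp: lookup_divpow_0)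
  then show ?thesis by simp
qed

text \<open>Induction on the number of functionals, restricting \<open>U\<close> to the kernel of
  the last one. If that functional is not zero on \<open>U\<close>, a vector \<open>z\<close>
  outside its kernel determines the remaining coefficient.\<close>

lemma functional_vanishing_on_common_kernel:
  fixes ev :: "nat \<Rightarrow> 'a::ab_group_add \<Rightarrow> 'k::field"
  assumes sc: "\<And>c x. x \<in> U \<Longrightarrow> scale c x \<in> U" and ad: "\<And>x y. x \<in> U \<Longrightarrow> y \<in> U \<Longrightarrow> x - y \<in> U"
    and ev: "\<And>i c x. ev i (scale c x) = c * ev i x" "\<And>i x y. ev i (x - y) = ev i x - ev i y"
    and l: "\<And>c x. l (scale c x) = c * l x" "\<And>x y. l (x - y) = l x - l y"
    and van: "\<And>x. x \<in> U \<Longrightarrow> (\<And>i. i \<in> {1..r} \<Longrightarrow> ev i x = 0) \<Longrightarrow> l x = 0"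
  shows "\<exists>v. \<forall>x\<in>U. l x = (\<Sum>i=1..r. v i * ev i x)"
  using sc ad van
proof (induction r arbitrary: U)
  case 0
  then show ?case by auto
next
  case (Suc r)
  let ?U = "{x \<in> U. ev (Suc r) x = 0}"
  have "\<exists>v. \<forall>x\<in>?U. l x = (\<Sum>i=1..r. v i * ev i x)"
    using Suc.prems by (intro Suc.IH) (auto simp: ev, metis atLeastAtMost_iff le_SucE)
  then obtain v where v: "\<And>x. x \<in> U \<Longrightarrow> ev (Suc r) x = 0 \<Longrightarrow> l x = (\<Sum>i=1..r. v i * ev i x)" by auto
  show ?case
  proof (cases "\<exists>z\<in>U. ev (Suc r) z \<noteq> 0")
    case False
    then show ?thesis using v by (intro exI[of _ v]) auto
  next
    case True
    then obtain z where z: "z \<in> U" "ev (Suc r) z \<noteq> 0" by auto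
    \<comment> \<open>The deficit of \<open>l\<close> against the combination found on the kernel.
      It vanishes there, hence is a multiple of the last functional.\<close>
    define g where "g = (\<lambda>x. l x - (\<Sum>i=1..r. v i * ev i x))"
    have "l x = (\<Sum>i=1..r. v i * ev i x) + g z / ev (Suc r) z * ev (Suc r) x" if x: "x \<in> U" for x
    proof -
      let ?c = "ev (Suc r) x / ev (Suc r) z"
      have "x - scale ?c z \<in> U" using x z Suc.prems by blast
      moreover have "ev (Suc r) (x - scale ?c z) = 0" using z by (simp add: ev)
      ultimately have "g (x - scale ?c z) = 0" using v by (simp add: g_def)
      then have "g x = ?c * g z"
        by (simp add: g_def l ev sum_subtractf algebra_simps sum_distrib_left)
      then show ?thesis by (simp add: g_def field_simps)
    qed
    then show ?thesis by (intro exI[of _ "v(Suc r := g z / ev (Suc r) z)"]) auto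
  qed
qed

section \<open>The coordinate ring of a finite set of points\<close>

text \<open>Kept apart from \<open>point_set\<close>, whose assumptions on \<open>s\<close> are
  derived here from the Hilbert function.\<close>

locale point_config =
  fixes P :: "nat \<Rightarrow> 'v::finite \<Rightarrow> 'k::{alg_closed_field, field_char_0}" and w :: 'v and r :: nat
  assumes inj_P: "inj_on P {1..r}"
    and P_w: "\<And>i. i \<in> {1..r} \<Longrightarrow> P i w = 1"
begin

abbreviation ol :: "nat \<Rightarrow> ('v, 'k) mpoly \<Rightarrow> 'k poly" where "ol i f \<equiv> on_line (P i) f"
abbreviation xw :: "('v, 'k) mpoly" where "xw \<equiv> Var w"

text \<open>Vanishing on the whole lines of the affine cone makes sense for inhomogeneous
  polynomials too; by \<open>vanishing_ideal_eq\<close> this is the homogeneous ideal of the points.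
  The ideal \<open>JX\<close> below is its sum with the principal ideal of
  \<open>xw\<close>.\<close>

definition IX :: "('v, 'k) mpoly set" where "IX = {f. \<forall>i\<in>{1..r}. ol i f = 0}"
definition JX :: "('v, 'k) mpoly set" where "JX = {f. \<exists>h. f - h * xw \<in> IX}"
definition V :: "nat \<Rightarrow> (nat \<Rightarrow> 'k) \<Rightarrow> bool" where "V d v \<longleftrightarrow> (\<exists>f\<in>forms d. \<forall>i\<in>{1..r}. peval f (P i) = v i)"

lemma ring_ideal_IX: "ring_ideal IX"
  unfolding ring_ideal_def IX_def by (auto simp: on_line_add on_line_mult)

text \<open>The coefficients of the restriction of \<open>f\<close> to a line are the values of the
  homogeneous parts of \<open>f\<close>, so \<open>f\<close> vanishes on the lines iff each of its
  parts vanishes at the points.\<close>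

lemma vanishing_ideal_eq: "vanishing_ideal (P ` {1..r}) = IX"
proof
  interpret R: cring "mpoly_ring :: ('v, 'k) mpoly ring" by (rule cring_from_type_algebra)
  let ?F = "{f. (\<exists>d. f \<in> forms d) \<and> (\<forall>a\<in>P ` {1..r}. peval f a = 0)}"
  have "?F \<subseteq> IX" by (auto simp: IX_def on_line_forms)
  then show "vanishing_ideal (P ` {1..r}) \<subseteq> IX"
    unfolding vanishing_ideal_def using ring_ideal_IX ring_ideal_iff by (intro R.genideal_minimal) auto
  have sub: "?F \<subseteq> carrier mpoly_ring" by (simp add: ring_of_type_algebra_def)
  then have gen: "ring_ideal (vanishing_ideal (P ` {1..r}))"
    unfolding vanishing_ideal_def ring_ideal_iff[symmetric] by (rule R.genideal_ideal)
  show "IX \<subseteq> vanishing_ideal (P ` {1..r})"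
  proof
    fix f assume f: "f \<in> IX"
    have "hcomp d f \<in> ?F" for d
    proof -
      have "peval (hcomp d f) (P i) = 0" if "i \<in> {1..r}" for i
        using f that coeff_on_line[of "P i" f d] by (simp add: IX_def)
      then show ?thesis using hcomp_in_forms[of d f] by auto
    qed
    then have mem: "hcomp d f \<in> vanishing_ideal (P ` {1..r})" for d
      unfolding vanishing_ideal_def using R.genideal_self[OF sub] by blast
    obtain N where N: "f = (\<Sum>d\<le>N. hcomp d f)" using mpoly_eq_sum_hcomp[of f] by blast
    have "(\<Sum>d\<le>n. hcomp d f) \<in> vanishing_ideal (P ` {1..r})" for n
      using gen mem by (induction n) (auto simp: ring_ideal_def)
    then show "f \<in> vanishing_ideal (P ` {1..r})" by (subst N)
  qed
qed

lemma on_line_X: "i \<in> {1..r} \<Longrightarrow> ol i xw = [:0, 1:]"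
  by (simp add: on_line_Var P_w monom_Suc monom_0)

lemma V_mono: "V d v \<Longrightarrow> d \<le> e \<Longrightarrow> V e v"
proof -
  assume "V d v" "d \<le> e"
  then obtain f where f: "f \<in> forms d" "\<forall>i\<in>{1..r}. peval f (P i) = v i" by (auto simp: V_def)
  have "xw ^ (e - d) * f \<in> forms e"
    using forms_mult[OF forms_power[OF forms_Var, of w "e - d"] f(1)] \<open>d \<le> e\<close> by simp
  moreover have "\<forall>i\<in>{1..r}. peval (xw ^ (e - d) * f) (P i) = v i"
    using f(2) P_w by (simp add: peval_mult peval_power)
  ultimately show "V e v" unfolding V_def by blast
qed

end

locale point_set = point_config P w r
  for P :: "nat \<Rightarrow> 'v::finite \<Rightarrow> 'k::{alg_closed_field, field_char_0}" and w :: 'v and r :: nat +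
  fixes s :: nat
  assumes s_pos: "s > 0"
    and full: "\<And>v. V s v"
    and not_full: "\<exists>v. \<not> V (s - 1) v"
begin

lemma V_full: "d \<ge> s \<Longrightarrow> V d v"
  using full V_mono by blast

text \<open>For each degree \<open>d \<ge> s\<close> one form of degree \<open>d\<close> realizes
  all coefficients at \<open>t ^ d\<close>, as such forms take arbitrary values at the points; these
  forms are added up.\<close>

lemma ex_restrictions:
  assumes "\<And>i. i \<in> {1..r} \<Longrightarrow> Polynomial.monom 1 s dvd q i"
  shows "\<exists>h. \<forall>i\<in>{1..r}. ol i h = q i"
proof -
  define D where "D = Max (insert s ((\<lambda>i. Polynomial.degree (q i)) ` {1..r}))"
  have D: "Polynomial.degree (q i) \<le> D" if "i \<in> {1..r}" for i
    unfolding D_def using that by (intro Max_ge) auto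
  have "\<exists>f\<in>forms d. \<forall>i\<in>{1..r}. peval f (P i) = Polynomial.coeff (q i) d" if "d \<ge> s" for d
    using V_full[OF that] by (auto simp: V_def)
  then obtain g where g: "\<And>d. d \<ge> s \<Longrightarrow> g d \<in> forms d"
    "\<And>d i. d \<ge> s \<Longrightarrow> i \<in> {1..r} \<Longrightarrow> peval (g d) (P i) = Polynomial.coeff (q i) d" by metis
  have "ol i (\<Sum>d\<in>{s..D}. g d) = q i" if i: "i \<in> {1..r}" for i
  proof -
    have "ol i (\<Sum>d\<in>{s..D}. g d) = (\<Sum>d\<in>{s..D}. Polynomial.monom (Polynomial.coeff (q i) d) d)"
      unfolding on_line_sum using i by (intro sum.cong) (auto simp: on_line_forms[OF g(1)] g(2))
    also have "\<dots> = (\<Sum>d\<le>D. Polynomial.monom (Polynomial.coeff (q i) d) d)"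
      using assms[OF i] by (intro sum.mono_neutral_left) (auto simp: monom_1_dvd_iff')
    also have "\<dots> = q i" by (rule poly_as_sum_of_monoms'[OF D[OF i]])
    finally show ?thesis .
  qed
  then show ?thesis by blast
qed

text \<open>The polynomial \<open>h\<close> evaluated at \<open>xw\<close>. It restricts to
  \<open>h\<close> on every line, since \<open>xw\<close> is 1 at the points; so the coordinate ring
  is a module over \<open>k[t]\<close> compatible with restriction.\<close>

definition polyX :: "'k poly \<Rightarrow> ('v, 'k) mpoly"
  where "polyX h = (\<Sum>d\<le>Polynomial.degree h. Const (Polynomial.coeff h d) * xw ^ d)"

lemma on_line_polyX: "i \<in> {1..r} \<Longrightarrow> ol i (polyX h) = h"
proof -
  assume i: "i \<in> {1..r}"
  have "ol i (Const (Polynomial.coeff h d) * xw ^ d) = Polynomial.monom (Polynomial.coeff h d) d" for d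
    by (simp add: on_line_mult on_line_power on_line_X[OF i] monom_altdef)
  then show ?thesis by (simp add: polyX_def on_line_sum poly_as_sum_of_monoms)
qed

text \<open>The image of \<open>Q\<close> under restriction is a \<open>k[t]\<close>-submodule of
  \<open>k[t] ^ r\<close>. Lines are added one at a time: among elements of \<open>Q\<close>
  vanishing on the first \<open>n\<close> lines, one of least degree on the next line divides all
  the others there.\<close>

lemma finitely_generated_modulo_IX:
  assumes Q: "ring_ideal Q"
  shows "\<exists>G c. finite G \<and> G \<subseteq> Q \<and> (\<forall>f\<in>Q. f - (\<Sum>g\<in>G. c f g * g) \<in> IX)"
proof -
  have Qf: "0 \<in> Q" "\<And>x y. x \<in> Q \<Longrightarrow> y \<in> Q \<Longrightarrow> x - y \<in> Q" "\<And>a x. x \<in> Q \<Longrightarrow> a * x \<in> Q"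
    using Q ring_ideal_diff[OF Q] by (auto simp: ring_ideal_def)
  have "\<exists>G. finite G \<and> G \<subseteq> Q \<and> (\<forall>f\<in>Q. \<exists>c. \<forall>i\<in>{1..n}. ol i (f - (\<Sum>g\<in>G. c g * g)) = 0)" if "n \<le> r" for n
    using that
  proof (induction n)
    case 0
    then show ?case by (intro exI[of _ "{}"]) auto
  next
    case (Suc n)
    then obtain G where G: "finite G" "G \<subseteq> Q"
      "\<And>f. f \<in> Q \<Longrightarrow> \<exists>c. \<forall>i\<in>{1..n}. ol i (f - (\<Sum>g\<in>G. c g * g)) = 0" by auto
    have n: "Suc n \<in> {1..r}" using Suc by auto
    define T where "T = {f \<in> Q. \<forall>i\<in>{1..n}. ol i f = 0}"
    have red: "f - (\<Sum>g\<in>G. c g * g) \<in> Q" if "f \<in> Q" for f c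
    proof -
      have "(\<Sum>g\<in>H. c g * g) \<in> Q" if "H \<subseteq> G" for H
        using finite_subset[OF that G(1)] that
      proof (induction H rule: finite_induct)
        case (insert h H)
        then show ?case using Q G(2) by (auto simp: ring_ideal_def)
      qed (use Qf in auto)
      then show ?thesis using Qf that by blast
    qed
    show ?case
    proof (cases "\<exists>f\<in>T. ol (Suc n) f \<noteq> 0")
      case False
      have "\<exists>c. \<forall>i\<in>{1..Suc n}. ol i (f - (\<Sum>g\<in>G. c g * g)) = 0" if f: "f \<in> Q" for f
      proof -
        obtain c where c: "\<forall>i\<in>{1..n}. ol i (f - (\<Sum>g\<in>G. c g * g)) = 0" using G(3)[OF f] by auto
        then have "f - (\<Sum>g\<in>G. c g * g) \<in> T" using red[OF f] by (simp add: T_def)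
        then have "ol (Suc n) (f - (\<Sum>g\<in>G. c g * g)) = 0" using False by blast
        then show ?thesis using c by (intro exI[of _ c]) (auto simp: le_Suc_eq)
      qed
      then show ?thesis using G by blast
    next
      case True
      \<comment> \<open>The candidates for the additional generator; \<open>q\<close> has least
        degree on line \<open>Suc n\<close>, and division with remainder can be carried out with
        \<open>polyX\<close>.\<close>
      define A where "A f \<longleftrightarrow> f \<in> T \<and> ol (Suc n) f \<noteq> 0" for f
      define q where "q = (ARG_MIN (\<lambda>f. Polynomial.degree (ol (Suc n) f)) f. A f)"
      obtain f0 where f0: "A f0" using True by (auto simp: A_def)
      have q: "A q" unfolding q_def using f0 by (rule arg_min_natI)
      have qmin: "Polynomial.degree (ol (Suc n) q) \<le> Polynomial.degree (ol (Suc n) f)" if "A f" for f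
        unfolding q_def using that by (rule arg_min_nat_le)
      have qT: "q \<in> Q" "\<And>i. i \<in> {1..n} \<Longrightarrow> ol i q = 0" "ol (Suc n) q \<noteq> 0" using q by (auto simp: A_def T_def)
      have dvd: "ol (Suc n) f = (ol (Suc n) f div ol (Suc n) q) * ol (Suc n) q" if f: "f \<in> T" for f
      proof (rule ccontr)
        assume ne: "ol (Suc n) f \<noteq> (ol (Suc n) f div ol (Suc n) q) * ol (Suc n) q"
        let ?d = "ol (Suc n) f div ol (Suc n) q"
        let ?f = "f - polyX ?d * q"
        have "?f \<in> T" using f qT Qf by (auto simp: T_def on_line_diff on_line_mult)
        moreover have e: "ol (Suc n) ?f = ol (Suc n) f mod ol (Suc n) q"
          using on_line_polyX[OF n, of ?d] by (simp add: on_line_diff on_line_mult minus_div_mult_eq_mod)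
        moreover have nz: "ol (Suc n) f mod ol (Suc n) q \<noteq> 0" using ne by (metis add.right_neutral div_mult_mod_eq)
        ultimately have "A ?f" by (simp add: A_def)
        then have "Polynomial.degree (ol (Suc n) q) \<le> Polynomial.degree (ol (Suc n) f mod ol (Suc n) q)"
          using qmin e by metis
        then show False using degree_mod_less[OF qT(3), of "ol (Suc n) f"] nz by simp
      qed
      have "\<exists>c. \<forall>i\<in>{1..Suc n}. ol i (f - (\<Sum>g\<in>insert q G. c g * g)) = 0" if f: "f \<in> Q" for f
      proof -
        obtain c where c: "\<forall>i\<in>{1..n}. ol i (f - (\<Sum>g\<in>G. c g * g)) = 0" using G(3)[OF f] by auto
        let ?f = "f - (\<Sum>g\<in>G. c g * g)"
        let ?d = "polyX (ol (Suc n) ?f div ol (Suc n) q)"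
        have fT: "?f \<in> T" using red[OF f] c by (simp add: T_def)
        \<comment> \<open>The case distinction on \<open>q \<in> G\<close> is needed because
          \<open>insert q G\<close> would not count \<open>q\<close> twice.\<close>
        define c' where "c' g = (if g = q then (if q \<in> G then c q else 0) + ?d else c g)" for g
        have "(\<Sum>g\<in>insert q G. c' g * g) = (\<Sum>g\<in>G. c g * g) + ?d * q"
        proof (cases "q \<in> G")
          case True
          have "(\<Sum>g\<in>G. c' g * g) = (\<Sum>g\<in>G. c g * g + (if g = q then ?d * q else 0))"
            using True by (intro sum.cong) (auto simp: c'_def algebra_simps)
          then show ?thesis using True G(1) by (simp add: sum.distrib insert_absorb)
        next
          case False
          have "(\<Sum>g\<in>G. c' g * g) = (\<Sum>g\<in>G. c g * g)"
            using False by (intro sum.cong) (auto simp: c'_def)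
          then show ?thesis using False G(1) by (simp add: c'_def)
        qed
        then have e: "f - (\<Sum>g\<in>insert q G. c' g * g) = ?f - ?d * q" by simp
        have "ol i (?f - ?d * q) = 0" if "i \<in> {1..Suc n}" for i
        proof (cases "i = Suc n")
          case True
          then show ?thesis using dvd[OF fT] by (simp only: on_line_diff[of _ ?f] on_line_mult on_line_polyX[OF n]) simp
        next
          case False
          then have "i \<in> {1..n}" using that by auto
          then show ?thesis using c qT(2) by (simp only: on_line_diff[of _ ?f] on_line_mult) simp
        qed
        then show ?thesis unfolding e[symmetric] by blast
      qed
      then show ?thesis using G qT(1) by (intro exI[of _ "insert q G"]) auto
    qed
  qed
  from this[OF order_refl] obtain G where G: "finite G" "G \<subseteq> Q"
    "\<forall>f\<in>Q. \<exists>c. \<forall>i\<in>{1..r}. ol i (f - (\<Sum>g\<in>G. c g * g)) = 0" by (elim exE conjE)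
  have "\<forall>f\<in>Q. \<exists>c. f - (\<Sum>g\<in>G. c g * g) \<in> IX" unfolding IX_def mem_Collect_eq by (rule G(3))
  then have "\<exists>c. \<forall>f\<in>Q. f - (\<Sum>g\<in>G. c f g * g) \<in> IX" by (rule bchoice)
  then show ?thesis using G(1,2) by blast
qed

text \<open>The maximal ideal of the point \<open>c P j\<close> of the affine cone. Then follow the
  prime of a line and the set of lines through that point: all of them at the origin, only line
  \<open>j\<close> elsewhere.\<close>

definition mpt :: "nat \<Rightarrow> 'k \<Rightarrow> ('v, 'k) mpoly set" where "mpt j c = {f. poly (ol j f) c = 0}"
definition pline :: "nat \<Rightarrow> ('v, 'k) mpoly set" where "pline i = {f. ol i f = 0}"
definition lines_through :: "nat \<Rightarrow> 'k \<Rightarrow> nat set" where "lines_through j c = {i \<in> {1..r}. c = 0 \<or> i = j}"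

lemma prime_mpt: "prime_ring_ideal (mpt j c)"
  unfolding prime_ring_ideal_def ring_ideal_def mpt_def by (auto simp: on_line_add on_line_mult)

lemma prime_pline: "prime_ring_ideal (pline i)"
  unfolding prime_ring_ideal_def ring_ideal_def pline_def by (auto simp: on_line_add on_line_mult)

lemma IX_sub_pline: "i \<in> {1..r} \<Longrightarrow> IX \<subseteq> pline i"
  by (auto simp: IX_def pline_def)

lemma pline_sub_mpt: "pline i \<subseteq> mpt i c"
  by (auto simp: pline_def mpt_def)

lemma poly_on_line_0: "poly (ol i f) 0 = Poly_Mapping.lookup f 0"
proof -
  have "poly (ol i f) 0 = peval (hcomp 0 f) (P i)" using coeff_on_line[of "P i" f 0] by (simp add: poly_0_coeff_0)
  also have "\<dots> = Poly_Mapping.lookup f 0"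
    by (subst forms_0_eq_Const[OF hcomp_in_forms]) (simp add: lookup_hcomp)
  finally show ?thesis .
qed

lemma mpt_0: "mpt j 0 = {f. Poly_Mapping.lookup f 0 = 0}"
  by (simp add: mpt_def poly_on_line_0)

lemma mpt_lines_through: "i \<in> lines_through j c \<Longrightarrow> mpt i c = mpt j c"
  by (cases "c = 0") (auto simp: lines_through_def mpt_0)

text \<open>If \<open>P i\<close> and \<open>P j\<close> differ in the coordinate \<open>v\<close>,
  the linear form \<open>Var v - Const (P i v) * xw\<close> vanishes on line \<open>i\<close> and
  has the value \<open>c * (P j v - P i v)\<close> at \<open>c P j\<close>.\<close>

lemma lines_throughI:
  assumes "i \<in> {1..r}" "j \<in> {1..r}" "pline i \<subseteq> mpt j c"
  shows "i \<in> lines_through j c"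
proof (rule ccontr)
  assume "i \<notin> lines_through j c"
  then have c: "c \<noteq> 0" "i \<noteq> j" using assms by (auto simp: lines_through_def)
  then have "P i \<noteq> P j" using inj_P assms by (auto dest: inj_onD)
  then obtain v where v: "P i v \<noteq> P j v" by auto
  let ?f = "Var v - Const (P i v) * xw"
  have "?f \<in> pline i"
    by (simp add: pline_def on_line_diff on_line_mult on_line_Var P_w[OF assms(1)] smult_monom)
  then have "?f \<in> mpt j c" using assms by auto
  then show False
    using v c by (simp add: mpt_def on_line_diff on_line_mult on_line_Var P_w[OF assms(2)] poly_monom)
qed

text \<open>Otherwise choose an element outside \<open>p\<close> from the ideal of each line. Their
  product vanishes on all lines but is not in the prime \<open>p\<close>.\<close>

lemma prime_contains_pline:
  assumes p: "prime_ring_ideal p" "IX \<subseteq> p"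
  shows "\<exists>i\<in>{1..r}. pline i \<subseteq> p"
proof (rule ccontr)
  assume "\<not> ?thesis"
  then have "\<forall>i\<in>{1..r}. \<exists>f. f \<in> pline i \<and> f \<notin> p" by auto
  then obtain f where f: "\<And>i. i \<in> {1..r} \<Longrightarrow> f i \<in> pline i \<and> f i \<notin> p" by metis
  have "(\<Prod>i\<in>A. f i) \<notin> p" if "A \<subseteq> {1..r}" for A
    using finite_subset[OF that finite_atLeastAtMost] that
  proof (induction A rule: finite_induct)
    case empty
    then show ?case using p by (simp add: prime_ring_ideal_def)
  next
    case (insert i A)
    then have "f i \<notin> p" "prod f A \<notin> p" using f by auto
    then show ?case using insert p(1) by (auto simp: prime_ring_ideal_def)
  qed
  moreover have "(\<Prod>i\<in>{1..r}. f i) \<in> IX"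
  proof -
    have "ol i (\<Prod>i\<in>{1..r}. f i) = 0" if "i \<in> {1..r}" for i
      unfolding on_line_prod using f[OF that] that by (intro prod_zero) (auto simp: pline_def)
    then show ?thesis by (simp add: IX_def)
  qed
  ultimately show False using p by blast
qed

lemma xc_mem: "j \<in> {1..r} \<Longrightarrow> xw - Const c \<in> mpt j c"
  by (simp add: mpt_def on_line_diff on_line_X)

lemma on_line_xc: "i \<in> {1..r} \<Longrightarrow> ol i (xw - Const c) = [:- c, 1:]"
  by (simp add: on_line_diff on_line_X)

text \<open>On line \<open>i\<close> an element of \<open>mpt i c\<close> is divisible by
  \<open>t - c\<close>; the cofactor is lifted by \<open>polyX\<close>.\<close>

lemma pline_xc_imp_mpt:
  assumes Q: "ring_ideal Q" "pline i \<subseteq> Q" "xw - Const c \<in> Q" and i: "i \<in> {1..r}"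
  shows "mpt i c \<subseteq> Q"
proof
  fix g assume g: "g \<in> mpt i c"
  then have "[:- c, 1:] dvd ol i g" by (simp add: mpt_def poly_eq_0_iff_dvd)
  then obtain h where h: "ol i g = [:- c, 1:] * h" by (auto simp: dvd_def)
  have "g - polyX h * (xw - Const c) \<in> pline i"
    by (simp add: pline_def on_line_diff[of _ g] on_line_mult on_line_xc[OF i] on_line_polyX[OF i] h)
  then have "g - polyX h * (xw - Const c) \<in> Q" "polyX h * (xw - Const c) \<in> Q"
    using Q by (auto simp: ring_ideal_def)
  then have "(g - polyX h * (xw - Const c)) + polyX h * (xw - Const c) \<in> Q"
    using Q(1) unfolding ring_ideal_def by blast
  then show "g \<in> Q" by simp
qed

lemma prime_power_mem: "prime_ring_ideal p \<Longrightarrow> x ^ n \<in> p \<Longrightarrow> x \<in> p"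
  by (induction n) (auto simp: prime_ring_ideal_def)

lemma order_split:
  fixes p :: "'k poly"
  assumes "p \<noteq> 0"
  shows "\<exists>u k. p = [:- c, 1:] ^ k * u \<and> poly u c \<noteq> 0"
proof -
  obtain u where u: "p = [:- c, 1:] ^ order c p * u" "\<not> [:- c, 1:] dvd u"
    using order_decomp[OF assms, of c] by auto
  then show ?thesis by (metis poly_eq_0_iff_dvd)
qed

text \<open>Some \<open>pline i\<close> lies in \<open>p\<close>, so on line \<open>i\<close> an
  element of \<open>q\<close> outside \<open>p\<close> is \<open>(t - c) ^ k * u\<close> with
  \<open>u\<close> nonzero at \<open>c\<close>. The lift of \<open>u\<close> is outside
  \<open>q\<close>, hence \<open>xw - Const c\<close> is in \<open>q\<close>.\<close>

lemma primes_below_mpt: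
  assumes j: "j \<in> {1..r}" and p: "prime_ring_ideal p" "prime_ring_ideal q" "IX \<subseteq> p" "p \<subset> q" "q \<subseteq> mpt j c"
  shows "q = mpt j c"
proof -
  obtain i where i: "i \<in> {1..r}" "pline i \<subseteq> p" using prime_contains_pline p by blast
  then have m: "mpt i c = mpt j c" using p by (intro mpt_lines_through lines_throughI j) auto
  have Q: "ring_ideal q" "pline i \<subseteq> q" using p i by (auto simp: prime_ring_ideal_def)
  obtain f where f: "f \<in> q" "f \<notin> p" using p by auto
  then have "ol i f \<noteq> 0" using i by (auto simp: pline_def)
  then obtain u k where u: "ol i f = [:- c, 1:] ^ k * u" "poly u c \<noteq> 0" using order_split by blast
  let ?g = "(xw - Const c) ^ k * polyX u"
  have "f - ?g \<in> pline i"
    by (simp add: pline_def on_line_diff[of _ f] on_line_mult on_line_power on_line_xc[OF i(1)] on_line_polyX[OF i(1)] u(1))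
  then have "f - (f - ?g) \<in> q" using Q f ring_ideal_diff by blast
  then have "?g \<in> q" by simp
  moreover have "polyX u \<notin> q"
  proof
    assume "polyX u \<in> q"
    then have "polyX u \<in> mpt i c" using p m by auto
    then show False using u(2) by (simp add: mpt_def on_line_polyX[OF i(1)])
  qed
  ultimately have "(xw - Const c) ^ k \<in> q" using p(2) unfolding prime_ring_ideal_def by blast
  then have "xw - Const c \<in> q" by (rule prime_power_mem[OF p(2)])
  then have "mpt i c \<subseteq> q" using pline_xc_imp_mpt Q i by blast
  then show ?thesis using m p by auto
qed

lemma pline_below_mpt: "j \<in> {1..r} \<Longrightarrow> pline j \<subset> mpt j c"
proof -
  assume j: "j \<in> {1..r}"
  have "xw - Const c \<notin> pline j" by (simp add: pline_def on_line_xc[OF j])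
  then show ?thesis using xc_mem[OF j] pline_sub_mpt by blast
qed

text \<open>Such a prime contains some \<open>pline i\<close> and an \<open>f\<close> not vanishing
  on that line, hence also the lift of the restriction of \<open>f\<close>. Over an algebraically
  closed field this splits into linear factors, and one of them lies in \<open>p\<close>.\<close>

lemma maximal_eq_mpt:
  assumes p: "prime_ring_ideal p" "IX \<subseteq> p" and np: "\<And>i. i \<in> {1..r} \<Longrightarrow> p \<noteq> pline i"
  shows "\<exists>j\<in>{1..r}. \<exists>c. p = mpt j c"
proof -
  obtain i where i: "i \<in> {1..r}" "pline i \<subseteq> p" using prime_contains_pline p by blast
  then obtain f where f: "f \<in> p" "ol i f \<noteq> 0" using np[OF i(1)] by (auto simp: pline_def)
  have "\<exists>c. xw - Const c \<in> p" if "polyX h \<in> p" "h \<noteq> 0" for h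
    using that
  proof (induction "Polynomial.degree h" arbitrary: h)
    case 0
    then obtain a where h: "h = [:a:]" using degree_eq_zeroE by metis
    then have "a \<noteq> 0" using 0 by simp
    have "Const (1 / a) * polyX h = 1" using \<open>a \<noteq> 0\<close> by (simp add: polyX_def h Const_def mult_single)
    then have "1 \<in> p" using 0 p(1) unfolding prime_ring_ideal_def ring_ideal_def by metis
    then show ?case using p(1) by (simp add: prime_ring_ideal_def)
  next
    case (Suc d)
    have "Polynomial.degree h > 0" using Suc by simp
    then obtain c where c: "poly h c = 0" using alg_closed_imp_poly_has_root by blast
    then obtain q where q: "h = [:- c, 1:] * q" by (auto simp: poly_eq_0_iff_dvd dvd_def)
    have q0: "q \<noteq> 0" using Suc q by auto
    have dq: "Polynomial.degree q = d"
    proof -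
      have "Polynomial.degree h = 1 + Polynomial.degree q"
        unfolding q using q0 by (subst degree_mult_eq) auto
      then show ?thesis using Suc by simp
    qed
    have "polyX h - (xw - Const c) * polyX q \<in> IX"
      unfolding IX_def
    proof (intro CollectI ballI)
      fix i assume i: "i \<in> {1..r}"
      show "ol i (polyX h - (xw - Const c) * polyX q) = 0"
        unfolding on_line_diff[of _ "polyX h"] on_line_mult on_line_xc[OF i] on_line_polyX[OF i] by (simp add: q)
    qed
    then have "polyX h - (polyX h - (xw - Const c) * polyX q) \<in> p"
      using Suc.prems p ring_ideal_diff[of p] unfolding prime_ring_ideal_def by blast
    then have "(xw - Const c) * polyX q \<in> p" by simp
    then have "xw - Const c \<in> p \<or> polyX q \<in> p" using p(1) unfolding prime_ring_ideal_def by blast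
    then show ?case using Suc.hyps(1)[of q] dq q0 by blast
  qed
  moreover have "polyX (ol i f) \<in> p"
  proof -
    have "f - polyX (ol i f) \<in> pline i" by (simp add: pline_def on_line_diff on_line_polyX[OF i(1)])
    then have "f - (f - polyX (ol i f)) \<in> p"
      using f i p ring_ideal_diff[of p] unfolding prime_ring_ideal_def by blast
    then show ?thesis by simp
  qed
  ultimately obtain c where c: "xw - Const c \<in> p" using f by blast
  have ri: "ring_ideal p" using p by (simp add: prime_ring_ideal_def)
  have sub: "mpt i c \<subseteq> p" by (rule pline_xc_imp_mpt[OF ri i(2) c i(1)])
  have "p \<subseteq> mpt i c"
  proof
    fix f assume f: "f \<in> p"
    let ?e = "poly (ol i f) c"
    have "f - Const ?e \<in> mpt i c" by (simp add: mpt_def on_line_diff)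
    then have "f - (f - Const ?e) \<in> p" using sub f ring_ideal_diff[OF ri] by blast
    then have "Const ?e \<in> p" by simp
    then have e: "Const (1 / ?e) * Const ?e \<in> p" using ri unfolding ring_ideal_def by blast
    show "f \<in> mpt i c"
    proof (rule ccontr)
      assume "f \<notin> mpt i c"
      then have "?e \<noteq> 0" by (simp add: mpt_def)
      then have "Const (1 / ?e) * Const ?e = (1 :: ('v, 'k) mpoly)" by (simp flip: Const_mult)
      then show False using e p(1) by (simp add: prime_ring_ideal_def)
    qed
  qed
  then show ?thesis using sub i by blast
qed

text \<open>
  On the lines through \<open>c P\<^sub>j\<close> arbitrary restrictions can be prescribed up to the
  common factor \<open>\<epsilon> (t - c)\<^sup>s\<close>, where \<open>\<epsilon>\<close> is a unit at \<open>c\<close>: this replaces the conductor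
  of the coordinate ring in its normalization.
\<close>

lemma ex_conductor:
  assumes j: "j \<in> {1..r}"
  shows "\<exists>e \<epsilon>. poly \<epsilon> c \<noteq> 0 \<and> (\<forall>i\<in>{1..r}. ol i e = (if i \<in> lines_through j c then \<epsilon> else 0)) \<and>
    (\<forall>q. \<exists>h. \<forall>i\<in>{1..r}. ol i h = (if i \<in> lines_through j c then \<epsilon> * [:- c, 1:] ^ s * q i else 0))"
proof (cases "c = 0")
  case True
  have "\<exists>h. \<forall>i\<in>{1..r}. ol i h = (if i \<in> lines_through j c then 1 * [:- c, 1:] ^ s * q i else 0)" for q
    by (rule ex_restrictions) (auto simp: True monom_altdef)
  then show ?thesis
    using True by (intro exI[of _ 1]) (auto simp: lines_through_def)
next
  case False
  \<comment> \<open>Off the origin \<open>t ^ s\<close> does not vanish at \<open>c\<close> and can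
    serve as \<epsilon>. At the origin \<open>(t - c) ^ s\<close> is itself \<open>t ^ s\<close> and
    \<epsilon> is 1.\<close>
  let ?t = "Polynomial.monom (1 :: 'k) s"
  have "\<exists>h. \<forall>i\<in>{1..r}. ol i h = (if i \<in> lines_through j c then ?t * [:- c, 1:] ^ s * q i else 0)" for q
    by (rule ex_restrictions) (auto simp: mult.assoc)
  moreover have "\<exists>e. \<forall>i\<in>{1..r}. ol i e = (if i \<in> lines_through j c then ?t else 0)"
    by (rule ex_restrictions) auto
  moreover have "poly ?t c \<noteq> 0" using False by (simp add: poly_monom)
  ultimately show ?thesis by blast
qed

end

section \<open>The local rings at the points of the affine cone\<close>

locale local_point = point_set P w r s + local_pres B \<theta> "point_set.mpt P j c" "point_config.IX P r"
  for P :: "nat \<Rightarrow> 'v::finite \<Rightarrow> 'k::{alg_closed_field, field_char_0}" and w r s and B (structure) and \<theta> j c +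
  assumes j: "j \<in> {1..r}"
begin

lemma noetherian: "noetherian_ring B"
  using noetherian_if_finitely_generated_modulo finitely_generated_modulo_IX by blast

lemma dim_1: "krull_dim B = 1"
  by (rule krull_dim_eq_1[OF prime_pline IX_sub_pline[OF j] pline_below_mpt[OF j] primes_below_mpt[OF j]])

lemma nonzerodivisor_xc: "nonzerodivisor (\<theta> (xw - Const c))"
  unfolding nonzerodivisor_th_iff th_zero_iff
proof (intro allI impI)
  fix h assume "\<exists>u\<in>- mpt j c. u * ((xw - Const c) * h) \<in> IX"
  then obtain u where u: "u \<in> - mpt j c" "u * ((xw - Const c) * h) \<in> IX" by auto
  have "u * h \<in> IX"
    unfolding IX_def
  proof (intro CollectI ballI)
    fix i assume i: "i \<in> {1..r}"
    then have "ol i u * ([:- c, 1:] * ol i h) = 0"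
      using u(2) i unfolding IX_def mem_Collect_eq on_line_mult on_line_xc[OF i, symmetric] by blast
    then show "ol i (u * h) = 0" by (auto simp: on_line_mult simp del: mult_pCons_left)
  qed
  then show "\<exists>u\<in>- mpt j c. u * h \<in> IX" using u by blast
qed

text \<open>On every line through the point \<open>f\<close> is \<open>(t - c) ^ k i * u i\<close>
  with \<open>u i\<close> nonzero at \<open>c\<close>. The \<open>u i\<close> are absorbed into the
  denominator, and a high power of \<open>z\<close> supplies the factors \<open>t - c\<close>, so
  the quotient by \<open>f\<close> can be lifted line by line.\<close>

lemma power_mem_PIdl:
  assumes f: "f \<in> mpt j c" "nonzerodivisor (\<theta> f)" and z: "z \<in> mpt j c"
  shows "\<exists>k::nat. \<theta> (z ^ k) \<in> PIdl (\<theta> f)"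
proof -
  let ?K = "lines_through j c" and ?t = "[:- c, 1:]"
  obtain e \<epsilon> where e: "poly \<epsilon> c \<noteq> 0" "\<And>i. i \<in> {1..r} \<Longrightarrow> ol i e = (if i \<in> ?K then \<epsilon> else 0)"
    and h: "\<And>q. \<exists>h. \<forall>i\<in>{1..r}. ol i h = (if i \<in> ?K then \<epsilon> * ?t ^ s * q i else 0)"
    using ex_conductor[OF j, of c] by metis
  have \<epsilon>0: "\<epsilon> \<noteq> 0" using e by auto
  have Kr: "i \<in> {1..r}" if "i \<in> ?K" for i using that by (simp add: lines_through_def)
  have finK: "finite ?K" by (simp add: lines_through_def)
  have jK: "j \<in> ?K" using j by (simp add: lines_through_def)
  \<comment> \<open>If \<open>f\<close> vanished on line \<open>i\<close>, it would kill a
    polynomial supported on that line alone which is not zero in the local ring.\<close>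
  have nz: "ol i f \<noteq> 0" if i: "i \<in> ?K" for i
  proof
    assume 0: "ol i f = 0"
    obtain h where h: "\<And>l. l \<in> {1..r} \<Longrightarrow> ol l h = (if l \<in> ?K then \<epsilon> * ?t ^ s * (if l = i then 1 else 0) else 0)"
      using h[of "\<lambda>l. if l = i then 1 else 0"] by blast
    have "f * h \<in> IX" using 0 by (auto simp: IX_def on_line_mult h)
    then have "\<theta> h = \<zero>" using f(2) th_I unfolding nonzerodivisor_th_iff by blast
    then obtain u where u: "u \<notin> mpt j c" "u * h \<in> IX" unfolding th_zero_iff by auto
    have "ol i u * (\<epsilon> * ?t ^ s) = 0"
    proof -
      have "ol i h = \<epsilon> * ?t ^ s" using h[OF Kr[OF i]] i by simp
      moreover have "ol i u * ol i h = 0" using u(2) Kr[OF i] unfolding IX_def on_line_mult[symmetric] by blast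
      ultimately show ?thesis by simp
    qed
    then have "ol i u = 0" using \<epsilon>0 by simp
    then have "u \<in> mpt i c" by (simp add: mpt_def)
    then show False using u mpt_lines_through[OF i] by simp
  qed
  have "\<forall>i\<in>?K. \<exists>uk. ol i f = ?t ^ snd uk * fst uk \<and> poly (fst uk) c \<noteq> 0"
    using order_split[OF nz, of _ c] by auto
  then obtain uk where uk: "\<And>i. i \<in> ?K \<Longrightarrow> ol i f = ?t ^ snd (uk i) * fst (uk i) \<and> poly (fst (uk i)) c \<noteq> 0" by metis
  define u k where "u = (\<lambda>i. fst (uk i))" and "k = (\<lambda>i. snd (uk i))"
  have u: "ol i f = ?t ^ k i * u i" "poly (u i) c \<noteq> 0" if "i \<in> ?K" for i
    using uk[OF that] by (auto simp: u_def k_def)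
  \<comment> \<open>The sum bounds all the orders \<open>k i\<close>. In the exponent
    \<open>s + N\<close> below, \<open>N\<close> pays for the division by \<open>f\<close> and
    \<open>s\<close> for the lifting of the quotient.\<close>
  define N where "N = (\<Sum>i\<in>?K. k i)"
  have kN: "k i \<le> N" if "i \<in> ?K" for i
    unfolding N_def using that finK by (intro member_le_sum) auto
  define U where "U = (\<Prod>i\<in>?K. u i)"
  have Uc: "poly U c \<noteq> 0" unfolding U_def poly_prod using u finK by simp
  have "\<forall>i\<in>?K. \<exists>q. ol i z = ?t * q"
  proof
    fix i assume "i \<in> ?K"
    then have "z \<in> mpt i c" using z mpt_lines_through by blast
    then show "\<exists>q. ol i z = ?t * q" by (simp add: mpt_def poly_eq_0_iff_dvd dvd_def)
  qed
  then obtain zz where zz: "\<And>i. i \<in> ?K \<Longrightarrow> ol i z = ?t * zz i" by metis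
  \<comment> \<open>On line \<open>i\<close> this is the quotient of
    \<open>(e * polyX U) * z ^ (s + N)\<close> by \<open>f\<close>: the factor \<open>u i\<close>
    has been cancelled from \<open>U\<close>, and \<open>t - c\<close> from the power of
    \<open>z\<close>.\<close>
  obtain g where g: "\<And>i. i \<in> {1..r} \<Longrightarrow> ol i g = (if i \<in> ?K then
      \<epsilon> * ?t ^ s * (?t ^ (N - k i) * (\<Prod>l\<in>?K - {i}. u l) * zz i ^ (s + N)) else 0)"
    using h[of "\<lambda>i. ?t ^ (N - k i) * (\<Prod>l\<in>?K - {i}. u l) * zz i ^ (s + N)"] by blast
  have "(e * polyX U) * z ^ (s + N) - g * f \<in> IX"
    unfolding IX_def
  proof (intro CollectI ballI)
    fix i assume i: "i \<in> {1..r}"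
    show "ol i ((e * polyX U) * z ^ (s + N) - g * f) = 0"
    proof (cases "i \<in> ?K")
      case True
      have t: "?t ^ (N - k i) * ?t ^ k i = ?t ^ N" using kN[OF True] by (simp flip: power_add)
      have U: "U = u i * (\<Prod>l\<in>?K - {i}. u l)" unfolding U_def using finK True by (rule prod.remove)
      have "ol i (g * f) = \<epsilon> * ?t ^ s * (?t ^ (N - k i) * (\<Prod>l\<in>?K - {i}. u l) * zz i ^ (s + N)) * (?t ^ k i * u i)"
        unfolding on_line_mult g[OF i] u(1)[OF True] using True by simp
      also have "\<dots> = \<epsilon> * ?t ^ s * (?t ^ (N - k i) * ?t ^ k i) * (u i * (\<Prod>l\<in>?K - {i}. u l)) * zz i ^ (s + N)"
        by (simp only: mult_ac)
      also have "\<dots> = \<epsilon> * U * (?t * zz i) ^ (s + N)"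
        unfolding t U[symmetric] power_mult_distrib power_add by (simp only: mult_ac)
      also have "\<dots> = ol i ((e * polyX U) * z ^ (s + N))"
        unfolding on_line_mult on_line_power e(2)[OF i] on_line_polyX[OF i] zz[OF True] using True by simp
      finally show ?thesis by (simp add: on_line_diff)
    next
      case False
      then show ?thesis unfolding on_line_diff on_line_mult e(2)[OF i] g[OF i] by simp
    qed
  qed
  moreover have "e * polyX U \<notin> mpt j c"
    using e Uc jK j by (simp add: mpt_def on_line_mult on_line_polyX)
  ultimately show ?thesis unfolding th_PIdl_iff by blast
qed

lemma gorenstein_local_iff:
  "(\<exists>\<nn>. gorenstein_local_ring B \<nn>) \<longleftrightarrow> socle_cyclic nn (\<theta> (xw - Const c))"
  using power_mem_PIdl xc_mem[OF j]
  by (intro gorenstein_local_iff_socle_cyclic noetherian dim_1 nonzerodivisor_xc) auto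

text \<open>With only line \<open>j\<close> through the point, an element \<open>a\<close> vanishing
  there becomes a multiple of \<open>xw - Const c\<close> after multiplication by a denominator
  \<open>e\<close> supported on line \<open>j\<close>. The maximal ideal is thus generated by
  \<open>xw - Const c\<close>, and any element outside \<open>(xw - Const c)\<close> is a
  unit.\<close>

lemma socle_cyclic_off_origin:
  assumes c: "c \<noteq> 0"
  shows "socle_cyclic nn (\<theta> (xw - Const c))"
  unfolding socle_cyclic_iff
proof (intro allI impI)
  fix a b assume "\<theta> a \<notin> PIdl (\<theta> (xw - Const c))"
  have "a \<notin> mpt j c"
  proof
    assume "a \<in> mpt j c"
    then obtain q where q: "ol j a = [:- c, 1:] * q" by (auto simp: mpt_def poly_eq_0_iff_dvd dvd_def)
    let ?t = "Polynomial.monom (1 :: 'k) s"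
    have ex: "\<exists>h. \<forall>i\<in>{1..r}. ol i h = (if i = j then ?t * p else 0)" for p
      by (rule ex_restrictions) auto
    obtain e where e: "\<And>i. i \<in> {1..r} \<Longrightarrow> ol i e = (if i = j then ?t * 1 else 0)"
      using ex[of 1] by blast
    obtain h where h: "\<And>i. i \<in> {1..r} \<Longrightarrow> ol i h = (if i = j then ?t * q else 0)"
      using ex[of q] by blast
    have "e * a - h * (xw - Const c) \<in> IX"
      unfolding IX_def
    proof (intro CollectI ballI)
      fix i assume i: "i \<in> {1..r}"
      show "ol i (e * a - h * (xw - Const c)) = 0"
        unfolding on_line_diff[of _ "e * a"] on_line_mult e[OF i] h[OF i] on_line_xc[OF i]
        by (simp add: q mult_ac del: mult_pCons_left mult_pCons_right)
    qed
    moreover have "e \<notin> mpt j c" using c by (simp add: mpt_def e[OF j] poly_monom)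
    ultimately show False using \<open>\<theta> a \<notin> _\<close> unfolding th_PIdl_iff by blast
  qed
  \<comment> \<open>The unit \<open>a\<close> itself is the denominator and \<open>b\<close> the
    numerator.\<close>
  moreover have "\<theta> (a * b - b * a) \<in> PIdl (\<theta> (xw - Const c))"
    using additive_subgroup.zero_closed[OF ideal.axioms(1)[OF cgenideal_ideal]] by (simp add: th_0 mult.commute)
  ultimately show "\<exists>c' q. q \<notin> mpt j c \<and> \<theta> (q * b - c' * a) \<in> PIdl (\<theta> (xw - Const c))" by blast
qed

end

section \<open>The socle modulo \<open>xw\<close>, in the polynomial ring and in the local ring at
  the origin\<close>

context point_set
begin

abbreviation m0 :: "('v, 'k) mpoly set" where "m0 \<equiv> {f. Poly_Mapping.lookup f 0 = 0}"

text \<open>A scalar coefficient is enough because \<open>m0\<close> multiplies socle elements into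
  \<open>JX\<close>. The condition avoids the local ring at the origin; \<open>JX_saturated\<close>
  shows that localizing changes nothing.\<close>

definition socle_1dim :: bool where
  "socle_1dim \<longleftrightarrow> (\<forall>a b. (\<forall>n\<in>m0. n * a \<in> JX) \<longrightarrow> (\<forall>n\<in>m0. n * b \<in> JX) \<longrightarrow> a \<notin> JX \<longrightarrow>
    (\<exists>c. b - Const c * a \<in> JX))"

lemma ring_ideal_JX: "ring_ideal JX"
  unfolding ring_ideal_def
proof (intro conjI ballI allI)
  have IX: "\<And>x y. x \<in> IX \<Longrightarrow> y \<in> IX \<Longrightarrow> x + y \<in> IX" "\<And>a x. x \<in> IX \<Longrightarrow> a * x \<in> IX" "0 \<in> IX"
    using ring_ideal_IX by (auto simp: ring_ideal_def)
  show "0 \<in> JX" using IX(3) by (auto simp: JX_def intro!: exI[of _ 0])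
  fix x assume x: "x \<in> JX"
  then obtain h where h: "x - h * xw \<in> IX" by (auto simp: JX_def)
  show "x + y \<in> JX" if y: "y \<in> JX" for y
  proof -
    obtain h' where h': "y - h' * xw \<in> IX" using y by (auto simp: JX_def)
    have "x + y - (h + h') * xw = (x - h * xw) + (y - h' * xw)" by (simp add: algebra_simps)
    then have "x + y - (h + h') * xw \<in> IX" using IX(1)[OF h h'] by (simp only:)
    then show ?thesis unfolding JX_def by blast
  qed
  show "a * x \<in> JX" for a
  proof -
    have "a * x - (a * h) * xw = a * (x - h * xw)" by (simp add: algebra_simps)
    then have "a * x - (a * h) * xw \<in> IX" using IX(2)[OF h, of a] by (simp only:)
    then show ?thesis unfolding JX_def by blast
  qed
qed

lemma IX_sub_JX: "IX \<subseteq> JX"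
  by (auto simp: JX_def intro!: exI[of _ 0])

lemma xw_mem_JX: "xw \<in> JX"
  using ring_ideal_IX by (auto simp: JX_def ring_ideal_def intro!: exI[of _ 1])

lemma r_pos: "1 \<in> {1..r}"
proof (rule ccontr)
  assume "1 \<notin> {1..r}"
  then have "{1..r} = {}" by auto
  then show False using not_full forms_0 unfolding V_def by blast
qed

text \<open>On every line the power is divisible by \<open>t ^ Suc s\<close>: one factor
  \<open>t\<close> is \<open>xw\<close>, and the other \<open>s\<close> ensure that the quotient can
  be lifted.\<close>

lemma m0_power_mem_JX:
  assumes "n \<in> m0"
  shows "n ^ Suc s \<in> JX"
proof -
  have "\<exists>q. ol i n = [:0, 1:] * q" for i
    using assms poly_on_line_0[of i n] by (simp add: poly_eq_0_iff_dvd dvd_def)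
  then obtain q where q: "\<And>i. ol i n = [:0, 1:] * q i" by metis
  have "\<exists>h. \<forall>i\<in>{1..r}. ol i h = [:0, 1:] ^ s * q i ^ Suc s"
    by (rule ex_restrictions) (auto simp: monom_altdef)
  then obtain h where h: "\<And>i. i \<in> {1..r} \<Longrightarrow> ol i h = [:0, 1:] ^ s * q i ^ Suc s" by blast
  have "n ^ Suc s - h * xw \<in> IX"
    unfolding IX_def
  proof (intro CollectI ballI)
    fix i assume i: "i \<in> {1..r}"
    have "ol i (n ^ Suc s) = ([:0, 1:] * q i) ^ Suc s" by (simp only: on_line_power q)
    also have "\<dots> = [:0, 1:] ^ s * q i ^ Suc s * [:0, 1:]"
      unfolding power_mult_distrib power_Suc by (simp only: mult_ac)
    also have "\<dots> = ol i (h * xw)" by (simp only: on_line_mult h[OF i] on_line_X[OF i])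
    finally show "ol i (n ^ Suc s - h * xw) = 0" by (simp only: on_line_diff) simp
  qed
  then show ?thesis unfolding JX_def by blast
qed

text \<open>A polynomial with constant term \<open>c \<noteq> 0\<close> is \<open>c - n\<close> with
  \<open>n\<close> nilpotent modulo \<open>JX\<close>, hence invertible modulo \<open>JX\<close> by
  a geometric sum.\<close>

lemma JX_saturated:
  assumes u: "u \<notin> m0" and uf: "u * f \<in> JX"
  shows "f \<in> JX"
proof -
  define c where "c = Poly_Mapping.lookup u 0"
  define n where "n = Const c - u"
  have c: "c \<noteq> 0" using u by (simp add: c_def)
  have J: "\<And>x y. x \<in> JX \<Longrightarrow> y \<in> JX \<Longrightarrow> x + y \<in> JX" "\<And>a x. x \<in> JX \<Longrightarrow> a * x \<in> JX"
    using ring_ideal_JX by (auto simp: ring_ideal_def)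
  have "n \<in> m0" by (simp add: n_def c_def lookup_minus lookup_Const)
  then have n: "f * n ^ Suc s \<in> JX" by (intro J m0_power_mem_JX)
  obtain g where g: "Const c ^ Suc s - n ^ Suc s = (Const c - n) * g"
    using power_diff_sumr2[of "Const c" "Suc s" n] by blast
  have "Const c - n = u" by (simp add: n_def)
  then have "g * (u * f) + f * n ^ Suc s = Const c ^ Suc s * f"
    using g by (simp add: algebra_simps)
  then have "Const c ^ Suc s * f \<in> JX" using J(1)[OF J(2)[OF uf, of g] n] by simp
  then have "Const (1 / c) ^ Suc s * (Const c ^ Suc s * f) \<in> JX" by (rule J(2))
  moreover have "Const (1 / c) ^ Suc s * (Const c ^ Suc s * f) = (Const (1 / c) * Const c) ^ Suc s * f"
    by (simp only: power_mult_distrib mult.assoc)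
  moreover have "Const (1 / c) * Const c = (1 :: ('v, 'k) mpoly)"
    using c by (simp flip: Const_mult)
  ultimately show ?thesis by simp
qed

end

context local_point
begin

text \<open>By saturation, the contraction of the ideal of \<open>xw\<close> is \<open>JX\<close>.
  In a relation between socle elements polynomial coefficients can be replaced by their constant
  terms, the difference lying in \<open>m0\<close>.\<close>

lemma socle_cyclic_origin:
  assumes c: "c = 0"
  shows "socle_cyclic nn (\<theta> (xw - Const c)) \<longleftrightarrow> socle_1dim"
proof -
  have m: "mpt j c = m0" by (simp add: c mpt_0)
  have xc: "xw - Const c = xw" by (simp add: c)
  have J: "\<And>x y. x \<in> JX \<Longrightarrow> y \<in> JX \<Longrightarrow> x + y \<in> JX" "\<And>a x. x \<in> JX \<Longrightarrow> a * x \<in> JX"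
    using ring_ideal_JX by (auto simp: ring_ideal_def)
  have mem: "\<theta> f \<in> PIdl (\<theta> xw) \<longleftrightarrow> f \<in> JX" for f
  proof
    assume "\<theta> f \<in> PIdl (\<theta> xw)"
    then obtain u h where u: "u \<notin> mpt j c" "u * f - h * xw \<in> IX" unfolding th_PIdl_iff by blast
    then have "u * f \<in> JX" unfolding JX_def by blast
    then show "f \<in> JX" using JX_saturated u m by simp
  next
    assume "f \<in> JX"
    then obtain h where "1 * f - h * xw \<in> IX" by (auto simp: JX_def)
    moreover have "1 \<notin> mpt j c" by (simp add: m)
    ultimately show "\<theta> f \<in> PIdl (\<theta> xw)" unfolding th_PIdl_iff by blast
  qed
  have "(\<exists>d q. q \<notin> m0 \<and> q * b - d * a \<in> JX) \<longleftrightarrow> (\<exists>d. b - Const d * a \<in> JX)"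
    if ab: "\<forall>n\<in>m0. n * a \<in> JX" "\<forall>n\<in>m0. n * b \<in> JX" for a b
  proof
    assume "\<exists>d q. q \<notin> m0 \<and> q * b - d * a \<in> JX"
    then obtain d q where dq: "q \<notin> m0" "q * b - d * a \<in> JX" by blast
    define q0 d0 where "q0 = Poly_Mapping.lookup q 0" and "d0 = Poly_Mapping.lookup d 0"
    have q0: "q0 \<noteq> 0" using dq by (simp add: q0_def)
    have "Const q0 - q \<in> m0" "d - Const d0 \<in> m0" by (simp_all add: q0_def d0_def lookup_minus lookup_Const)
    then have "(Const q0 - q) * b \<in> JX" "(d - Const d0) * a \<in> JX" using ab by auto
    then have "(q * b - d * a) + ((Const q0 - q) * b + (d - Const d0) * a) \<in> JX" using dq J by blast
    moreover have "(q * b - d * a) + ((Const q0 - q) * b + (d - Const d0) * a) = Const q0 * b - Const d0 * a"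
      by (simp add: algebra_simps)
    ultimately have "Const (1 / q0) * (Const q0 * b - Const d0 * a) \<in> JX" using J(2) by simp
    moreover have "Const (1 / q0) * (Const q0 * b - Const d0 * a) = b - Const (1 / q0 * d0) * a"
      using q0 by (simp add: right_diff_distrib)
    ultimately show "\<exists>d. b - Const d * a \<in> JX" by metis
  next
    assume "\<exists>d. b - Const d * a \<in> JX"
    then obtain d where "1 * b - Const d * a \<in> JX" by auto
    moreover have "1 \<notin> m0" by simp
    ultimately show "\<exists>d q. q \<notin> m0 \<and> q * b - d * a \<in> JX" by blast
  qed
  then show ?thesis unfolding socle_cyclic_iff xc mem m socle_1dim_def by blast
qed

lemma gorenstein_local_iff': "(\<exists>\<nn>. gorenstein_local_ring B \<nn>) \<longleftrightarrow> c \<noteq> 0 \<or> socle_1dim"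
  using gorenstein_local_iff socle_cyclic_origin socle_cyclic_off_origin by blast

end

section \<open>From the local rings to the coordinate ring\<close>

context point_set
begin

text \<open>Maximal ideals of the coordinate ring contract to ideals \<open>mpt j c\<close>, where
  the local criterion applies. It is automatic for \<open>c \<noteq> 0\<close> and says
  \<open>socle_1dim\<close> at the origin.\<close>

lemma gorenstein_iff_socle_1dim: "arithmetically_gorenstein (P ` {1..r}) \<longleftrightarrow> socle_1dim"
proof -
  let ?R = "mpoly_ring :: ('v, 'k) mpoly ring"
  define A where "A = ?R Quot IX"
  define \<theta> where "\<theta> f = IX +>\<^bsub>?R\<^esub> f" for f
  have pres: "localization_pres A \<theta> {1} IX"
    unfolding A_def \<theta>_def by (rule localization_pres_quotient) (simp add: ring_ideal_iff ring_ideal_IX)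
  interpret A: localization_pres A \<theta> "{1}" IX by fact
  have surj: "\<exists>f. \<theta> f = x" if "x \<in> carrier A" for x
    using A.th_surj[OF that] that by (auto simp: A.th_one)
  have noeth: "noetherian_ring A"
    by (rule A.noetherian_if_finitely_generated_modulo) (rule finitely_generated_modulo_IX)
  have image_ideal: "ideal (\<theta> ` Q) A" if Q: "ring_ideal Q" for Q
  proof (rule A.ideal_if_closed)
    show "\<zero>\<^bsub>A\<^esub> \<in> \<theta> ` Q" using Q A.th_0 by (force simp: ring_ideal_def)
    show "x \<oplus>\<^bsub>A\<^esub> y \<in> \<theta> ` Q" if "x \<in> \<theta> ` Q" "y \<in> \<theta> ` Q" for x y
      using that Q by (auto simp: ring_ideal_def simp flip: A.th_add)
    show "a \<otimes>\<^bsub>A\<^esub> x \<in> \<theta> ` Q" if "a \<in> carrier A" "x \<in> \<theta> ` Q" for a x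
      using that Q surj[of a] by (auto simp: ring_ideal_def simp flip: A.th_mult)
  qed auto
  have contr: "f \<in> Q" if f: "\<theta> f \<in> \<theta> ` Q" and Q: "ring_ideal Q" "IX \<subseteq> Q" for f Q
  proof -
    obtain g where g: "g \<in> Q" "\<theta> f = \<theta> g" using f by auto
    then have "f - g \<in> IX" using A.th_eq_iff by simp
    then have "(f - g) + g \<in> Q" using Q g unfolding ring_ideal_def by blast
    then show ?thesis by simp
  qed
  have local: "local_point P w r s (fractions A (carrier A - \<MM>)) (\<lambda>f. frac A (carrier A - \<MM>) (\<theta> f) \<one>\<^bsub>A\<^esub>) j c"
    if "maximalideal \<MM> A" "{g. \<theta> g \<in> \<MM>} = mpt j c" "j \<in> {1..r}" for \<MM> j c
  proof -
    have "- mpt j c = {g. \<theta> g \<notin> \<MM>}" using that by auto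
    then have "localization_pres (fractions A (carrier A - \<MM>)) (\<lambda>f. frac A (carrier A - \<MM>) (\<theta> f) \<one>\<^bsub>A\<^esub>) (- mpt j c) IX"
      using A.localization_pres_fractions[OF pres A.maximalideal_prime[OF that(1)]] by simp
    moreover have "IX \<subseteq> mpt j c" using IX_sub_pline[OF that(3)] pline_sub_mpt by blast
    ultimately show ?thesis
      using prime_mpt that(3) point_set_axioms
      by (auto simp: local_point_def local_point_axioms_def local_pres_def local_pres_axioms_def)
  qed
  have max_form: "\<exists>j\<in>{1..r}. \<exists>c. {g. \<theta> g \<in> \<MM>} = mpt j c" if max: "maximalideal \<MM> A" for \<MM>
  proof (rule maximal_eq_mpt)
    interpret M: maximalideal \<MM> A by fact
    interpret Mp: primeideal \<MM> A by (rule A.maximalideal_prime[OF max])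
    have one: "\<one>\<^bsub>A\<^esub> \<notin> \<MM>" using M.one_imp_carrier M.I_notcarr by auto
    show "prime_ring_ideal {g. \<theta> g \<in> \<MM>}"
      unfolding prime_ring_ideal_def using A.ring_ideal_contraction[OF M.is_ideal] Mp.I_prime one
      by (auto simp: A.th_mult A.th_one)
    show IXs: "IX \<subseteq> {g. \<theta> g \<in> \<MM>}" by (auto simp: A.th_I)
    fix i assume i: "i \<in> {1..r}"
    show "{g. \<theta> g \<in> \<MM>} \<noteq> pline i"
    proof
      \<comment> \<open>The ideal of a line is not maximal: that of the origin lies strictly between
        it and the whole ring.\<close>
      assume eq: "{g. \<theta> g \<in> \<MM>} = pline i"
      have Q: "ring_ideal (mpt i 0)" "IX \<subseteq> mpt i 0"
        using prime_mpt IX_sub_pline[OF i] pline_sub_mpt unfolding prime_ring_ideal_def by blast+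
      have "\<MM> \<subseteq> \<theta> ` mpt i 0"
      proof
        fix x assume x: "x \<in> \<MM>"
        then obtain f where f: "\<theta> f = x" using surj M.Icarr by blast
        then have "f \<in> pline i" using eq x by blast
        then show "x \<in> \<theta> ` mpt i 0" using f pline_sub_mpt by blast
      qed
      moreover have "\<theta> ` mpt i 0 \<subseteq> carrier A" by auto
      ultimately consider "\<theta> ` mpt i 0 = \<MM>" | "\<theta> ` mpt i 0 = carrier A"
        using M.I_maximal[OF image_ideal[OF Q(1)]] by blast
      then show False
      proof cases
        case 1
        have "xw - Const 0 \<in> pline i" using xc_mem[OF i, of 0] 1 eq by blast
        then show False by (simp add: pline_def on_line_X[OF i])
      next
        case 2
        then have "1 \<in> mpt i 0" using contr[OF _ Q, of 1] by simp
        then show False by (simp add: mpt_def)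
      qed
    qed
  qed
  have "gorenstein_ring A \<longleftrightarrow> (\<forall>\<MM>. maximalideal \<MM> A \<longrightarrow> (\<exists>\<nn>. gorenstein_local_ring (fractions A (carrier A - \<MM>)) \<nn>))"
    unfolding gorenstein_ring_def Let_def using noeth A.cring_axioms by simp
  also have "\<dots> \<longleftrightarrow> socle_1dim"
  proof
    assume soc: socle_1dim
    show "\<forall>\<MM>. maximalideal \<MM> A \<longrightarrow> (\<exists>\<nn>. gorenstein_local_ring (fractions A (carrier A - \<MM>)) \<nn>)"
    proof (intro allI impI)
      fix \<MM> assume max: "maximalideal \<MM> A"
      then obtain j c where jc: "j \<in> {1..r}" "{g. \<theta> g \<in> \<MM>} = mpt j c" using max_form by blast
      show "\<exists>\<nn>. gorenstein_local_ring (fractions A (carrier A - \<MM>)) \<nn>"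
        using local_point.gorenstein_local_iff'[OF local[OF max jc(2,1)]] soc by simp
    qed
  next
    assume G: "\<forall>\<MM>. maximalideal \<MM> A \<longrightarrow> (\<exists>\<nn>. gorenstein_local_ring (fractions A (carrier A - \<MM>)) \<nn>)"
    have Q: "ring_ideal (mpt 1 0)" "IX \<subseteq> mpt 1 0"
      using prime_mpt IX_sub_pline[OF r_pos] pline_sub_mpt unfolding prime_ring_ideal_def by blast+
    let ?M = "\<theta> ` mpt 1 0"
    have c: "{g. \<theta> g \<in> ?M} = mpt 1 0" using contr[OF _ Q] by blast
    have "maximalideal ?M A"
    proof (rule maximalidealI[OF image_ideal[OF Q(1)]])
      have "1 \<notin> mpt 1 0" by (simp add: mpt_def)
      then show "carrier A \<noteq> ?M" using c A.th_closed[of 1] by blast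
      fix J assume J: "ideal J A" "?M \<subseteq> J" "J \<subseteq> carrier A"
      interpret J: ideal J A by fact
      show "J = ?M \<or> J = carrier A"
      proof (rule disjCI)
        assume "J \<noteq> carrier A"
        show "J = ?M"
        proof (rule ccontr)
          assume "J \<noteq> ?M"
          then obtain x where x: "x \<in> J" "x \<notin> ?M" using J by blast
          then obtain f where f: "\<theta> f = x" using surj J by blast
          define e where "e = Poly_Mapping.lookup f 0"
          have "f \<notin> mpt 1 0" using f x by blast
          then have e: "e \<noteq> 0" by (simp add: mpt_0 e_def)
          have "Const e - f \<in> mpt 1 0" by (simp add: mpt_0 e_def lookup_minus lookup_Const)
          then have "\<theta> (Const e - f) \<oplus>\<^bsub>A\<^esub> \<theta> f \<in> J" using J x f by (intro J.a_closed) auto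
          then have "\<theta> (Const e) \<in> J" by (simp flip: A.th_add)
          then have "\<theta> (Const (1 / e)) \<otimes>\<^bsub>A\<^esub> \<theta> (Const e) \<in> J" by (intro J.I_l_closed) auto
          moreover have "Const (1 / e) * Const e = (1 :: ('v, 'k) mpoly)" using e by (simp flip: Const_mult)
          ultimately have "\<one>\<^bsub>A\<^esub> \<in> J" by (simp flip: A.th_mult add: A.th_one)
          then show False using J.one_imp_carrier \<open>J \<noteq> carrier A\<close> by simp
        qed
      qed
    qed
    from G[rule_format, OF this] local_point.gorenstein_local_iff'[OF local[OF this c r_pos]] show socle_1dim by simp
  qed
  finally show ?thesis unfolding arithmetically_gorenstein_def vanishing_ideal_eq A_def .
qed

end

section \<open>Inverse systems\<close>

lemma span_singleton_dact: "Gam.span {x} = range (\<lambda>g. g \<circle> x)"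
  by (rule Gam.span_singleton)

lemma dact_commute: "f \<circle> (g \<circle> x) = g \<circle> (f \<circle> x)"
  for f g x :: "('v::finite, 'k::comm_ring_1) mpoly"
  by (metis dact_mult mult.commute)

lemma ann_span_singleton: "ann (Gam.span {x}) = ann {x}"
proof -
  have "(\<forall>g. f \<circle> (g \<circle> x) = 0) \<longleftrightarrow> f \<circle> x = 0" for f
    by (metis dact_commute dact_one dact_zero_right)
  then show ?thesis by (auto simp: ann_def span_singleton_dact)
qed

lemma subspace_inv_sys: "Gam.subspace (inv_sys I)"
proof (rule Gam.subspaceI)
  show "c \<circle> x \<in> inv_sys I" if "x \<in> inv_sys I" for c x
    unfolding inv_sys_def
  proof (intro CollectI ballI)
    fix g assume "g \<in> I"
    then have "g \<circle> x = 0" using that by (simp add: inv_sys_def)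
    then show "g \<circle> (c \<circle> x) = 0" unfolding dact_commute[of g c x] by simp
  qed
qed (simp_all add: inv_sys_def dact_add_right)

context point_set
begin

definition W :: "(nat \<Rightarrow> 'k) \<Rightarrow> nat \<Rightarrow> ('v, 'k) mpoly"
  where "W v n = (\<Sum>i=1..r. Const (v i) * divpow (P i) n)"

lemma W_forms: "W v n \<in> forms n"
  unfolding W_def by (intro forms_sum forms_Const_mult divpow_forms)

lemma W_cong: "(\<And>i. i \<in> {1..r} \<Longrightarrow> v i = v' i) \<Longrightarrow> W v n = W v' n"
  unfolding W_def by (intro sum.cong) auto

lemma pairing_W: "Poly_Mapping.lookup (f \<circle> W v n) 0 = (\<Sum>i=1..r. v i * Polynomial.coeff (ol i f) n)"
  by (simp add: W_def dact_sum_right dact_Const_right lookup_sum pairing_divpow)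

lemma dact_W: "f \<circle> W v n = (\<Sum>d\<le>n. W (\<lambda>i. v i * Polynomial.coeff (ol i f) d) (n - d))"
proof -
  have "f \<circle> W v n = (\<Sum>i=1..r. \<Sum>d\<le>n. Const (v i * Polynomial.coeff (ol i f) d) * divpow (P i) (n - d))"
    unfolding W_def dact_sum_right dact_Const_right dact_divpow
    by (simp add: sum_distrib_left)
  also have "\<dots> = (\<Sum>d\<le>n. W (\<lambda>i. v i * Polynomial.coeff (ol i f) d) (n - d))"
    unfolding W_def by (rule sum.swap)
  finally show ?thesis .
qed

lemma W_zero: "(\<And>i. i \<in> {1..r} \<Longrightarrow> v i = 0) \<Longrightarrow> W v n = 0"
  unfolding W_def by (intro sum.neutral) auto

lemma dact_W_forms:
  assumes "f \<in> forms d"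
  shows "f \<circle> W v n = (if d \<le> n then W (\<lambda>i. v i * peval f (P i)) (n - d) else 0)"
proof -
  have "f \<circle> W v n = (\<Sum>e\<le>n. if e = d then W (\<lambda>i. v i * peval f (P i)) (n - d) else 0)"
    unfolding dact_W by (intro sum.cong) (auto simp: on_line_forms[OF assms] intro: W_zero)
  then show ?thesis by simp
qed

lemma W_eq_0_iff: "W v n = 0 \<longleftrightarrow> (\<forall>g\<in>forms n. (\<Sum>i=1..r. v i * peval g (P i)) = 0)"
proof
  assume "W v n = 0"
  then show "\<forall>g\<in>forms n. (\<Sum>i=1..r. v i * peval g (P i)) = 0"
    using pairing_W[of _ v n] on_line_forms by (metis (no_types, lifting) coeff_monom dact_zero_right lookup_zero sum.cong)
next
  assume g: "\<forall>g\<in>forms n. (\<Sum>i=1..r. v i * peval g (P i)) = 0"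
  have "hcomp n (W v n) = hcomp n 0"
    by (rule eq_if_pairing_eq_on_forms) (use g in \<open>simp add: pairing_W on_line_forms\<close>)
  then show "W v n = 0" using hcomp_forms[OF W_forms, of n v n] by simp
qed

text \<open>A form of degree \<open>n \<ge> s\<close> with value 1 at one point and 0 at the others
  isolates a single weight.\<close>

lemma W_full_eq_0: "W v n = 0 \<Longrightarrow> n \<ge> s \<Longrightarrow> i \<in> {1..r} \<Longrightarrow> v i = 0"
proof -
  assume W: "W v n = 0" "n \<ge> s" and i: "i \<in> {1..r}"
  obtain f where f: "f \<in> forms n" "\<forall>l\<in>{1..r}. peval f (P l) = (if l = i then 1 else 0)"
    using V_full[OF W(2), of "\<lambda>l. if l = i then 1 else 0"] unfolding V_def by blast
  have "(\<Sum>l=1..r. v l * peval f (P l)) = (\<Sum>l=1..r. if l = i then v i else 0)"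
    using f(2) by (intro sum.cong) auto
  then show "v i = 0" using W(1) f(1) i unfolding W_eq_0_iff by simp
qed

lemma xw_W_Suc: "xw \<circle> W v (Suc n) = W v n"
proof -
  have "xw \<circle> W v (Suc n) = W (\<lambda>i. v i * peval xw (P i)) n"
    by (subst dact_W_forms[OF forms_Var]) simp
  also have "\<dots> = W v n" by (rule W_cong) (simp add: P_w)
  finally show ?thesis .
qed

lemma xw_W_0: "xw \<circle> W v 0 = 0"
  by (subst dact_W_forms[OF forms_Var]) simp

lemma xw_power_W: "xw ^ k \<circle> W v (n + k) = W v n"
proof (induction k)
  case (Suc k)
  show ?case
    unfolding power_Suc2 dact_mult add_Suc_right xw_W_Suc by (rule Suc)
qed simp

text \<open>The summands are forms of pairwise different degrees.\<close>

lemma sum_W_eq_0_D: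
  assumes "(\<Sum>d\<le>n. W (v d) (n - d)) = 0" "d \<le> n"
  shows "W (v d) (n - d) = 0"
proof -
  have "hcomp (n - d) (\<Sum>e\<le>n. W (v e) (n - e)) = (\<Sum>e\<le>n. if e = d then W (v d) (n - d) else 0)"
    unfolding hcomp_sum using assms(2) by (intro sum.cong) (auto simp: hcomp_forms[OF W_forms])
  also have "\<dots> = W (v d) (n - d)" using assms(2) by simp
  finally show ?thesis unfolding assms(1) by simp
qed

lemma W_in_inv_sys: "W v n \<in> inv_sys IX"
  unfolding inv_sys_def
proof (intro CollectI ballI)
  fix g assume "g \<in> IX"
  then show "g \<circle> W v n = 0" unfolding dact_W by (intro sum.neutral ballI W_zero) (simp add: IX_def)
qed

lemma forms_IX_iff: "f \<in> forms d \<Longrightarrow> f \<in> IX \<longleftrightarrow> (\<forall>i\<in>{1..r}. peval f (P i) = 0)"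
  by (simp add: IX_def on_line_forms)

text \<open>A form on which all evaluations at the points vanish lies in \<open>IX\<close>, so the
  functional vanishes on their common kernel. This is the source of weights both for elements of the
  inverse system and for \<beta>.\<close>

lemma ex_W_functional:
  assumes l: "\<And>c x. l (Const c * x) = c * l x" "\<And>x y. l (x - y) = l x - l y"
    and van: "\<And>x. x \<in> forms d \<Longrightarrow> x \<in> IX \<Longrightarrow> l x = (0 :: 'k)"
  shows "\<exists>v. \<forall>x\<in>forms d. l x = (\<Sum>i=1..r. v i * peval x (P i))"
  by (rule functional_vanishing_on_common_kernel[where scale = "\<lambda>c x. Const c * x"])
    (auto simp: forms_Const_mult forms_diff peval_mult peval_diff l forms_IX_iff intro: van)

text \<open>Taking the constant term of \<open>x \<circle> G\<close> is a functional on forms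
  \<open>x\<close> of degree \<open>n\<close> that kills \<open>IX\<close>, hence a weighted sum of
  values; \<open>W\<close> with these weights induces the same functional.\<close>

lemma inv_sys_hcomp:
  assumes G: "G \<in> inv_sys IX"
  shows "\<exists>v. hcomp n G = W v n"
proof -
  have "\<exists>v. \<forall>x\<in>forms n. Poly_Mapping.lookup (x \<circle> G) 0 = (\<Sum>i=1..r. v i * peval x (P i))"
  proof (rule ex_W_functional)
    show "Poly_Mapping.lookup ((Const c * x) \<circle> G) 0 = c * Poly_Mapping.lookup (x \<circle> G) 0" for c x
      unfolding dact_mult dact_Const_left by simp
    show "Poly_Mapping.lookup ((x - y) \<circle> G) 0 = Poly_Mapping.lookup (x \<circle> G) 0 - Poly_Mapping.lookup (y \<circle> G) 0" for x y
      unfolding dact_diff_left lookup_minus ..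
    show "Poly_Mapping.lookup (x \<circle> G) 0 = 0" if "x \<in> IX" for x
      using G that by (simp add: inv_sys_def)
  qed
  then obtain v where v: "\<And>x. x \<in> forms n \<Longrightarrow> Poly_Mapping.lookup (x \<circle> G) 0 = (\<Sum>i=1..r. v i * peval x (P i))"
    by blast
  have "hcomp n G = hcomp n (W v n)"
    by (rule eq_if_pairing_eq_on_forms) (simp add: v pairing_W on_line_forms)
  then show ?thesis using hcomp_forms[OF W_forms, of n v n] by auto
qed

text \<open>Since \<open>s > 0\<close>, the truncated subtraction is exact. The first member is
  \<open>W \<beta> s\<close>, and condition (1) concerns the one that would precede it.\<close>

definition Fam :: "(nat \<Rightarrow> 'k) \<Rightarrow> nat \<Rightarrow> ('v, 'k) mpoly" where "Fam \<beta> t = W \<beta> (t + s - 1)"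

text \<open>Every \<open>W v n\<close> is obtained from the member of degree \<open>n + s\<close> by
  a form of degree \<open>s\<close> with the values \<open>v i / \<alpha> i\<close>.\<close>

lemma span_Fam:
  assumes \<alpha>: "\<And>i. i \<in> {1..r} \<Longrightarrow> \<alpha> i \<noteq> 0"
  shows "Gam.span (Fam \<alpha> ` {1..}) = inv_sys IX"
proof
  show "Gam.span (Fam \<alpha> ` {1..}) \<subseteq> inv_sys IX"
    by (rule Gam.span_minimal[OF _ subspace_inv_sys]) (auto simp: Fam_def W_in_inv_sys)
  show "inv_sys IX \<subseteq> Gam.span (Fam \<alpha> ` {1..})"
  proof
    fix G assume G: "G \<in> inv_sys IX"
    have W: "W v n \<in> Gam.span (Fam \<alpha> ` {1..})" for v n
    proof -
      obtain f where f: "f \<in> forms s" "\<And>i. i \<in> {1..r} \<Longrightarrow> peval f (P i) = v i / \<alpha> i"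
        using full[of "\<lambda>i. v i / \<alpha> i"] unfolding V_def by blast
      have "f \<circle> Fam \<alpha> (n + 1) = W (\<lambda>i. \<alpha> i * peval f (P i)) n"
        unfolding Fam_def by (subst dact_W_forms[OF f(1)]) simp
      also have "\<dots> = W v n" using \<alpha> f(2) by (intro W_cong) simp
      finally have e: "W v n = f \<circle> Fam \<alpha> (n + 1)" by simp
      show ?thesis unfolding e by (intro Gam.span_scale Gam.span_base) auto
    qed
    obtain N where N: "G = (\<Sum>d\<le>N. hcomp d G)" using mpoly_eq_sum_hcomp[of G] by blast
    show "G \<in> Gam.span (Fam \<alpha> ` {1..})"
      by (subst N, rule Gam.span_sum) (metis inv_sys_hcomp[OF G] W)
  qed
qed

text \<open>The operator \<open>xw ^ l\<close> maps \<open>Fam \<beta> (l + 1)\<close> to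
  \<open>Fam \<beta> 1\<close>, and \<open>Fam \<beta> l\<close> to
  \<open>W \<beta> (s - 1)\<close>, which is 0.\<close>

lemma Fam_1_sub:
  assumes 1: "W \<beta> (s - 1) = 0" and l: "l \<ge> 1"
  shows "Gam.span {Fam \<beta> 1} \<subseteq> (\<lambda>g. g \<circle> Fam \<beta> (l + 1)) ` ann {Fam \<beta> l}"
proof
  fix x assume "x \<in> Gam.span {Fam \<beta> 1}"
  then obtain f where f: "x = f \<circle> Fam \<beta> 1" by (auto simp: span_singleton_dact)
  obtain k where k: "l = Suc k" using l by (cases l) auto
  have s: "s = Suc (s - 1)" using s_pos by simp
  have a: "(f * xw ^ l) \<circle> Fam \<beta> (l + 1) = x"
    using xw_power_W[of l \<beta> s] by (simp add: f dact_mult Fam_def add.commute)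
  have "xw ^ k \<circle> Fam \<beta> l = W \<beta> s"
    using xw_power_W[of k \<beta> s] by (simp add: Fam_def k add.commute)
  then have "xw ^ l \<circle> Fam \<beta> l = xw \<circle> W \<beta> s"
    by (simp add: k dact_mult)
  also have "\<dots> = 0" by (subst s) (simp only: xw_W_Suc 1)
  finally have "(f * xw ^ l) \<circle> Fam \<beta> l = 0" by (simp add: dact_mult)
  then have "f * xw ^ l \<in> ann {Fam \<beta> l}" by (simp add: ann_def)
  then show "x \<in> (\<lambda>g. g \<circle> Fam \<beta> (l + 1)) ` ann {Fam \<beta> l}" using a by blast
qed

text \<open>
  An operator annihilating \<open>F\<^sub>l\<close> splits into homogeneous parts; the vector \<open>v\<close> of values of
  the part of degree \<open>d\<close> contributes \<open>W (\<beta> v) m\<close> with \<open>m = l + s - d\<close>.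
\<close>

lemma ann_Fam_sub:
  assumes l: "l \<ge> 1"
    and step: "\<And>v m. m \<le> s \<Longrightarrow> V (l + s - m) v \<Longrightarrow> (m > 0 \<Longrightarrow> W (\<lambda>i. \<beta> i * v i) (m - 1) = 0) \<Longrightarrow>
      W (\<lambda>i. \<beta> i * v i) m \<in> Gam.span {Fam \<beta> 1}"
  shows "(\<lambda>g. g \<circle> Fam \<beta> (l + 1)) ` ann {Fam \<beta> l} \<subseteq> Gam.span {Fam \<beta> 1}"
proof
  fix x assume "x \<in> (\<lambda>g. g \<circle> Fam \<beta> (l + 1)) ` ann {Fam \<beta> l}"
  then obtain g where g: "g \<circle> Fam \<beta> l = 0" "x = g \<circle> Fam \<beta> (l + 1)" by (auto simp: ann_def)
  define v where "v d = (\<lambda>i. Polynomial.coeff (ol i g) d)" for d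
  have z: "W (\<lambda>i. \<beta> i * v d i) (l + s - 1 - d) = 0" if "d \<le> l + s - 1" for d
    using g(1) unfolding Fam_def dact_W v_def by (rule sum_W_eq_0_D[OF _ that])
  have x: "x = (\<Sum>d\<le>l + s. W (\<lambda>i. \<beta> i * v d i) (l + s - d))"
    unfolding g(2) Fam_def dact_W v_def by simp
  show "x \<in> Gam.span {Fam \<beta> 1}"
    unfolding x
  proof (rule Gam.span_sum)
    fix d assume "d \<in> {..l + s}"
    then have d: "d \<le> l + s" by simp
    define m where "m = l + s - d"
    have dm: "d = l + s - m" using d by (simp add: m_def)
    have z': "W (\<lambda>i. \<beta> i * v d i) (m - 1) = 0" if "m > 0"
    proof -
      have "d \<le> l + s - 1" "l + s - 1 - d = m - 1" using that by (auto simp: m_def)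
      then show ?thesis using z[of d] by simp
    qed
    have "W (\<lambda>i. \<beta> i * v d i) m \<in> Gam.span {Fam \<beta> 1}"
    proof (cases "m \<le> s")
      case True
      have "V d (v d)"
        unfolding V_def v_def by (intro bexI[OF _ hcomp_in_forms[of d g]]) (simp add: coeff_on_line)
      then show ?thesis using True z' dm by (intro step) simp_all
    next
      \<comment> \<open>Here \<open>m - 1 \<ge> s\<close>, so the vanishing in degree
        \<open>m - 1\<close> already forces the weights themselves to be 0.\<close>
      case False
      then have "\<beta> i * v d i = 0" if "i \<in> {1..r}" for i
        using W_full_eq_0[OF z'] that by simp
      then have "W (\<lambda>i. \<beta> i * v d i) m = 0" by (rule W_zero)
      then show ?thesis by (simp add: Gam.span_zero)
    qed
    then show "W (\<lambda>i. \<beta> i * v d i) (l + s - d) \<in> Gam.span {Fam \<beta> 1}" by (simp add: m_def)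
  qed
qed

text \<open>For \<open>m \<le> s\<close> the degree \<open>2 * s - m\<close> is at least
  \<open>s\<close>, so any vector \<open>v\<close> consists of the values of such a form. Condition
  (2) at level \<open>s\<close> thus contains what \<open>ann_Fam_sub\<close> demands at every
  level.\<close>

lemma G_admissible_family_Fam_iff:
  "G_admissible_family xw (Fam \<beta>) \<longleftrightarrow>
    W \<beta> (s - 1) = 0 \<and> Gam.span {Fam \<beta> 1} = (\<lambda>g. g \<circle> Fam \<beta> (s + 1)) ` ann {Fam \<beta> s}"
proof -
  have s: "s = Suc (s - 1)" using s_pos by simp
  have F1: "xw \<circle> Fam \<beta> 1 = W \<beta> (s - 1)"
    unfolding Fam_def using xw_W_Suc[of \<beta> "s - 1"] s_pos by simp
  have Fl: "xw \<circle> Fam \<beta> l = Fam \<beta> (l - 1)" if "l > 1" for l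
  proof -
    have "l + s - 1 = Suc (l - 1 + s - 1)" using that s_pos by simp
    then show ?thesis unfolding Fam_def using xw_W_Suc by metis
  qed
  show ?thesis
  proof
    assume G: "G_admissible_family xw (Fam \<beta>)"
    then show "W \<beta> (s - 1) = 0 \<and> Gam.span {Fam \<beta> 1} = (\<lambda>g. g \<circle> Fam \<beta> (s + 1)) ` ann {Fam \<beta> s}"
      unfolding G_admissible_family_def ann_span_singleton using F1 s_pos by (metis One_nat_def Suc_leI)
  next
    assume H: "W \<beta> (s - 1) = 0 \<and> Gam.span {Fam \<beta> 1} = (\<lambda>g. g \<circle> Fam \<beta> (s + 1)) ` ann {Fam \<beta> s}"
    have "(\<lambda>g. g \<circle> Fam \<beta> (l + 1)) ` ann {Fam \<beta> l} \<subseteq> Gam.span {Fam \<beta> 1}" if l: "l \<ge> 1" for l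
    proof (rule ann_Fam_sub[OF l])
      fix v m assume m: "m \<le> s" and W: "m > 0 \<Longrightarrow> W (\<lambda>i. \<beta> i * v i) (m - 1) = 0"
      obtain g where g: "g \<in> forms (2 * s - m)" "\<And>i. i \<in> {1..r} \<Longrightarrow> peval g (P i) = v i"
      proof -
        have "V (2 * s - m) v" using m by (intro V_full) simp
        then show thesis using that unfolding V_def by blast
      qed
      have ev: "W (\<lambda>i. \<beta> i * peval g (P i)) n = W (\<lambda>i. \<beta> i * v i) n" for n
        using g(2) by (intro W_cong) simp
      have "g \<circle> Fam \<beta> s = 0"
      proof (cases "m > 0")
        case True
        then have "2 * s - m \<le> s + s - 1" "s + s - 1 - (2 * s - m) = m - 1" using m by auto
        then show ?thesis unfolding Fam_def dact_W_forms[OF g(1)] using ev W[OF True] by simp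
      next
        \<comment> \<open>For \<open>m = 0\<close> the operator has degree \<open>2 * s\<close>, one
          more than \<open>Fam \<beta> s\<close>, and kills it for degree reasons.\<close>
        case False
        then have "\<not> 2 * s - m \<le> s + s - 1" using s_pos by simp
        then show ?thesis unfolding Fam_def dact_W_forms[OF g(1)] by simp
      qed
      then have "g \<in> ann {Fam \<beta> s}" by (simp add: ann_def)
      then have "g \<circle> Fam \<beta> (s + 1) \<in> Gam.span {Fam \<beta> 1}" using H by blast
      moreover have "g \<circle> Fam \<beta> (s + 1) = W (\<lambda>i. \<beta> i * v i) m"
      proof -
        have "2 * s - m \<le> s + 1 + s - 1" "s + 1 + s - 1 - (2 * s - m) = m" using m by auto
        then show ?thesis unfolding Fam_def dact_W_forms[OF g(1)] using ev by simp
      qed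
      ultimately show "W (\<lambda>i. \<beta> i * v i) m \<in> Gam.span {Fam \<beta> 1}" by simp
    qed
    then have "\<forall>l\<ge>1. (\<lambda>g. g \<circle> Fam \<beta> (l + 1)) ` ann (Gam.span {Fam \<beta> l}) = Gam.span {Fam \<beta> 1}"
      unfolding ann_span_singleton using Fam_1_sub H by blast
    then show "G_admissible_family xw (Fam \<beta>)"
      unfolding G_admissible_family_def using F1 Fl H by simp
  qed
qed

end

section \<open>Duality modulo \<open>xw\<close> and the equivalence with admissibility\<close>

lemma ex_functional_separating:
  fixes U :: "('v::finite, 'k::field) mpoly set"
  assumes U: "mpoly.subspace U" and f: "f \<notin> U"
  shows "\<exists>l. (\<forall>c x. l (Const c * x) = c * l x) \<and> (\<forall>x y. l (x - y) = l x - l y) \<and> (\<forall>x\<in>U. l x = 0) \<and> l f = (1 :: 'k)"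
proof -
  interpret k: vector_space "(*) :: 'k \<Rightarrow> 'k \<Rightarrow> 'k" by unfold_locales (auto simp: algebra_simps)
  interpret pair: vector_space_pair "\<lambda>c. (*) (Const c :: ('v, 'k) mpoly)" "(*) :: 'k \<Rightarrow> 'k \<Rightarrow> 'k" ..
  obtain B where B: "B \<subseteq> U" "mpoly.independent B" "U \<subseteq> mpoly.span B"
    using mpoly.maximal_independent_subset[of U] by blast
  have span: "mpoly.span B = U" using B U by (intro subset_antisym mpoly.span_minimal)
  then have "mpoly.independent (insert f B)" using B f mpoly.independent_insertI by blast
  then obtain l where l: "Vector_Spaces.linear (\<lambda>c. (*) (Const c :: ('v, 'k) mpoly)) (*) l"
      "\<forall>x\<in>insert f B. l x = (if x = f then 1 else 0)"
    using pair.linear_independent_extend[of "insert f B" "\<lambda>x. if x = f then 1 else 0"] by blast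
  have "l x = 0" if "x \<in> U" for x
  proof (rule pair.linear_eq_0_on_span[OF l(1)])
    show "x \<in> mpoly.span B" using span that by simp
    show "l b = 0" if "b \<in> B" for b using l(2) that f B by auto
  qed
  moreover have "l (Const c * x) = c * l x" "l (x - y) = l x - l y" for c x y
    using pair.linear_scale[OF l(1)] pair.linear_diff[OF l(1)] by blast+
  moreover have "l f = 1" using l(2) by simp
  ultimately show ?thesis by (intro exI[of _ l] conjI allI ballI)
qed

text \<open>A nonconstant monomial of \<open>C\<close> would be detected by the operator with the
  same exponents.\<close>

lemma dact_killed_imp_Const:
  fixes C :: "('v::finite, 'k::field_char_0) mpoly"
  assumes "\<And>n. Poly_Mapping.lookup n 0 = 0 \<Longrightarrow> n \<circle> C = 0"
  shows "C = Const (Poly_Mapping.lookup C 0)"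
proof (rule poly_mapping_eqI)
  fix m
  show "Poly_Mapping.lookup C m = Poly_Mapping.lookup (Const (Poly_Mapping.lookup C 0)) m"
  proof (cases "m = 0")
    case False
    then have "Poly_Mapping.lookup (Poly_Mapping.single m (1::'k)) 0 = 0" by (simp add: lookup_single)
    from assms[OF this] have "Poly_Mapping.lookup (Poly_Mapping.single m 1 \<circle> C) 0 = 0" by simp
    then show ?thesis
      using False diff_coeff_self_pos[of m] unfolding lookup_dact_single_0 by (simp add: lookup_Const)
  qed (simp add: lookup_Const)
qed

lemma ring_ideal_contains_m0_multiples:
  fixes a :: "('v::finite, 'k::comm_ring_1) mpoly"
  assumes Q: "ring_ideal Q" and v: "\<And>v. Var v * a \<in> Q" and n: "Poly_Mapping.lookup n 0 = 0"
  shows "n * a \<in> Q"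
proof -
  have mono: "Poly_Mapping.single m c * a \<in> Q" if m: "m \<noteq> 0" for m c
  proof -
    obtain d where "mdegree m = Suc d" using m mdegree_eq_0_iff[of m] by (cases "mdegree m") auto
    then obtain v m' where m': "m = Poly_Mapping.single v 1 + m'" by (rule exponent_Suc_split)
    have "Poly_Mapping.single m c = Poly_Mapping.single m' c * Var v"
      by (simp add: Var_def mult_single m' add.commute)
    then have "Poly_Mapping.single m c * a = Poly_Mapping.single m' c * (Var v * a)" by (simp add: mult.assoc)
    then show ?thesis using Q v unfolding ring_ideal_def by metis
  qed
  have "(\<Sum>m\<in>K. Poly_Mapping.single m (Poly_Mapping.lookup n m) * a) \<in> Q" if "finite K" "0 \<notin> K" for K
    using that
  proof (induction K rule: finite_induct)
    case empty
    then show ?case using Q by (simp add: ring_ideal_def)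
  next
    case (insert m K)
    then have "Poly_Mapping.single m (Poly_Mapping.lookup n m) * a \<in> Q" by (intro mono) auto
    then show ?case using insert Q unfolding ring_ideal_def by simp
  qed
  from this[OF finite_keys[of n]] n have "(\<Sum>m\<in>Poly_Mapping.keys n. Poly_Mapping.single m (Poly_Mapping.lookup n m) * a) \<in> Q"
    by (simp add: in_keys_iff)
  then show ?thesis unfolding sum_distrib_right[symmetric] mpoly_eq_sum_single[of n, symmetric] .
qed

context point_set
begin

text \<open>Multiplying by \<open>xw\<close> does not change values at the points, so modulo
  \<open>IX\<close> the multiples of \<open>xw\<close> in degree \<open>Suc e\<close> are the forms
  whose values occur in degree \<open>e\<close>. This turns questions on \<open>JX\<close> into
  questions on \<open>V\<close>.\<close>

lemma JX_forms_Suc_iff: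
  assumes f: "f \<in> forms (Suc e)"
  shows "f \<in> JX \<longleftrightarrow> V e (\<lambda>i. peval f (P i))"
proof
  assume "f \<in> JX"
  then obtain h where h: "f - h * xw \<in> IX" by (auto simp: JX_def)
  have "peval f (P i) = peval (hcomp e h) (P i)" if i: "i \<in> {1..r}" for i
  proof -
    have "ol i f = [:0, 1:] * ol i h"
      using h i unfolding IX_def by (simp add: on_line_diff on_line_mult on_line_X[OF i] del: mult_pCons_left mult_pCons_right)
    then have "Polynomial.coeff (ol i f) (Suc e) = Polynomial.coeff (ol i h) e" by simp
    then show ?thesis by (simp add: on_line_forms[OF f] coeff_on_line)
  qed
  then show "V e (\<lambda>i. peval f (P i))" unfolding V_def by (metis hcomp_in_forms)
next
  assume "V e (\<lambda>i. peval f (P i))"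
  then obtain g where g: "g \<in> forms e" "\<And>i. i \<in> {1..r} \<Longrightarrow> peval g (P i) = peval f (P i)" by (auto simp: V_def)
  have "g * xw \<in> forms (Suc e)" using forms_mult[OF g(1) forms_Var[of w]] by simp
  then have "f - g * xw \<in> IX"
    using forms_diff[OF f] by (subst forms_IX_iff) (auto simp: peval_diff peval_mult P_w g)
  then show "f \<in> JX" unfolding JX_def by blast
qed

lemma lookup_0_JX: "f \<in> JX \<Longrightarrow> Poly_Mapping.lookup f 0 = 0"
proof -
  assume "f \<in> JX"
  then obtain h where h: "f - h * xw \<in> IX" by (auto simp: JX_def)
  then have "ol 1 (f - h * xw) = 0" using r_pos unfolding IX_def by blast
  then have "ol 1 f = ol 1 h * [:0, 1:]"
    unfolding on_line_diff on_line_mult on_line_X[OF r_pos] by simp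
  then have "poly (ol 1 f) 0 = 0" by simp
  then show ?thesis by (simp only: poly_on_line_0)
qed

lemma hcomp_JX: "f \<in> JX \<Longrightarrow> hcomp d f \<in> JX"
proof (cases d)
  case 0
  assume "f \<in> JX"
  then have "hcomp 0 f = 0"
    using forms_0_eq_Const[OF hcomp_in_forms[of 0 f]] lookup_0_JX by (simp add: lookup_hcomp)
  then show ?thesis using 0 ring_ideal_JX by (simp add: ring_ideal_def)
next
  case (Suc e)
  assume "f \<in> JX"
  then obtain h where h: "f - h * xw \<in> IX" by (auto simp: JX_def)
  have "peval (hcomp (Suc e) f) (P i) = peval (hcomp e h) (P i)" if i: "i \<in> {1..r}" for i
  proof -
    have "ol i f = [:0, 1:] * ol i h"
      using h i unfolding IX_def by (simp add: on_line_diff on_line_mult on_line_X[OF i] del: mult_pCons_left mult_pCons_right)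
    then have "Polynomial.coeff (ol i f) (Suc e) = Polynomial.coeff (ol i h) e" by simp
    then show ?thesis by (simp add: coeff_on_line)
  qed
  then have "V e (\<lambda>i. peval (hcomp (Suc e) f) (P i))" unfolding V_def by (metis hcomp_in_forms)
  then show ?thesis using JX_forms_Suc_iff[OF hcomp_in_forms] Suc by blast
qed

lemma JX_sum: "(\<And>i. i \<in> A \<Longrightarrow> f i \<in> JX) \<Longrightarrow> (\<Sum>i\<in>A. f i) \<in> JX"
  using ring_ideal_JX unfolding ring_ideal_def by (induction A rule: infinite_finite_induct) auto

lemma subspace_JX: "mpoly.subspace JX"
  using ring_ideal_JX unfolding ring_ideal_def by (auto intro!: mpoly.subspaceI)

lemma JX_separation:
  assumes f: "f \<in> forms d" "f \<notin> JX"
  shows "\<exists>v. (\<forall>x\<in>forms d. x \<in> JX \<longrightarrow> (\<Sum>i=1..r. v i * peval x (P i)) = 0) \<and> (\<Sum>i=1..r. v i * peval f (P i)) \<noteq> 0"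
proof -
  obtain l where l: "\<And>c x. l (Const c * x) = c * l x" "\<And>x y. l (x - y) = l x - l y"
    "\<And>x. x \<in> JX \<Longrightarrow> l x = 0" "l f = (1 :: 'k)"
    using ex_functional_separating[OF subspace_JX f(2)] by blast
  have "\<exists>v. \<forall>x\<in>forms d. l x = (\<Sum>i=1..r. v i * peval x (P i))"
    by (rule ex_W_functional[OF l(1,2)]) (use l(3) IX_sub_JX in blast)
  then obtain v where v: "\<And>x. x \<in> forms d \<Longrightarrow> l x = (\<Sum>i=1..r. v i * peval x (P i))" by blast
  then show ?thesis using l(3,4) f(1) by (metis zero_neq_one)
qed

text \<open>Some homogeneous part of \<open>f\<close> is outside \<open>JX\<close>, and weights
  \<open>v\<close> separate it from \<open>JX\<close>. As these vanish on multiples of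
  \<open>xw\<close>, the element \<open>W v d\<close> is killed by \<open>xw\<close>, but its
  pairing with \<open>f\<close> is not 0.\<close>

lemma JX_double_annihilator:
  assumes f: "f \<notin> JX"
  shows "\<exists>G\<in>inv_sys IX. xw \<circle> G = 0 \<and> f \<circle> G \<noteq> 0"
proof -
  obtain N where N: "f = (\<Sum>d\<le>N. hcomp d f)" using mpoly_eq_sum_hcomp[of f] by blast
  obtain d where d: "hcomp d f \<notin> JX" using JX_sum[of "{..N}" "\<lambda>d. hcomp d f"] N f by metis
  obtain v where v: "\<And>x. x \<in> forms d \<Longrightarrow> x \<in> JX \<Longrightarrow> (\<Sum>i=1..r. v i * peval x (P i)) = 0"
    "(\<Sum>i=1..r. v i * peval (hcomp d f) (P i)) \<noteq> 0"
    using JX_separation[OF hcomp_in_forms d] by blast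
  have "xw \<circle> W v d = 0"
  proof (cases d)
    case 0
    then show ?thesis by (simp add: xw_W_0)
  next
    case (Suc e)
    have "W v e = 0"
      unfolding W_eq_0_iff
    proof
      fix g :: "('v, 'k) mpoly" assume g: "g \<in> forms e"
      have "g * xw \<in> forms d" using forms_mult[OF g forms_Var[of w]] Suc by simp
      moreover have "g * xw \<in> JX" using ring_ideal_JX xw_mem_JX unfolding ring_ideal_def by blast
      ultimately have "(\<Sum>i=1..r. v i * peval (g * xw) (P i)) = 0" by (rule v(1))
      moreover have "(\<Sum>i=1..r. v i * peval (g * xw) (P i)) = (\<Sum>i=1..r. v i * peval g (P i))"
        by (intro sum.cong) (auto simp: peval_mult P_w)
      ultimately show "(\<Sum>i=1..r. v i * peval g (P i)) = 0" by simp
    qed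
    then show ?thesis using Suc xw_W_Suc by simp
  qed
  moreover have "Poly_Mapping.lookup (f \<circle> W v d) 0 \<noteq> 0"
    unfolding pairing_W coeff_on_line by (rule v(2))
  then have "f \<circle> W v d \<noteq> 0" by auto
  ultimately show ?thesis using W_in_inv_sys by blast
qed

text \<open>The family is arbitrary, not one of the \<open>Fam \<beta>\<close>, so only the two
  defining conditions are available.\<close>

lemma G_admissible_imp_socle_1dim:
  assumes "G_admissible xw (inv_sys IX)"
  shows socle_1dim
proof -
  obtain F where M: "inv_sys IX = Gam.span (F ` {1..})" and F: "G_admissible_family xw F"
    using assms unfolding G_admissible_def by blast
  have Fl: "\<And>l. l > 1 \<Longrightarrow> xw \<circle> F l = F (l - 1)" and F1: "xw \<circle> F 1 = 0" and
    Fa: "\<And>l. l \<ge> 1 \<Longrightarrow> (\<lambda>g. g \<circle> F (l + 1)) ` ann {F l} = Gam.span {F 1}"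
    using F unfolding G_admissible_family_def ann_span_singleton by (elim conjE; simp)+
  have pow: "xw ^ k \<circle> F (l + k) = F l" if "l \<ge> 1" for l k
  proof (induction k)
    case (Suc k)
    have "xw \<circle> F (l + Suc k) = F (l + k)" using Fl[of "l + Suc k"] that by simp
    then show ?case unfolding power_Suc2 dact_mult using Suc by simp
  qed simp
  \<comment> \<open>Each \<open>F l\<close> is the image of every later member under a power of
    \<open>xw\<close>, so finitely many generators can be replaced by a single one and
    \<open>T\<close> is the whole module.\<close>
  define T where "T = {G. \<exists>l\<ge>1. \<exists>g. G = g \<circle> F l}"
  have raise: "\<exists>g. G = g \<circle> F l'" if "G = g \<circle> F l" "l \<ge> 1" "l \<le> l'" for G g l l'
  proof -
    have "G = (g * xw ^ (l' - l)) \<circle> F l'" using pow[OF that(2), of "l' - l"] that by (simp add: dact_mult)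
    then show ?thesis by blast
  qed
  have "Gam.subspace T"
  proof (rule Gam.subspaceI)
    show "0 \<in> T" unfolding T_def using dact_zero_left[of "F 1"] by (metis (mono_tags, lifting) mem_Collect_eq order_refl)
    show "c \<circle> x \<in> T" if x: "x \<in> T" for c x
    proof -
      obtain l g where "l \<ge> 1" "x = g \<circle> F l" using x by (auto simp: T_def)
      then have "l \<ge> 1" "c \<circle> x = (c * g) \<circle> F l" by simp_all
      then show ?thesis unfolding T_def by blast
    qed
    fix x y assume "x \<in> T" "y \<in> T"
    then obtain l g l' g' where x: "x = g \<circle> F l" "l \<ge> 1" and y: "y = g' \<circle> F l'" "l' \<ge> 1" by (auto simp: T_def)
    obtain h h' where "x = h \<circle> F (max l l')" "y = h' \<circle> F (max l l')"
      using raise[OF x, of "max l l'"] raise[OF y, of "max l l'"] by auto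
    then have "x + y = (h + h') \<circle> F (max l l')" by (simp add: dact_add_left)
    then show "x + y \<in> T" unfolding T_def using x(2) by (metis (mono_tags, lifting) max.coboundedI1 mem_Collect_eq)
  qed
  moreover have "F ` {1..} \<subseteq> T"
    unfolding T_def using dact_one by (metis (mono_tags, lifting) atLeast_iff image_subsetI mem_Collect_eq)
  ultimately have MT: "inv_sys IX \<subseteq> T" unfolding M by (intro Gam.span_minimal)
  \<comment> \<open>If \<open>xw\<close> kills \<open>g \<circle> F l\<close>, then \<open>g\<close>
    annihilates \<open>F (l - 1)\<close>, and condition (ii) at level \<open>l - 1\<close> puts
    \<open>g \<circle> F l\<close> into the span of \<open>F 1\<close>.\<close>
  have ker: "\<exists>g. G = g \<circle> F 1" if G: "G \<in> inv_sys IX" "xw \<circle> G = 0" for G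
  proof -
    obtain l g where g: "l \<ge> 1" "G = g \<circle> F l" using G(1) MT by (auto simp: T_def)
    show ?thesis
    proof (cases "l = 1")
      case False
      then have l: "l - 1 \<ge> 1" "l > 1" using g by auto
      have "g \<circle> F (l - 1) = 0" using G(2) Fl[OF l(2)] dact_commute[of xw g "F l"] unfolding g(2) by simp
      then have "g \<in> ann {F (l - 1)}" by (simp add: ann_def)
      then have "G \<in> (\<lambda>g. g \<circle> F (l - 1 + 1)) ` ann {F (l - 1)}" using g l by auto
      then show ?thesis unfolding Fa[OF l(1)] span_singleton_dact by blast
    qed (use g in blast)
  qed
  have F1M: "F 1 \<in> inv_sys IX" unfolding M by (rule Gam.span_base) simp
  have JX_iff: "f \<circle> F 1 = 0 \<longleftrightarrow> f \<in> JX" for f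
  proof
    assume f: "f \<circle> F 1 = 0"
    show "f \<in> JX"
    proof (rule ccontr)
      assume "f \<notin> JX"
      then obtain G where G: "G \<in> inv_sys IX" "xw \<circle> G = 0" "f \<circle> G \<noteq> 0" using JX_double_annihilator by blast
      then obtain g where "G = g \<circle> F 1" using ker by blast
      then have "f \<circle> G = g \<circle> (f \<circle> F 1)" using dact_commute by blast
      then show False using G(3) unfolding f by simp
    qed
  next
    assume "f \<in> JX"
    then obtain h where h: "f - h * xw \<in> IX" by (auto simp: JX_def)
    then have "(f - h * xw) \<circle> F 1 = 0" using F1M unfolding inv_sys_def by blast
    moreover have "(h * xw) \<circle> F 1 = 0" unfolding dact_mult F1 by simp
    ultimately show "f \<circle> F 1 = 0" unfolding dact_diff_left by simp
  qed
  show ?thesis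
    unfolding socle_1dim_def
  proof (intro allI impI)
    fix a b assume ab: "\<forall>n\<in>m0. n * a \<in> JX" "\<forall>n\<in>m0. n * b \<in> JX" "a \<notin> JX"
    have const: "x \<circle> F 1 = Const (Poly_Mapping.lookup (x \<circle> F 1) 0)" if x: "\<forall>n\<in>m0. n * x \<in> JX" for x
    proof (rule dact_killed_imp_Const)
      fix n :: "('v, 'k) mpoly" assume "Poly_Mapping.lookup n 0 = 0"
      then have "(n * x) \<circle> F 1 = 0" using x JX_iff by blast
      then show "n \<circle> (x \<circle> F 1) = 0" unfolding dact_mult .
    qed
    define ca cb where "ca = Poly_Mapping.lookup (a \<circle> F 1) 0" and "cb = Poly_Mapping.lookup (b \<circle> F 1) 0"
    have a: "a \<circle> F 1 = Const ca" and b: "b \<circle> F 1 = Const cb" using const ab by (auto simp: ca_def cb_def)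
    have "ca \<noteq> 0" using ab(3) JX_iff[of a] a by auto
    then have "(b - Const (cb / ca) * a) \<circle> F 1 = 0"
      unfolding dact_diff_left dact_mult a b dact_Const_left by (simp flip: Const_mult)
    then show "\<exists>c. b - Const c * a \<in> JX" using JX_iff by blast
  qed
qed

text \<open>The socle modulo \<open>JX\<close> sits in degree \<open>s\<close> alone, so
  multiplication into degree \<open>s\<close> is a perfect pairing modulo \<open>JX\<close>. The
  weights come from the functional on forms of degree \<open>s\<close> with kernel
  \<open>JX\<close>.\<close>

lemma socle_1dim_imp_ex:
  assumes soc: socle_1dim
  shows "\<exists>\<beta>. (\<forall>i\<in>{1..r}. \<beta> i \<noteq> 0) \<and> W \<beta> (s - 1) = 0 \<and>
    Gam.span {Fam \<beta> 1} = (\<lambda>g. g \<circle> Fam \<beta> (s + 1)) ` ann {Fam \<beta> s}"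
proof -
  have s: "s = Suc (s - 1)" using s_pos by simp
  have J: "\<And>x y. x \<in> JX \<Longrightarrow> y \<in> JX \<Longrightarrow> x + y \<in> JX" "\<And>a x. x \<in> JX \<Longrightarrow> a * x \<in> JX" "0 \<in> JX"
    using ring_ideal_JX by (auto simp: ring_ideal_def)
  have JX_s: "f \<in> JX \<longleftrightarrow> V (s - 1) (\<lambda>i. peval f (P i))" if "f \<in> forms s" for f
    using JX_forms_Suc_iff[of f "s - 1"] that s by simp
  have V_cong: "V d v \<longleftrightarrow> V d v'" if "\<And>i. i \<in> {1..r} \<Longrightarrow> v i = v' i" for d v v'
    using that unfolding V_def by auto
  \<comment> \<open>All forms of degree \<open>s\<close> are socle elements: multiplied by a
    variable, their values occur already in degree \<open>s\<close>, where all vectors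
    occur.\<close>
  have top: "n * x \<in> JX" if x: "x \<in> forms s" and n: "n \<in> m0" for n x
  proof (rule ring_ideal_contains_m0_multiples[OF ring_ideal_JX])
    show "Var u * x \<in> JX" for u
      using JX_forms_Suc_iff[of "Var u * x" s] forms_mult[OF forms_Var x] V_full by simp
    show "Poly_Mapping.lookup n 0 = 0" using n by simp
  qed
  \<comment> \<open>A form of degree \<open>s\<close> whose values do not occur in degree
    \<open>s - 1\<close> is outside \<open>JX\<close> and thus spans the socle.\<close>
  obtain v0 where v0: "\<not> V (s - 1) v0" using not_full by blast
  obtain a where a: "a \<in> forms s" "\<And>i. i \<in> {1..r} \<Longrightarrow> peval a (P i) = v0 i" using full[of v0] unfolding V_def by blast
  have aJ: "a \<notin> JX" using JX_s[OF a(1)] v0 V_cong[of "\<lambda>i. peval a (P i)" v0] a(2) by blast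
  \<comment> \<open>A socle element is a multiple of \<open>a\<close> modulo the homogeneous ideal
    \<open>JX\<close>; in degree \<open>d < s\<close> this leaves only 0.\<close>
  have low: "f \<in> JX" if f: "f \<in> forms d" "d < s" "\<And>u. Var u * f \<in> JX" for f d
  proof -
    have "\<forall>n\<in>m0. n * f \<in> JX" using ring_ideal_contains_m0_multiples[OF ring_ideal_JX f(3)] by blast
    then obtain c where c: "f - Const c * a \<in> JX" using soc top[OF a(1)] aJ unfolding socle_1dim_def by blast
    have "hcomp d (f - Const c * a) = f"
      using f(2) by (simp add: hcomp_diff hcomp_Const_mult hcomp_forms[OF f(1)] hcomp_forms[OF a(1)])
    then show ?thesis using hcomp_JX[OF c, of d] by simp
  qed
  obtain \<beta> where \<beta>: "\<And>x. x \<in> forms s \<Longrightarrow> x \<in> JX \<Longrightarrow> (\<Sum>i=1..r. \<beta> i * peval x (P i)) = 0"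
    "(\<Sum>i=1..r. \<beta> i * peval a (P i)) \<noteq> 0"
    using JX_separation[OF a(1) aJ] by blast
  \<comment> \<open>Since every form of degree \<open>s\<close> is a multiple of \<open>a\<close>
    modulo \<open>JX\<close> and \<beta> does not kill \<open>a\<close>, the kernel is not larger
    than \<open>JX\<close>.\<close>
  have JX_\<beta>: "x \<in> JX" if x: "x \<in> forms s" "(\<Sum>i=1..r. \<beta> i * peval x (P i)) = 0" for x
  proof -
    obtain c where c: "x - Const c * a \<in> JX"
      using soc top[OF a(1)] top[OF x(1)] aJ unfolding socle_1dim_def by blast
    have "x - Const c * a \<in> forms s" by (intro forms_diff x forms_Const_mult a)
    from \<beta>(1)[OF this c] have "(\<Sum>i=1..r. \<beta> i * peval x (P i)) - c * (\<Sum>i=1..r. \<beta> i * peval a (P i)) = 0"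
      by (simp add: peval_diff peval_mult algebra_simps sum_subtractf sum_distrib_left)
    then have "c = 0" using x(2) \<beta>(2) by simp
    then show ?thesis using c by simp
  qed
  have one: "W \<beta> (s - 1) = 0"
    unfolding W_eq_0_iff
  proof
    fix g :: "('v, 'k) mpoly" assume g: "g \<in> forms (s - 1)"
    have "xw * g \<in> forms s" using forms_mult[OF forms_Var[of w] g] s by simp
    moreover have "xw * g \<in> JX" using J(2)[OF xw_mem_JX, of g] by (simp add: mult.commute)
    ultimately have "(\<Sum>i=1..r. \<beta> i * peval (xw * g) (P i)) = 0" by (rule \<beta>(1))
    moreover have "(\<Sum>i=1..r. \<beta> i * peval (xw * g) (P i)) = (\<Sum>i=1..r. \<beta> i * peval g (P i))"
      by (intro sum.cong) (auto simp: peval_mult P_w)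
    ultimately show "(\<Sum>i=1..r. \<beta> i * peval g (P i)) = 0" by simp
  qed
  \<comment> \<open>A zero weight puts a form with the indicator vector of point \<open>i\<close> as
    values into the kernel, so this vector first occurs in a degree \<open>d < s\<close>. A form
    realizing it there would be a new socle element.\<close>
  have nz: "\<beta> i \<noteq> 0" if i: "i \<in> {1..r}" for i
  proof
    assume 0: "\<beta> i = 0"
    let ?e = "\<lambda>l. if l = i then 1 else 0 :: 'k"
    have Vs: "V s ?e" using V_full by blast
    define d where "d = (LEAST d. V d ?e)"
    have Vd: "V d ?e" unfolding d_def using Vs by (rule LeastI)
    have "V (s - 1) ?e"
    proof -
      obtain f where f: "f \<in> forms s" "\<forall>l\<in>{1..r}. peval f (P l) = ?e l" using Vs unfolding V_def by blast
      have "(\<Sum>l=1..r. \<beta> l * peval f (P l)) = 0" using f(2) 0 by (intro sum.neutral) auto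
      then have "f \<in> JX" using f JX_\<beta> by blast
      then show ?thesis using JX_s[OF f(1)] V_cong[of "\<lambda>i. peval f (P i)" ?e] f(2) by blast
    qed
    then have ds: "d < s" unfolding d_def using Least_le[of "\<lambda>d. V d ?e" "s - 1"] s_pos by simp
    obtain f where f: "f \<in> forms d" "\<And>l. l \<in> {1..r} \<Longrightarrow> peval f (P l) = ?e l" using Vd unfolding V_def by blast
    \<comment> \<open>A variable scales the indicator vector by the coordinate \<open>P i u\<close>,
      so the product takes values that already occur in degree \<open>d\<close>.\<close>
    have "Var u * f \<in> JX" for u
    proof -
      have "V d (\<lambda>l. peval (Var u * f) (P l))"
        unfolding V_def using f by (intro bexI[of _ "Const (P i u) * f"] forms_Const_mult) (auto simp: peval_mult)
      then show ?thesis using JX_forms_Suc_iff[of "Var u * f" d] forms_mult[OF forms_Var f(1)] by simp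
    qed
    then have fJ: "f \<in> JX" using low[OF f(1) ds] by blast
    show False
    proof (cases d)
      case 0
      have "f = Const (Poly_Mapping.lookup f 0)" using f(1) 0 forms_0_eq_Const by blast
      then have "f = 0" using lookup_0_JX[OF fJ] by simp
      then show False using f(2)[OF i] by simp
    next
      case (Suc e)
      then have "V e (\<lambda>l. peval f (P l))" using JX_forms_Suc_iff[of f e] f(1) fJ by simp
      then have "V e ?e" using V_cong[of "\<lambda>l. peval f (P l)" ?e] f(2) by blast
      then have "d \<le> e" unfolding d_def by (rule Least_le)
      then show False using Suc by simp
    qed
  qed
  \<comment> \<open>Nondegeneracy of the pairing, by descending induction on \<open>d\<close>: the
    products with variables are in \<open>JX\<close>, and \<open>low\<close> excludes new socle
    elements.\<close>
  have perfect: "f \<in> JX" if "f \<in> forms d" "d \<le> s" "\<And>g. g \<in> forms (s - d) \<Longrightarrow> f * g \<in> JX" for f d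
    using that
  proof (induction "s - d" arbitrary: f d)
    case 0
    then have "f * Const 1 \<in> JX" by (metis forms_Const)
    then show ?case by simp
  next
    case (Suc k)
    have d: "d < s" using Suc.hyps by simp
    have "Var u * f \<in> JX" for u
    proof (rule Suc.hyps(1)[of "Suc d"])
      show "k = s - Suc d" using Suc.hyps(2) by simp
      show "Var u * f \<in> forms (Suc d)" using forms_mult[OF forms_Var Suc.prems(1)] by simp
      show "Suc d \<le> s" using d by simp
      fix g :: "('v, 'k) mpoly" assume g: "g \<in> forms (s - Suc d)"
      have "Var u * g \<in> forms (s - d)" using forms_mult[OF forms_Var[of u] g] d by (simp add: Suc_diff_Suc)
      then have "f * (Var u * g) \<in> JX" by (rule Suc.prems(3))
      then show "Var u * f * g \<in> JX" by (simp add: mult_ac)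
    qed
    then show ?case using low[OF Suc.prems(1) d] by blast
  qed
  have "(\<lambda>g. g \<circle> Fam \<beta> (s + 1)) ` ann {Fam \<beta> s} \<subseteq> Gam.span {Fam \<beta> 1}"
  proof (rule ann_Fam_sub)
    show "1 \<le> s" using s_pos by simp
    fix v m assume m: "m \<le> s" and Wm: "m > 0 \<Longrightarrow> W (\<lambda>i. \<beta> i * v i) (m - 1) = 0"
    \<comment> \<open>Otherwise the least degree \<open>e\<close> of \<open>v\<close> satisfies
      \<open>s - e \<le> m - 1\<close>, so by \<open>Wm\<close> a form with values \<open>v\<close>
      is orthogonal to all forms of degree \<open>s - e\<close>. By \<open>perfect\<close> it is in
      \<open>JX\<close>, and \<open>v\<close> would occur in degree \<open>e - 1\<close>.\<close>
    have "V (s - m) v"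
    proof (cases "m > 0")
      case False
      then show ?thesis using V_full by simp
    next
      case True
      define e where "e = (LEAST d. V d v)"
      have Vs: "V s v" using V_full by blast
      have Ve: "V e v" unfolding e_def using Vs by (rule LeastI)
      have es: "e \<le> s" unfolding e_def using Vs by (rule Least_le)
      have "e \<le> s - m"
      proof (rule ccontr)
        assume "\<not> e \<le> s - m"
        then have em: "s - e \<le> m - 1" "e > 0" using m by auto
        obtain f where f: "f \<in> forms e" "\<And>i. i \<in> {1..r} \<Longrightarrow> peval f (P i) = v i" using Ve unfolding V_def by blast
        have "f * g \<in> JX" if g: "g \<in> forms (s - e)" for g
        proof (rule JX_\<beta>)
          show "f * g \<in> forms s" using forms_mult[OF f(1) g] es by simp
          have "V (s - e) (\<lambda>i. peval g (P i))" using g unfolding V_def by blast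
          then have "V (m - 1) (\<lambda>i. peval g (P i))" by (rule V_mono[OF _ em(1)])
          then obtain g' where g': "g' \<in> forms (m - 1)" "\<And>i. i \<in> {1..r} \<Longrightarrow> peval g' (P i) = peval g (P i)"
            unfolding V_def by blast
          have "(\<Sum>i=1..r. \<beta> i * peval (f * g) (P i)) = (\<Sum>i=1..r. (\<beta> i * v i) * peval g' (P i))"
            using f(2) g'(2) by (intro sum.cong) (auto simp: peval_mult)
          also have "\<dots> = 0" using Wm[OF True] g'(1) unfolding W_eq_0_iff by blast
          finally show "(\<Sum>i=1..r. \<beta> i * peval (f * g) (P i)) = 0" .
        qed
        then have "f \<in> JX" by (rule perfect[OF f(1) es])
        then have "V (e - 1) (\<lambda>i. peval f (P i))" using JX_forms_Suc_iff[of f "e - 1"] f(1) em(2) by simp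
        then have "V (e - 1) v" using V_cong[of "\<lambda>i. peval f (P i)" v] f(2) by blast
        then have "e \<le> e - 1" unfolding e_def by (rule Least_le)
        then show False using em by simp
      qed
      then show ?thesis using V_mono[OF Ve] by blast
    qed
    then obtain h where h: "h \<in> forms (s - m)" "\<And>i. i \<in> {1..r} \<Longrightarrow> peval h (P i) = v i" unfolding V_def by blast
    have "h \<circle> Fam \<beta> 1 = W (\<lambda>i. \<beta> i * peval h (P i)) m"
      unfolding Fam_def dact_W_forms[OF h(1)] using m by simp
    also have "\<dots> = W (\<lambda>i. \<beta> i * v i) m" using h(2) by (intro W_cong) simp
    finally show "W (\<lambda>i. \<beta> i * v i) m \<in> Gam.span {Fam \<beta> 1}" unfolding span_singleton_dact by (metis rangeI)
  qed
  then have "Gam.span {Fam \<beta> 1} = (\<lambda>g. g \<circle> Fam \<beta> (s + 1)) ` ann {Fam \<beta> s}"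
    using Fam_1_sub[OF one] s_pos by (intro subset_antisym) simp_all
  then show ?thesis using nz one by blast
qed

lemma G_admissible_if_ex:
  assumes "\<exists>\<beta>. (\<forall>i\<in>{1..r}. \<beta> i \<noteq> 0) \<and> W \<beta> (s - 1) = 0 \<and>
    Gam.span {Fam \<beta> 1} = (\<lambda>g. g \<circle> Fam \<beta> (s + 1)) ` ann {Fam \<beta> s}"
  shows "G_admissible xw (inv_sys IX)"
proof -
  obtain \<beta> where nz: "\<forall>i\<in>{1..r}. \<beta> i \<noteq> 0" and
    adm: "W \<beta> (s - 1) = 0 \<and> Gam.span {Fam \<beta> 1} = (\<lambda>g. g \<circle> Fam \<beta> (s + 1)) ` ann {Fam \<beta> s}"
    using assms by (elim exE conjE) (rule that, assumption, rule conjI)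
  have "inv_sys IX = Gam.span (Fam \<beta> ` {1..})" using nz by (intro span_Fam[symmetric]) blast
  moreover have "G_admissible_family xw (Fam \<beta>)" unfolding G_admissible_family_Fam_iff by (rule adm)
  ultimately show ?thesis unfolding G_admissible_def by (intro exI[of _ "Fam \<beta>"] conjI)
qed

lemma gorenstein_iff_G_admissible:
  "arithmetically_gorenstein (P ` {1..r}) \<longleftrightarrow> G_admissible xw (inv_sys IX)"
  unfolding gorenstein_iff_socle_1dim
  by (rule iffI[OF G_admissible_if_ex[OF socle_1dim_imp_ex] G_admissible_imp_socle_1dim])

lemma gorenstein_iff_ex:
  "arithmetically_gorenstein (P ` {1..r}) \<longleftrightarrow> (\<exists>\<beta>. (\<forall>i\<in>{1..r}. \<beta> i \<noteq> 0) \<and> W \<beta> (s - 1) = 0 \<and>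
    Gam.span {Fam \<beta> 1} = (\<lambda>g. g \<circle> Fam \<beta> (s + 1)) ` ann {Fam \<beta> s})"
  unfolding gorenstein_iff_socle_1dim
  by (rule iffI[OF socle_1dim_imp_ex G_admissible_imp_socle_1dim[OF G_admissible_if_ex]])

end

section \<open>The Hilbert function\<close>

lemma (in vector_space) subspace_eq_if_dim_eq:
  assumes A: "subspace A" "A \<subseteq> B" and B: "B \<subseteq> span T" "finite T" "dim A = dim B"
  shows "A = B"
proof (rule ccontr)
  assume "A \<noteq> B"
  then obtain b where b: "b \<in> B" "b \<notin> A" using A by blast
  obtain C where C: "C \<subseteq> A" "independent C" "A \<subseteq> span C" "card C = dim A" using basis_exists by blast
  obtain D where D: "D \<subseteq> B" "independent D" "B \<subseteq> span D" "card D = dim B" using basis_exists by blast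
  have finD: "finite D" using independent_span_bound[OF B(2) D(2)] D(1) B(1) by blast
  have finC: "finite C" using independent_span_bound[OF finD C(2)] C(1) A(2) D(3) by blast
  have sC: "span C = A" using C A by (intro subset_antisym span_minimal)
  then have "independent (insert b C)" using C b independent_insertI by blast
  moreover have "insert b C \<subseteq> span D" using b C A D by blast
  ultimately have "card (insert b C) \<le> card D" using independent_span_bound[OF finD] by blast
  moreover have "b \<notin> C" using b C by blast
  ultimately show False using finC C(4) D(4) B(3) by simp
qed

lemma (in vector_space) independent_span_disjoint:
  assumes "independent C" "A \<subseteq> C" "B \<subseteq> C" "A \<inter> B = {}"
  shows "span A \<inter> span B = {0}"
proof -
  have "x = 0" if x: "x \<in> span A" "x \<in> span B" for x
  proof -
    have "representation C x = representation A x" "representation C x = representation B x"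
      using representation_extend assms x by blast+
    then have "representation C x b = 0" for b
      using representation_ne_zero[of A x b] representation_ne_zero[of B x b] assms(4) by (metis IntI empty_iff)
    moreover have "x \<in> span C" using x assms(2) span_mono by blast
    ultimately show "x = 0" using sum_nonzero_representation_eq[OF assms(1), of x] by simp
  qed
  then show ?thesis using span_zero by blast
qed

text \<open>Rank-nullity for a finite-dimensional subspace of a space of any dimension: a basis of
  the kernel is extended to \<open>U\<close>, and the added vectors map to a basis of the
  image.\<close>

lemma (in vector_space_pair) dim_image_eq_diff:
  assumes f: "Vector_Spaces.linear s1 s2 f" and U: "vs1.subspace U" "U \<subseteq> vs1.span T" "finite T"
  shows "vs2.dim (f ` U) = vs1.dim U - vs1.dim {x \<in> U. f x = 0}"
proof -
  obtain B where B: "B \<subseteq> {x \<in> U. f x = 0}" "vs1.independent B" "{x \<in> U. f x = 0} \<subseteq> vs1.span B"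
    "card B = vs1.dim {x \<in> U. f x = 0}" using vs1.basis_exists by blast
  obtain C where C: "B \<subseteq> C" "C \<subseteq> U" "vs1.independent C" "U \<subseteq> vs1.span C"
    using vs1.maximal_independent_subset_extend[of B U] B by blast
  have finC: "finite C" using vs1.independent_span_bound[OF U(3) C(3)] C(2) U(2) by blast
  have dimU: "vs1.dim U = card C" using vs1.dim_unique[OF C(2,4,3)] by simp
  let ?D = "C - B"
  have indD: "vs1.independent ?D" using C(3) vs1.independent_mono by blast
  have inj: "inj_on f (vs1.span ?D)"
  proof -
    have "x = 0" if x: "x \<in> vs1.span ?D" "f x = 0" for x
    proof -
      have "vs1.span ?D \<subseteq> U" using C(2) U(1) by (intro vs1.span_minimal) auto
      then have "x \<in> vs1.span B" using x B(3) by blast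
      then have "x \<in> vs1.span ?D \<inter> vs1.span B" using x by blast
      moreover have "vs1.span ?D \<inter> vs1.span B = {0}"
        using vs1.independent_span_disjoint[OF C(3), of ?D B] C(1) by blast
      ultimately show ?thesis by blast
    qed
    then show ?thesis using linear_inj_on_iff_eq_0[OF f vs1.subspace_span] by blast
  qed
  have indf: "vs2.independent (f ` ?D)" by (rule linear_independent_injective_image[OF f indD inj])
  have span: "f ` U \<subseteq> vs2.span (f ` ?D)"
  proof
    fix y assume "y \<in> f ` U"
    then obtain x where x: "x \<in> U" "y = f x" by blast
    have "x \<in> vs1.span (?D \<union> B)" using x C(1,4) by (metis Diff_partition Un_commute subsetD)
    then obtain a b where ab: "x = a + b" "a \<in> vs1.span ?D" "b \<in> vs1.span B"
      unfolding vs1.span_Un by blast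
    have "f b = 0" using linear_eq_0_on_span[OF f, of B b] ab(3) B(1) by blast
    then have "y = f a" using x ab linear_add[OF f] by simp
    then show "y \<in> vs2.span (f ` ?D)" using ab(2) linear_span_image[OF f] by blast
  qed
  have "vs2.dim (f ` U) = card (f ` ?D)"
    using C(2) by (intro vs2.dim_unique[OF _ span indf]) auto
  also have "\<dots> = card ?D" by (rule card_image[OF inj_on_subset[OF inj vs1.span_superset]])
  also have "\<dots> = card C - card B" by (rule card_Diff_subset[OF finite_subset[OF C(1) finC] C(1)])
  finally show ?thesis using dimU B(4) by simp
qed

lemma finite_mdegree: "finite {m :: 'v::finite \<Rightarrow>\<^sub>0 nat. mdegree m = t}"
proof (induction t)
  case 0
  then show ?case by (simp add: mdegree_eq_0_iff)
next
  case (Suc t)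
  have "{m :: 'v \<Rightarrow>\<^sub>0 nat. mdegree m = Suc t} \<subseteq> (\<Union>v. (\<lambda>m. Poly_Mapping.single v 1 + m) ` {m. mdegree m = t})"
  proof
    fix m :: "'v \<Rightarrow>\<^sub>0 nat" assume "m \<in> {m. mdegree m = Suc t}"
    then obtain v m' where "m = Poly_Mapping.single v 1 + m'" "mdegree m' = t"
      using exponent_Suc_split[of m t] by blast
    then show "m \<in> (\<Union>v. (\<lambda>m. Poly_Mapping.single v 1 + m) ` {m. mdegree m = t})" by blast
  qed
  then show ?case using Suc by (rule finite_subset[OF _ finite_UN_I[OF finite finite_imageI]])
qed

lemma forms_sub_span: "forms t \<subseteq> mpoly.span ((\<lambda>m. Poly_Mapping.single m (1::'k::field)) ` {m :: 'v::finite \<Rightarrow>\<^sub>0 nat. mdegree m = t})"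
proof
  fix f :: "('v, 'k) mpoly" assume f: "f \<in> forms t"
  have "(\<Sum>m\<in>Poly_Mapping.keys f. Const (Poly_Mapping.lookup f m) * Poly_Mapping.single m 1) \<in>
      mpoly.span ((\<lambda>m. Poly_Mapping.single m 1) ` {m. mdegree m = t})"
    using f by (intro mpoly.span_sum mpoly.span_scale mpoly.span_base) (auto simp: forms_def)
  moreover have "(\<Sum>m\<in>Poly_Mapping.keys f. Const (Poly_Mapping.lookup f m) * Poly_Mapping.single m 1) = f"
    by (subst (3) mpoly_eq_sum_single[of f]) (simp add: Const_def mult_single)
  ultimately show "f \<in> mpoly.span ((\<lambda>m. Poly_Mapping.single m 1) ` {m. mdegree m = t})" by simp
qed

lemma subspace_forms: "mpoly.subspace (forms t)"
  by (rule mpoly.subspaceI) (auto intro: forms_add forms_Const_mult)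

context point_config
begin

text \<open>The vector of values is encoded by the coefficients at 1 to \<open>r\<close> of a
  polynomial, a type that already carries scalar multiplication.\<close>

definition ev :: "('v, 'k) mpoly \<Rightarrow> 'k poly"
  where "ev f = (\<Sum>i=1..r. Polynomial.monom (peval f (P i)) i)"

lemma coeff_ev: "Polynomial.coeff (ev f) i = (if i \<in> {1..r} then peval f (P i) else 0)"
  by (auto simp: ev_def coeff_sum)

lemma V_iff_ev: "V t v \<longleftrightarrow> (\<Sum>i=1..r. Polynomial.monom (v i) i) \<in> ev ` forms t"
proof
  assume "V t v"
  then obtain f where f: "f \<in> forms t" "\<forall>i\<in>{1..r}. peval f (P i) = v i" by (auto simp: V_def)
  then have "ev f = (\<Sum>i=1..r. Polynomial.monom (v i) i)" unfolding ev_def by (intro sum.cong) auto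
  then show "(\<Sum>i=1..r. Polynomial.monom (v i) i) \<in> ev ` forms t" using f(1) by (metis imageI)
next
  assume "(\<Sum>i=1..r. Polynomial.monom (v i) i) \<in> ev ` forms t"
  then obtain f where f: "f \<in> forms t" "(\<Sum>i=1..r. Polynomial.monom (v i) i) = ev f" by blast
  have "v i = peval f (P i)" if i: "i \<in> {1..r}" for i
  proof -
    have "Polynomial.coeff (\<Sum>i=1..r. Polynomial.monom (v i) i) i = v i" using i by (simp add: coeff_sum)
    then show ?thesis unfolding f(2) coeff_ev using i by simp
  qed
  then show "V t v" using f(1) unfolding V_def by metis
qed

text \<open>By rank-nullity the Hilbert function is the dimension of the space of value vectors.
  These spaces increase with the degree, so equal dimensions mean equal spaces.\<close>

lemma hilbert_fun_eq_iff:
  "hilbert_fun (P ` {1..r}) t = hilbert_fun (P ` {1..r}) (Suc t) \<longleftrightarrow> (\<forall>v. V (Suc t) v \<longrightarrow> V t v)"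
proof -
  interpret k: vector_space "Polynomial.smult :: 'k \<Rightarrow> 'k poly \<Rightarrow> 'k poly"
    by unfold_locales (auto simp: smult_add_left smult_add_right)
  interpret pair: vector_space_pair "\<lambda>c. (*) (Const c :: ('v, 'k) mpoly)" "Polynomial.smult :: 'k \<Rightarrow> 'k poly \<Rightarrow> 'k poly" ..
  have lin: "Vector_Spaces.linear (\<lambda>c. (*) (Const c :: ('v, 'k) mpoly)) Polynomial.smult ev"
    by unfold_locales (auto intro!: poly_eqI simp: coeff_ev peval_add peval_mult)
  have fin: "finite ((\<lambda>m. Poly_Mapping.single m (1::'k)) ` {m :: 'v \<Rightarrow>\<^sub>0 nat. mdegree m = t})" for t
    using finite_mdegree by (rule finite_imageI)
  have ker: "vanishing_ideal (P ` {1..r}) \<inter> forms t = {f \<in> forms t. ev f = 0}" for t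
  proof -
    have "ev f = 0 \<longleftrightarrow> (\<forall>i\<in>{1..r}. peval f (P i) = 0)" for f
      unfolding poly_eq_iff coeff_ev by (simp only: coeff_0) metis
    then show ?thesis unfolding vanishing_ideal_eq by (auto simp: IX_def on_line_forms)
  qed
  have H: "hilbert_fun (P ` {1..r}) t = k.dim (ev ` forms t)" for t
    unfolding hilbert_fun_def ker
    by (rule pair.dim_image_eq_diff[OF lin subspace_forms forms_sub_span fin, symmetric])
  have sub: "ev ` forms t \<subseteq> ev ` forms (Suc t)"
  proof
    fix y assume "y \<in> ev ` forms t"
    then obtain f where f: "f \<in> forms t" "y = ev f" by blast
    have "ev (xw * f) = ev f" by (rule poly_eqI) (simp add: coeff_ev peval_mult P_w)
    moreover have "xw * f \<in> forms (Suc t)" using forms_mult[OF forms_Var f(1)] by simp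
    ultimately show "y \<in> ev ` forms (Suc t)" using f(2) by (metis imageI)
  qed
  have "(\<forall>v. V (Suc t) v \<longrightarrow> V t v) \<longleftrightarrow> ev ` forms (Suc t) \<subseteq> ev ` forms t"
  proof
    assume V: "\<forall>v. V (Suc t) v \<longrightarrow> V t v"
    show "ev ` forms (Suc t) \<subseteq> ev ` forms t"
    proof
      fix y assume y: "y \<in> ev ` forms (Suc t)"
      then obtain f where f: "y = ev f" by blast
      then have e: "y = (\<Sum>i=1..r. Polynomial.monom (peval f (P i)) i)" by (simp only: ev_def)
      show "y \<in> ev ` forms t" using V[rule_format, of "\<lambda>i. peval f (P i)"] y unfolding V_iff_ev e by blast
    qed
  next
    assume "ev ` forms (Suc t) \<subseteq> ev ` forms t"
    then show "\<forall>v. V (Suc t) v \<longrightarrow> V t v" unfolding V_iff_ev by blast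
  qed
  also have "\<dots> \<longleftrightarrow> ev ` forms t = ev ` forms (Suc t)" using sub by blast
  also have "\<dots> \<longleftrightarrow> k.dim (ev ` forms t) = k.dim (ev ` forms (Suc t))"
  proof
    assume d: "k.dim (ev ` forms t) = k.dim (ev ` forms (Suc t))"
    show "ev ` forms t = ev ` forms (Suc t)"
    proof (rule k.subspace_eq_if_dim_eq[OF _ sub _ finite_imageI[OF fin] d])
      show "k.subspace (ev ` forms t)" by (rule pair.linear_subspace_image[OF lin subspace_forms])
      show "ev ` forms (Suc t) \<subseteq> k.span (ev ` (\<lambda>m. Poly_Mapping.single m 1) ` {m. mdegree m = Suc t})"
        unfolding pair.linear_span_image[OF lin] by (rule image_mono[OF forms_sub_span])
    qed
  qed simp
  finally show ?thesis unfolding H by blast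
qed

text \<open>Lagrange interpolation: for each point, the product of \<open>r - 1\<close> linear
  forms, each vanishing at one of the other points but not at this one.\<close>

lemma V_large: "V (r - 1) v"
proof -
  have "\<forall>i\<in>{1..r}. \<forall>l\<in>{1..r}. i \<noteq> l \<longrightarrow> (\<exists>u. P i u \<noteq> P l u)"
    using inj_P by (metis ext inj_onD)
  then obtain u where u: "\<And>i l. i \<in> {1..r} \<Longrightarrow> l \<in> {1..r} \<Longrightarrow> i \<noteq> l \<Longrightarrow> P i (u i l) \<noteq> P l (u i l)" by metis
  define g where "g i l = Var (u i l) - Const (P l (u i l)) * xw" for i l
  define f where "f i = (\<Prod>l\<in>{1..r} - {i}. g i l)" for i
  have g: "g i l \<in> forms 1" for i l
    unfolding g_def by (intro forms_diff forms_Var forms_Const_mult)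
  have prod_forms: "(\<Prod>l\<in>A. g i l) \<in> forms (card A)" if "finite A" for A i
    using that
  proof (induction A rule: finite_induct)
    case empty
    then show ?case using forms_Const[of "1::'k"] by simp
  next
    case (insert a A)
    then show ?case using forms_mult[OF g insert(3), of i a] by simp
  qed
  have ff: "f i \<in> forms (r - 1)" if "i \<in> {1..r}" for i
    unfolding f_def using prod_forms[of "{1..r} - {i}" i] that by simp
  have gv: "peval (g i l) (P j) = P j (u i l) - P l (u i l)" if "j \<in> {1..r}" for i l j
    using P_w[OF that] by (simp add: g_def peval_diff peval_mult)
  have f0: "peval (f i) (P j) = 0" if "i \<in> {1..r}" "j \<in> {1..r}" "i \<noteq> j" for i j
    unfolding f_def peval_prod using that by (intro prod_zero) (auto intro!: bexI[of _ j] simp: gv)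
  have f1: "peval (f i) (P i) \<noteq> 0" if "i \<in> {1..r}" for i
    unfolding f_def peval_prod using that u gv[OF that] by (auto simp: prod_zero_iff)
  define h where "h = (\<Sum>i=1..r. Const (v i / peval (f i) (P i)) * f i)"
  have "h \<in> forms (r - 1)" unfolding h_def by (intro forms_sum forms_Const_mult ff)
  moreover have "peval h (P j) = v j" if j: "j \<in> {1..r}" for j
  proof -
    have "peval h (P j) = (\<Sum>i=1..r. if i = j then v j else 0)"
      unfolding h_def peval_sum peval_mult peval_Const using j f0 f1 by (intro sum.cong) auto
    then show ?thesis using j by simp
  qed
  ultimately show ?thesis unfolding V_def by blast
qed

text \<open>From \<open>s\<close> on the Hilbert function is constant, so all vectors occur in
  degree \<open>s\<close> because they do in degree \<open>s + r\<close>. The jump at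
  \<open>s\<close> leaves some vector out of degree \<open>s - 1\<close>.\<close>

lemma point_set_if_socle_degree:
  assumes card: "card (UNIV :: 'v set) \<ge> 2" and hyp: "\<not> in_hyperplane (P ` {1..r})"
    and soc: "socle_degree (P ` {1..r}) s"
  shows "point_set P w r s"
proof -
  have desc: "V (Suc t) v \<Longrightarrow> V t v" if t: "t \<ge> s" for t v
  proof -
    have "hilbert_diff (P ` {1..r}) (Suc t) = 0" using soc t by (simp add: socle_degree_def)
    then have "hilbert_fun (P ` {1..r}) t = hilbert_fun (P ` {1..r}) (Suc t)" by (simp add: hilbert_diff_def)
    then show "V (Suc t) v \<Longrightarrow> V t v" unfolding hilbert_fun_eq_iff by blast
  qed
  have full: "V s v" for v
  proof -
    have "V (s + k) v \<Longrightarrow> V s v" for k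
    proof (induction k)
      case (Suc k)
      then show ?case using desc[of "s + k" v] by simp
    qed simp
    moreover have "V (s + r) v" using V_mono[OF V_large, of "s + r" v] by simp
    ultimately show ?thesis by blast
  qed
  have pos: "s > 0"
  proof (rule ccontr)
    assume "\<not> s > 0"
    \<comment> \<open>If constants took all values, some coordinate \<open>x\<close> other than
      \<open>w\<close> would have the same value \<open>c\<close> at all points, which would then
      lie on the hyperplane where it equals \<open>c\<close> times coordinate
      \<open>w\<close>.\<close>
    then have V0: "V 0 v" for v using full[of v] by simp
    obtain x where x: "x \<noteq> w"
    proof -
      have "\<not> UNIV \<subseteq> {w}" using card card_mono[of "{w}" "UNIV :: 'v set"] by auto
      then show thesis using that by blast
    qed
    obtain f where f: "f \<in> forms 0" "\<forall>i\<in>{1..r}. peval f (P i) = P i x" using V0[of "\<lambda>i. P i x"] unfolding V_def by blast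
    define c where "c = Poly_Mapping.lookup f 0"
    have "f = Const c" unfolding c_def by (rule forms_0_eq_Const[OF f(1)])
    then have P: "P i x = c" if "i \<in> {1..r}" for i using f(2) that by simp
    let ?c = "\<lambda>v. if v = x then 1 else if v = w then - c else 0"
    have "?c \<noteq> (\<lambda>_. 0)" by (metis zero_neq_one)
    moreover have "(\<Sum>v\<in>UNIV. ?c v * a v) = 0" if a: "a \<in> P ` {1..r}" for a
    proof -
      obtain i where i: "i \<in> {1..r}" "a = P i" using a by blast
      have "(\<Sum>v\<in>UNIV. ?c v * a v) = (\<Sum>v\<in>{x, w}. ?c v * a v)" by (rule sum.mono_neutral_right) auto
      also have "\<dots> = 0" using x i P[OF i(1)] P_w[OF i(1)] by simp
      finally show ?thesis .
    qed
    ultimately show False using hyp unfolding in_hyperplane_def by blast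
  qed
  have "\<exists>v. \<not> V (s - 1) v"
  proof (rule ccontr)
    assume "\<nexists>v. \<not> V (s - 1) v"
    then have "hilbert_fun (P ` {1..r}) (s - 1) = hilbert_fun (P ` {1..r}) (Suc (s - 1))"
      unfolding hilbert_fun_eq_iff by blast
    then show False using soc pos by (simp add: socle_degree_def hilbert_diff_def)
  qed
  then show ?thesis using full pos point_config_axioms by (auto simp: point_set_def point_set_axioms_def)
qed

end

theorem proposition3p13:
  fixes P :: "nat \<Rightarrow> 'v::finite \<Rightarrow> 'k::{alg_closed_field, field_char_0}"
    and w :: 'v
    and r s :: nat
    and \<alpha> :: "nat \<Rightarrow> 'k"
    and \<X> :: "('v \<Rightarrow> 'k) set"
    and F :: "(nat \<Rightarrow> 'k) \<Rightarrow> nat \<Rightarrow> ('v, 'k) mpoly"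
    and M :: "('v, 'k) mpoly set"
  assumes "card (UNIV :: 'v set) \<ge> 2"
    and "\<X> = P ` {1..r}"
    and "inj_on P {1..r}"
    and "\<forall>i\<in>{1..r}. P i w = 1"
    and "\<not> in_hyperplane \<X>"
    and "socle_degree \<X> s"
    and "\<forall>i\<in>{1..r}. \<alpha> i \<noteq> 0"
    and "\<forall>\<beta> t. F \<beta> t =
      Const (1 / fact (t + s - 1)) * (\<Sum>i=1..r. Const (\<beta> i) * lin_form (P i) ^ (t + s - 1))"
    and "M = Gam.span (F \<alpha> ` {1..})"
  shows "M = inv_sys (vanishing_ideal \<X>) \<and>
    (G_admissible_family (Var w) (F \<alpha>) \<longleftrightarrow>
      (\<Sum>i=1..r. Const (\<alpha> i) * lin_form (P i) ^ (s - 1)) = 0 \<and>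
      Gam.span {F \<alpha> 1} = (\<lambda>g. g \<circle> F \<alpha> (s + 1)) ` ann {F \<alpha> s}) \<and>
    (arithmetically_gorenstein \<X> \<longleftrightarrow> G_admissible (Var w) M) \<and>
    (arithmetically_gorenstein \<X> \<longleftrightarrow>
      (\<exists>\<beta>. (\<forall>i\<in>{1..r}. \<beta> i \<noteq> 0) \<and>
        (\<Sum>i=1..r. Const (\<beta> i) * lin_form (P i) ^ (s - 1)) = 0 \<and>
        Gam.span {F \<beta> 1} = (\<lambda>g. g \<circle> F \<beta> (s + 1)) ` ann {F \<beta> s}))"
proof -
  have "point_config P w r" by unfold_locales (use assms in auto)
  then interpret point_set P w r s
    using assms by (intro point_config.point_set_if_socle_degree) auto
  have W: "W \<beta> n = Const (1 / fact n) * (\<Sum>i=1..r. Const (\<beta> i) * lin_form (P i) ^ n)" for \<beta> n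
    unfolding W_def divpow_def sum_distrib_left by (intro sum.cong refl) (rule mult.left_commute)
  have F: "F = Fam"
    by (intro ext) (simp add: assms(8) Fam_def W)
  have sum_eq_0: "(\<Sum>i=1..r. Const (\<beta> i) * lin_form (P i) ^ (s - 1)) = 0 \<longleftrightarrow> W \<beta> (s - 1) = 0" for \<beta>
    unfolding W using mpoly.scale_eq_0_iff[of "1 / fact (s - 1)"] by simp
  have M: "M = inv_sys IX"
    unfolding assms(9) F using span_Fam[of \<alpha>] assms(7) by blast
  show ?thesis
    unfolding M assms(2) vanishing_ideal_eq F sum_eq_0
    using G_admissible_family_Fam_iff gorenstein_iff_G_admissible gorenstein_iff_ex by (intro conjI refl)
qed

end
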